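(* Let $F:\Omega\times I\to\Omega\times I$, $F(\omega,x)=(\tau(\omega),f_{\omega_0}(x))$, be a one-step skew product over the Bernoulli shift $\tau$ on $(\Omega,\mathscr F,\mathbb P)=(\mathcal A^{\mathbb N},\mathcal F^{\mathbb N},p^{\mathbb N})$. Assume that for every $x\in(0,1)$ the sequence $\{X^x_n\}_{n\ge0}$, $X^x_n(\omega)=f^n_\omega(x)$, is conjugate to a random walk on $\mathbb Z$ or $\mathbb R$ with mean zero and positive finite variance. Then: (1) for every $x\in(0,1)$ the tail $\sigma$-algebra $\mathcal T(\{X^x_n\}_{n\ge1})$ is trivial (every element has $\mathbb P$-probability $0$ or $1$); (2) for every $\gamma,x\in(0,1)$, $$\lim_{n\to\infty}\mathbb P\Big(\frac1n\sum_{j=0}^{n-1}\mathbf 1_{I_i(\gamma)}(f^j_\omega(x))\le\alpha\Big)=\frac2\pi\arcsin\sqrt\alpha\quad\text{for every }\alpha\in(0,1)\text{ and }i=0,1,$$ where $I_0(\gamma)=[0,\gamma]$ and $I_1(\gamma)=[\gamma,1]$. (3) Moreover, if $F$ also satisfies (b) for every $\omega\in\Omega$, $f_\omega$ restricts to a measurable, monotonically increasing ($x\le y\Rightarrow f_\omega(x)\le f_\omega(y)$) map $f_\omega:(0,1)\to(0,1)$, and (c) for every $x\in(0,1)$ there exist $\alpha,\beta\in\Omega$ with $f_\alpha(x)<x<f_\beta(x)$, then for every $x\in(0,1)$ $$\liminf_{n\to\infty}\frac1n\sum_{j=0}^{n-1}f^j_\omega(x)\le\gamma_0<\gamma_1\le\limsup_{n\to\infty}\frac1n\sum_{j=0}^{n-1}f^j_\omega(x)\quad\text{for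 }\mathbb P\text{-a.e. }\omega\in\Omega,$$ where $\gamma_0<\gamma_1$ are constants for which $F$ satisfies the pointwise-fiber fluctuation law, and $F$ exhibits historical behavior for $(\mathbb P\times\mathrm{Leb})$-almost every point.
   Context: $I=[0,1]$ with Lebesgue measure $\mathrm{Leb}$. $\mathcal A$ is an at most countable alphabet, $\mathcal F$ its discrete $\sigma$-algebra, $p$ a probability measure on $\mathcal A$ with $p(a)>0$ for every $a\in\mathcal A$; $\tau:\Omega\to\Omega$ is the one-sided shift on $\Omega=\mathcal A^{\mathbb N}$. The fiber maps $f_a:I\to I$, $a\in\mathcal A$, are measurable; $f_\omega=f_{\omega_0}$, $f^0_\omega=\mathrm{id}$, $f^n_\omega=f_{\omega_{n-1}}\circ\dots\circ f_{\omega_0}$. Conjugate to a random walk: let $G$ be $\mathbb Z$ or $\mathbb R$ and $\mathcal O(x)=\{X^x_n(\omega):\omega\in\Omega,\ n\ge0\}$. The sequence $\{X^x_n\}_{n\ge0}$ is conjugate to a $G$-valued random walk if there is a strictly monotonic injection $h:\mathcal O(x)\to G$ such that, with $t=h(x)$ and $S^t_n(\omega)=h(f^n_\omega(x))$, the step random variables $Y^t_n=S^t_n-S^t_{n-1}$, $n\ge1$, are independent and identically distributed. The mean and variance of the random walk are the mean and variance of $Y^t_1$. Tail $\sigma$-algebra: $\mathcal T(\{X_n\}_{n\ge1})=\bigcap_{m\ge1}\sigma(X_m,X_{m+1},\dots)$. Pointwise-fiber fluctuation law with constants $\gamma_0,\gamma_1\in(0,1)$: there are $x_0,x_1\in(0,1)$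 such that $\liminf_{n\to\infty}\mathbb P\big(\frac1n\sum_{j=0}^{n-1}\mathbf 1_{I_i(\gamma_i)}(f^j_\omega(x_i))\le\alpha\big)<1$ for every $\alpha\in(0,1)$ and $i=0,1$. Historical behavior for $(\mathbb P\times\mathrm{Leb})$-a.e. point: for $(\mathbb P\times\mathrm{Leb})$-a.e. $(\omega,x)$ there is a continuous $\varphi:I\to\mathbb R$ such that $\lim_{n\to\infty}\frac1n\sum_{j=0}^{n-1}\varphi(f^j_\omega(x))$ does not exist.
   Formalization: In (2) the law is claimed only for γ strictly between inf O(x) and sup O(x); for other γ the occupation frequencies are constant and the law fails. Under (b) and (c) it is proved for all γ, x in (0,1). *)

theory Defs
  imports "HOL-Probability.Probability"
begin

definition bernoulli :: "'a pmf \<Rightarrow> (nat \<Rightarrow> 'a) measure" where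
  "bernoulli p = Pi\<^sub>M UNIV (\<lambda>_. measure_pmf p)"

definition skew_product :: "('a \<Rightarrow> real \<Rightarrow> real) \<Rightarrow> (nat \<Rightarrow> 'a) \<times> real \<Rightarrow> (nat \<Rightarrow> 'a) \<times> real" where
  "skew_product f = (\<lambda>(\<omega>, x). (\<lambda>k. \<omega> (Suc k), f (\<omega> 0) x))"

primrec fiber :: "('a \<Rightarrow> real \<Rightarrow> real) \<Rightarrow> nat \<Rightarrow> (nat \<Rightarrow> 'a) \<Rightarrow> real \<Rightarrow> real" where
  "fiber f 0 \<omega> = id"
| "fiber f (Suc n) \<omega> = f (\<omega> n) \<circ> fiber f n \<omega>"

lemma skew_product_iterate:
  "(skew_product f ^^ n) (\<omega>, x) = (\<lambda>k. \<omega> (k + n), fiber f n \<omega> x)"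
  by (induction n) (auto simp: skew_product_def)

definition orbit :: "('a \<Rightarrow> real \<Rightarrow> real) \<Rightarrow> real \<Rightarrow> real set" where
  "orbit f x = {fiber f n \<omega> x | n \<omega>. True}"

(* rw_step f h x n is the increment Y_{n+1} = S_{n+1} - S_n of S_n = h(f^n_omega(x)),
   so the increments Y_1, Y_2, ... are indexed from n = 0. *)
definition rw_step ::
  "('a \<Rightarrow> real \<Rightarrow> real) \<Rightarrow> (real \<Rightarrow> real) \<Rightarrow> real \<Rightarrow> nat \<Rightarrow> (nat \<Rightarrow> 'a) \<Rightarrow> real" where
  "rw_step f h x n \<omega> = h (fiber f (Suc n) \<omega> x) - h (fiber f n \<omega> x)"

(* The group G is a subset of the reals; only the values of h on the orbit matter. *)
definition random_walk_conjugacy ::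
  "'a pmf \<Rightarrow> ('a \<Rightarrow> real \<Rightarrow> real) \<Rightarrow> real \<Rightarrow> real set \<Rightarrow> (real \<Rightarrow> real) \<Rightarrow> bool" where
  "random_walk_conjugacy p f x G h \<longleftrightarrow>
     (strict_mono_on (orbit f x) h \<or> strict_antimono_on (orbit f x) h) \<and>
     h ` orbit f x \<subseteq> G \<and>
     prob_space.indep_vars (bernoulli p) (\<lambda>_. borel) (rw_step f h x) UNIV \<and>
     (\<forall>n. distr (bernoulli p) borel (rw_step f h x n) = distr (bernoulli p) borel (rw_step f h x 0))"

(* Square integrability expresses finiteness of the variance; integrability is stated
   explicitly because the Bochner integral of a non-integrable function is 0. *)
definition conjugate_to_centered_random_walk ::
  "'a pmf \<Rightarrow> ('a \<Rightarrow> real \<Rightarrow> real) \<Rightarrow> real \<Rightarrow> bool" where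
  "conjugate_to_centered_random_walk p f x \<longleftrightarrow>
     (\<exists>G \<in> {\<int>, UNIV}. \<exists>h. random_walk_conjugacy p f x G h \<and>
        integrable (bernoulli p) (rw_step f h x 0) \<and>
        integrable (bernoulli p) (\<lambda>\<omega>. (rw_step f h x 0 \<omega>)\<^sup>2) \<and>
        prob_space.expectation (bernoulli p) (rw_step f h x 0) = 0 \<and>
        prob_space.variance (bernoulli p) (rw_step f h x 0) > 0)"

definition tail_sigma :: "'b measure \<Rightarrow> (nat \<Rightarrow> 'b \<Rightarrow> real) \<Rightarrow> 'b set set" where
  "tail_sigma M X =
     prob_space.tail_events M (\<lambda>n. {X (Suc n) -` B \<inter> space M | B. B \<in> sets borel})"

definition fiber_average ::
  "('a \<Rightarrow> real \<Rightarrow> real) \<Rightarrow> (real \<Rightarrow> real) \<Rightarrow> real \<Rightarrow> nat \<Rightarrow> (nat \<Rightarrow> 'a) \<Rightarrow> real" where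
  "fiber_average f \<phi> x n \<omega> = (\<Sum>j<n. \<phi> (fiber f j \<omega> x)) / real n"

definition end_interval :: "nat \<Rightarrow> real \<Rightarrow> real set" where
  "end_interval i \<gamma> = (if i = 0 then {0..\<gamma>} else {\<gamma>..1})"

definition occupation_prob ::
  "'a pmf \<Rightarrow> ('a \<Rightarrow> real \<Rightarrow> real) \<Rightarrow> nat \<Rightarrow> real \<Rightarrow> real \<Rightarrow> real \<Rightarrow> nat \<Rightarrow> real" where
  "occupation_prob p f i \<gamma> x \<alpha> n =
     \<P>(\<omega> in bernoulli p. fiber_average f (indicator (end_interval i \<gamma>)) x n \<omega> \<le> \<alpha>)"

(* A conjugacy to a random walk only sees the order of the orbit, so the orbit of x may be
   bounded away from 0 or from 1. If gamma is not strictly between the infimum and the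
   supremum of the orbit, the occupation frequencies are constant and this law fails. *)
definition arcsine_law ::
  "'a pmf \<Rightarrow> ('a \<Rightarrow> real \<Rightarrow> real) \<Rightarrow> real \<Rightarrow> real \<Rightarrow> bool" where
  "arcsine_law p f \<gamma> x \<longleftrightarrow>
     (\<forall>\<alpha>\<in>{0<..<1}. \<forall>i\<in>{0, 1}.
        occupation_prob p f i \<gamma> x \<alpha> \<longlonglongrightarrow> 2 / pi * arcsin (sqrt \<alpha>))"

definition pointwise_fluctuation_law ::
  "'a pmf \<Rightarrow> ('a \<Rightarrow> real \<Rightarrow> real) \<Rightarrow> real \<Rightarrow> real \<Rightarrow> bool" where
  "pointwise_fluctuation_law p f \<gamma>0 \<gamma>1 \<longleftrightarrow>
     \<gamma>0 \<in> {0<..<1} \<and> \<gamma>1 \<in> {0<..<1} \<and>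
     (\<exists>x0\<in>{0<..<1}. \<exists>x1\<in>{0<..<1}. \<forall>\<alpha>\<in>{0<..<1}.
        liminf (\<lambda>n. ereal (occupation_prob p f 0 \<gamma>0 x0 \<alpha> n)) < 1 \<and>
        liminf (\<lambda>n. ereal (occupation_prob p f 1 \<gamma>1 x1 \<alpha> n)) < 1)"

definition historical_behavior_ae ::
  "'a pmf \<Rightarrow> ('a \<Rightarrow> real \<Rightarrow> real) \<Rightarrow> bool" where
  "historical_behavior_ae p f \<longleftrightarrow>
     (AE (\<omega>, x) in bernoulli p \<Otimes>\<^sub>M restrict_space lborel {0..1}.
        \<exists>\<phi>. continuous_on {0..1} \<phi> \<and> \<not> convergent (\<lambda>n. fiber_average f \<phi> x n \<omega>))"

end

theory Submission
  imports Defs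
begin

text \<open>
The orbit of a point \<open>x\<close> is read through its conjugacy \<open>h\<close>. The values
\<open>h (X n) - h x\<close> are the partial sums of independent, identically distributed, centred steps;
multiplying \<open>h\<close> by a constant of either sign gives them variance one and makes \<open>h\<close>
increasing or decreasing, whichever is convenient. As \<open>h\<close> is injective on the countable
orbit, every question about the orbit becomes one about the walk (locale \<open>coded_walk\<close>).

Tail triviality is the Hewitt-Savage law. An event determined by the partial sums from time \<open>n\<close>
on does not notice a permutation of the first \<open>n\<close> steps, so it has the same intersection
probability with a cylinder event as with any later copy of that cylinder. Averaging over many
independent copies shows that it is independent of every cylinder, hence of itself
(\<open>hewitt_savage\<close>).

The arcsine law is the Erdos-Kac theorem for half-lines. A monotone \<open>h\<close> turns visits to an end
interval into visits to a half-line, up to a bounded window, which the walk rarely visits by the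
central limit theorem. Cut time into \<open>m\<close> long blocks. On each block the sign of the walk is
mostly its sign at the end of the block (\<open>occupation_grid_L1\<close>), and the signs at the block
ends converge to those of a Gaussian walk with \<open>m\<close> steps (\<open>grid_npos_limit\<close>). So only
the Gaussian walk has to be computed. By the identity of Sparre Andersen its number of positive
partial sums has the law of the first position of its maximum, which splits the walk into two
independent pieces. Symmetry then forces the probabilities
\<open>half_binomial k * half_binomial (m - k)\<close>. This is a mixture of binomial laws over the arcsine
distribution, and the convergence of Bernstein polynomials lets \<open>m\<close> tend to infinity.

For monotone fibre maps that move every point both ways, the orbit comes arbitrarily near to 0 and 1.
If the supremum \<open>s\<close> of the orbit were below 1, some letter \<open>b\<close> would map \<open>s\<close>, hence the
whole orbit, below a fixed orbit point. But this letter changes \<open>h\<close> by a bounded amount,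
because it has positive probability and the law of a step does not depend on the position, while
\<open>h\<close> is unbounded on the orbit (\<open>no_bounded_step\<close>). So the arcsine law holds for every
threshold. In particular the occupation frequency of an end interval exceeds any \<open>\<alpha> < 1\<close> with
a probability that stays away from 0, and tail triviality upgrades this to an upper limit 1 almost
surely. Averages along almost every orbit therefore approach values at most \<open>\<gamma>0\<close> and values at
least \<open>\<gamma>1\<close> infinitely often, for any two thresholds, and the identity function witnesses
historical behavior by Fubini.
\<close>

section \<open>Sequences of independent identically distributed variables\<close>

abbreviation iid :: "'b measure \<Rightarrow> (nat \<Rightarrow> 'b) measure"
  where "iid M \<equiv> Pi\<^sub>M UNIV (\<lambda>_. M)"

lemma prob_space_iid: "prob_space M \<Longrightarrow> prob_space (iid M)"
  by (rule prob_space_PiM)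

lemma sequence_space_iid: "prob_space M \<Longrightarrow> sequence_space M"
  unfolding sequence_space_def product_prob_space_def product_sigma_finite_def
    product_prob_space_axioms_def
  by (auto intro: prob_space_imp_sigma_finite)

lemma distr_iid_reindex:
  assumes "prob_space M" "inj \<pi>"
  shows "distr (iid M) (iid M) (\<lambda>w i. w (\<pi> i)) = iid M"
  using distr_PiM_reindex[of UNIV "\<lambda>_. M" \<pi> UNIV] assms by (simp add: restrict_def)

lemma measure_iid_reindex:
  assumes "prob_space M" "inj \<pi>" and A: "A \<in> sets (iid M)"
  shows "measure (iid M) {w \<in> space (iid M). (\<lambda>i. w (\<pi> i)) \<in> A} = measure (iid M) A"
proof -
  have "(\<lambda>w i. w (\<pi> i)) \<in> iid M \<rightarrow>\<^sub>M iid M"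
    by (intro measurable_PiM_single') (auto simp: space_PiM)
  then have "measure (distr (iid M) (iid M) (\<lambda>w i. w (\<pi> i))) A =
      measure (iid M) ((\<lambda>w i. w (\<pi> i)) -` A \<inter> space (iid M))"
    by (rule measure_distr[OF _ A])
  then show ?thesis
    by (simp add: distr_iid_reindex[OF assms(1,2)] vimage_def Int_def conj_commute)
qed

text \<open>The independence of past and future in the form in which it is used throughout: \<open>A\<close> depends on
  the first \<open>k\<close> coordinates, and \<open>B\<close> is imposed on what follows them.\<close>
lemma measure_iid_append:
  assumes "prob_space M" and A: "A \<in> sets (iid M)" and B: "B \<in> sets (iid M)"
    and loc: "\<And>w w'. w \<in> A \<Longrightarrow> w' \<in> space (iid M) \<Longrightarrow> (\<And>i. i < k \<Longrightarrow> w i = w' i) \<Longrightarrow> w' \<in> A"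
  shows "measure (iid M) {w \<in> A. (\<lambda>i. w (k + i)) \<in> B} = measure (iid M) A * measure (iid M) B"
proof -
  interpret sequence_space M by (rule sequence_space_iid) fact
  interpret SS: pair_prob_space S S ..
  have [measurable]: "(\<lambda>w i. w (k + i)) \<in> S \<rightarrow>\<^sub>M S"
    by (intro measurable_PiM_single') (auto simp: space_PiM)
  note A[measurable] B[measurable]
  have shift: "(\<lambda>i. comb_seq k a b (k + i)) = b" for a b :: "nat \<Rightarrow> 'a"
    by (simp add: comb_seq_def)
  have sp: "comb_seq k a b \<in> space S" if "a \<in> space S" "b \<in> space S" for a b
    using that by (auto simp: space_PiM comb_seq_def PiE_iff)
  have AA: "A = {w \<in> space S. w \<in> A}"
    using sets.sets_into_space[OF A] by auto
  have m: "{w \<in> A. (\<lambda>i. w (k + i)) \<in> B} \<in> sets S"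
    by (subst AA) measurable
  have comb: "comb_seq k a b \<in> A \<longleftrightarrow> a \<in> A" if "a \<in> space S" "b \<in> space S" for a b
    using that loc[of a "comb_seq k a b"] loc[of "comb_seq k a b" a] sp
    by (auto simp: comb_seq_less)
  have "measure S {w \<in> A. (\<lambda>i. w (k + i)) \<in> B} =
      measure (distr (S \<Otimes>\<^sub>M S) S (\<lambda>(w, w'). comb_seq k w w')) {w \<in> A. (\<lambda>i. w (k + i)) \<in> B}"
    by (simp add: PiM_comb_seq)
  also have "\<dots> = measure (S \<Otimes>\<^sub>M S) (A \<times> B)"
    using m comb shift sets.sets_into_space[OF A] sets.sets_into_space[OF B]
    by (subst measure_distr)
       (auto simp: space_pair_measure shift intro!: arg_cong2[where f=measure])
  also have "\<dots> = measure S A * measure S B"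
    using A B by (simp add: measure_def P.emeasure_pair_measure_Times enn2real_mult)
  finally show ?thesis .
qed

lemma distr_iid_map:
  assumes M: "prob_space M" and g[measurable]: "g \<in> M \<rightarrow>\<^sub>M N"
  shows "distr (iid M) (iid N) (\<lambda>w i. g (w i)) = iid (distr M N g)"
proof -
  interpret M: sequence_space M by (rule sequence_space_iid) fact
  interpret N: sequence_space "distr M N g"
    by (rule sequence_space_iid) (rule M.M.prob_space_distr[OF g])
  have [measurable]: "(\<lambda>w i. g (w i)) \<in> iid M \<rightarrow>\<^sub>M iid N"
    by (intro measurable_PiM_single') (auto simp: space_PiM intro!: measurable_space[OF g])
  show ?thesis
  proof (rule N.PiM_eq)
    show "sets (distr (iid M) (iid N) (\<lambda>w i. g (w i))) = sets (iid (distr M N g))"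
      by (simp cong: sets_PiM_cong)
    fix J :: "nat set" and F assume J: "finite J" and F: "\<And>j. j \<in> J \<Longrightarrow> F j \<in> sets (distr M N g)"
    have F': "j \<in> J \<Longrightarrow> F j \<in> sets N" for j using F by simp
    have eq: "prod_emb UNIV (\<lambda>_. distr M N g) J (Pi\<^sub>E J F) = prod_emb UNIV (\<lambda>_. N) J (Pi\<^sub>E J F)"
      by (simp add: prod_emb_def)
    have emb: "prod_emb UNIV (\<lambda>_. N) J (Pi\<^sub>E J F) \<in> sets (iid N)"
      using J F' by (intro sets_PiM_I) auto
    have "emeasure (distr (iid M) (iid N) (\<lambda>w i. g (w i))) (prod_emb UNIV (\<lambda>_. N) J (Pi\<^sub>E J F)) =
        emeasure (iid M) (prod_emb UNIV (\<lambda>_. M) J (\<Pi>\<^sub>E j\<in>J. g -` F j \<inter> space M))"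
      using measurable_space[OF g]
      by (subst emeasure_distr[OF _ emb]) (auto simp: prod_emb_def space_PiM PiE_UNIV_domain Pi_iff
          intro!: arg_cong2[where f=emeasure])
    also have "\<dots> = (\<Prod>j\<in>J. emeasure (distr M N g) (F j))"
      using J F' by (subst M.emeasure_PiM_emb) (auto simp: emeasure_distr)
    finally show "emeasure (distr (iid M) (iid N) (\<lambda>w i. g (w i)))
        (prod_emb UNIV (\<lambda>_. distr M N g) J (Pi\<^sub>E J F)) = (\<Prod>j\<in>J. emeasure (distr M N g) (F j))"
      unfolding eq .
  qed
qed

lemma indep_vars_iid:
  assumes "prob_space M"
  shows "prob_space.indep_vars (iid M) (\<lambda>_. M) (\<lambda>i w. w i) UNIV"
proof -
  interpret P: prob_space "iid M" by (rule prob_space_iid) fact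
  have "distr (iid M) M (\<lambda>w. w i) = M" for i
    by (rule distr_PiM_component) (use assms in auto)
  then have "(\<lambda>i. distr (iid M) M (\<lambda>w. w i)) = (\<lambda>_. M)" by (intro ext)
  then show ?thesis
    by (subst P.indep_vars_iff_distr_eq_PiM) (simp_all add: restrict_def)
qed

text \<open>Transfers statements about independent, identically distributed variables on any space to the
  space of sequences, where reindexing and splitting are available.\<close>
lemma (in prob_space) distr_indep_identical_eq_iid:
  assumes "indep_vars (\<lambda>_. N) X UNIV" and "\<And>n. distr M N (X n) = \<nu>"
  shows "distr M (iid N) (\<lambda>w i. X i w) = iid \<nu>"
proof -
  have X: "X n \<in> M \<rightarrow>\<^sub>M N" for n using assms(1) by (simp add: indep_vars_def)
  have "distr M (iid N) (\<lambda>w. \<lambda>i\<in>UNIV. X i w) = (\<Pi>\<^sub>M i\<in>UNIV. distr M N (X i))"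
    using assms(1) by (rule indep_vars_iff_distr_eq_PiM[OF _ X, THEN iffD1, rotated]) simp
  also have "(\<lambda>i. distr M N (X i)) = (\<lambda>_. \<nu>)" using assms(2) by (intro ext)
  finally show ?thesis unfolding restrict_UNIV .
qed

section \<open>The Hewitt-Savage zero-one law\<close>

text \<open>The sets \<open>C n\<close> are almost surely the same, but only \<open>C n\<close> is exactly invariant under
  permutations of the first \<open>n\<close> coordinates. This is what tail events provide: an event has
  one description from each time on. For a cylinder \<open>D 0\<close> with base in \<open>{..<k}\<close>, let \<open>D j\<close> be
  its copy on the \<open>j\<close>-th block of length \<open>k\<close>. A permutation exchanging blocks shows that \<open>C 0\<close>
  meets all copies with the same probability. Since the copies are independent, their averaged
  indicators tend to a constant in the mean square, so that probability is a product.\<close>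
theorem hewitt_savage:
  fixes M :: "'b measure"
  assumes M: "prob_space M"
    and C: "\<And>n. C n \<in> sets (iid M)"
    and perm: "\<And>n \<pi> w. w \<in> space (iid M) \<Longrightarrow> inj \<pi> \<Longrightarrow> (\<And>i. i < n \<Longrightarrow> \<pi> i < n) \<Longrightarrow>
        (\<And>i. i \<ge> n \<Longrightarrow> \<pi> i = i) \<Longrightarrow> (\<lambda>i. w (\<pi> i)) \<in> C n \<longleftrightarrow> w \<in> C n"
    and ae: "\<And>n. AE w in iid M. w \<in> C n \<longleftrightarrow> w \<in> C 0"
  shows "measure (iid M) (C 0) = 0 \<or> measure (iid M) (C 0) = 1"
proof -
  let ?P = "iid M"
  interpret P: prob_space ?P by (rule prob_space_iid) fact
  note C[measurable]
  have cyl: "measure ?P (C 0 \<inter> D 0) = measure ?P (C 0) * measure ?P (D 0)"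
    if D: "\<And>j. D j = {w \<in> space ?P. \<forall>i\<in>J. w (k * j + i) \<in> A i}"
      and J: "J \<subseteq> {..<k}" and A: "\<And>i. i \<in> J \<Longrightarrow> A i \<in> sets M" for D :: "nat \<Rightarrow> _" and J k A
  proof -
    have "finite J" using J by (rule finite_subset) simp
    then have Dm[measurable]: "D j \<in> sets ?P" for j
      unfolding D using A by measurable
    have C_D: "measure ?P (C 0 \<inter> D j) = measure ?P (C 0 \<inter> D 0)" for j
    proof -
      define n where "n = k * (j + 1)"
      define t where "t = k * j"
      \<comment> \<open>\<open>\<pi>\<close> exchanges the initial block with the \<open>j\<close>-th one.\<close>
      define \<pi> where "\<pi> i = (if i < k then t + i else if t \<le> i \<and> i < t + k then i - t else i)" for i
      have kj: "t = 0 \<or> k \<le> t" unfolding t_def by (cases j) auto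
      have nt: "n = t + k" unfolding n_def t_def by simp
      have inv: "\<pi> (\<pi> i) = i" for i
        using kj unfolding \<pi>_def by auto
      then have inj: "inj \<pi>" by (metis injI)
      have n: "i < n \<Longrightarrow> \<pi> i < n" "i \<ge> n \<Longrightarrow> \<pi> i = i" for i
        using kj unfolding \<pi>_def nt by auto
      have \<pi>J: "i \<in> J \<Longrightarrow> \<pi> (k * j + i) = i" for i
        using kj J unfolding \<pi>_def t_def[symmetric] by auto
      have "measure ?P (C 0 \<inter> D j) = measure ?P (C n \<inter> D j)"
        using ae[of n] by (intro measure_eq_AE) auto
      also have "\<dots> = measure ?P {w \<in> space ?P. (\<lambda>i. w (\<pi> i)) \<in> C n \<inter> D j}"
        using measure_iid_reindex[OF M inj, of "C n \<inter> D j"] by simp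
      also have "\<dots> = measure ?P (C n \<inter> D 0)"
      proof (rule arg_cong[where f="measure ?P"])
        have "(\<lambda>i. w (\<pi> i)) \<in> D j \<longleftrightarrow> w \<in> D 0" if "w \<in> space ?P" for w
          using that \<pi>J unfolding D by (auto simp: space_PiM)
        then show "{w \<in> space ?P. (\<lambda>i. w (\<pi> i)) \<in> C n \<inter> D j} = C n \<inter> D 0"
          using perm[OF _ inj n] sets.sets_into_space[OF C[of n]] by auto
      qed
      also have "\<dots> = measure ?P (C 0 \<inter> D 0)"
        using ae[of n] by (intro measure_eq_AE) auto
      finally show ?thesis .
    qed
    define d where "d = measure ?P (D 0)"
    have D_prob: "measure ?P (D j) = d" for j
    proof -
      have "inj ((+) (k * j))" by simp
      from measure_iid_reindex[OF M this Dm[of 0]] show ?thesis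
        unfolding d_def D by (simp add: space_PiM PiE_UNIV_domain Pi_iff cong: conj_cong)
    qed
    have D_pair: "measure ?P (D i \<inter> D j) = d * d" if "i < j" for i j
    proof -
      \<comment> \<open>\<open>\<rho>\<close> lists the block \<open>i\<close>, then everything from the block \<open>j\<close> on.\<close>
      define \<rho> where "\<rho> l = (if l < k then k * i + l else k * j + (l - k))" for l
      have ij: "k * i + k \<le> k * j"
        using mult_le_mono2[of "Suc i" j k] that by simp
      have inj: "inj \<rho>"
        using ij by (intro injI) (auto simp: \<rho>_def split: if_splits)
      let ?E = "{w \<in> D 0. (\<lambda>l. w (k + l)) \<in> D 0}"
      have [measurable]: "(\<lambda>w i. w (k + i)) \<in> ?P \<rightarrow>\<^sub>M ?P"
        by (intro measurable_PiM_single') (auto simp: space_PiM)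
      have "?E = {w \<in> space ?P. w \<in> D 0 \<and> (\<lambda>l. w (k + l)) \<in> D 0}"
        using sets.sets_into_space[OF Dm[of 0]] by auto
      then have E: "?E \<in> sets ?P" by simp
      have "measure ?P ?E = d * d"
        unfolding d_def using J
        by (intro measure_iid_append[OF M Dm Dm]) (auto simp: D subset_eq)
      moreover have "{w \<in> space ?P. (\<lambda>l. w (\<rho> l)) \<in> ?E} = D i \<inter> D j"
        using J unfolding D \<rho>_def by (auto simp: space_PiM subset_eq)
      ultimately show ?thesis
        using measure_iid_reindex[OF M inj E] by simp
    qed
    have d01: "0 \<le> d" "d \<le> 1" unfolding d_def by auto
    define W where "W j w = indicator (D j) w - d" for j w
    have [measurable]: "W j \<in> borel_measurable ?P" for j unfolding W_def by measurable
    have Wint: "integrable ?P (\<lambda>w. W i w * W j w)" for i j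
      unfolding W_def
      by (intro P.integrable_const_bound[where B="(1+\<bar>d\<bar>)*(1+\<bar>d\<bar>)"])
         (use d01 in \<open>auto simp: abs_mult indicator_def intro!: mult_mono AE_I2\<close>)
    have ind_int[simp]: "integrable ?P (indicator E :: _ \<Rightarrow> real)" if "E \<in> sets ?P" for E
      using that by (intro integrable_real_indicator) (simp_all add: P.emeasure_eq_measure)
    have W2: "(\<integral>w. W i w * W j w \<partial>?P) = (if i = j then d - d * d else 0)" for i j
    proof -
      have "(\<integral>w. W i w * W j w \<partial>?P)
        = (\<integral>w. indicator (D i \<inter> D j) w - d * indicator (D i) w - d * indicator (D j) w + d * d \<partial>?P)"
        by (intro Bochner_Integration.integral_cong) (auto simp: W_def indicator_def algebra_simps)
      also have "\<dots> = measure ?P (D i \<inter> D j) - d * d - d * d + d * d"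
        using D_prob sets.sets_into_space[OF Dm] P.prob_space
        by (simp add: Int_absorb2 Int_assoc inf.absorb2 inf.absorb1)
      also have "\<dots> = (if i = j then d - d * d else 0)"
        using D_pair[of i j] D_pair[of j i] D_prob[of i]
        by (cases i j rule: linorder_cases) (auto simp: Int_commute)
      finally show ?thesis .
    qed
    let ?c = "measure ?P (C 0 \<inter> D 0) - measure ?P (C 0) * d"
    have bound: "real n * \<bar>?c\<bar> \<le> sqrt n" if "n > 0" for n :: nat
    proof -
      let ?S = "\<lambda>w. \<Sum>j<n. W j w"
      have Sint: "integrable ?P (\<lambda>w. (?S w)\<^sup>2)"
        unfolding power2_eq_square sum_product by (intro Bochner_Integration.integrable_sum Wint)
      have Sint1: "integrable ?P (\<lambda>w. \<bar>?S w\<bar>)"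
        by (intro integrable_abs Bochner_Integration.integrable_sum) (auto simp: W_def)
      have S2: "(\<integral>w. (?S w)\<^sup>2 \<partial>?P) \<le> n"
      proof -
        have "(\<integral>w. (?S w)\<^sup>2 \<partial>?P) = (\<Sum>i<n. \<Sum>j<n. if i = j then d - d * d else 0)"
          unfolding power2_eq_square sum_product
          by (subst Bochner_Integration.integral_sum; (intro Bochner_Integration.integrable_sum Wint)?)
             (simp add: Bochner_Integration.integral_sum Wint W2)
        also have "\<dots> = n * (d - d * d)" by simp
        also have "\<dots> \<le> real n * 1"
          using d01 mult_nonneg_nonneg[of d d] by (intro mult_left_mono) linarith+
        finally show ?thesis by simp
      qed
      have "measure ?P (C 0 \<inter> D 0) - d * measure ?P (C 0) =
          measure ?P (C 0 \<inter> D j) - d * measure ?P (C 0)" for j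
        using C_D[of j] by simp
      then have "real n * ?c = (\<Sum>j<n. measure ?P (C 0 \<inter> D j) - d * measure ?P (C 0))"
        by (subst sum.cong[OF refl, symmetric], assumption) (simp add: algebra_simps)
      also have "\<dots> = (\<Sum>j<n. \<integral>w. indicator (C 0) w * W j w \<partial>?P)"
      proof (rule sum.cong[OF refl])
        fix j
        have "(\<integral>w. indicator (C 0) w * W j w \<partial>?P) =
            (\<integral>w. indicator (C 0 \<inter> D j) w - d * indicator (C 0) w \<partial>?P)"
          by (intro Bochner_Integration.integral_cong) (auto simp: W_def indicator_def)
        also have "\<dots> = measure ?P (C 0 \<inter> D j) - d * measure ?P (C 0)"
          using sets.sets_into_space[OF C[of 0]] sets.sets_into_space[OF Dm[of j]]
          by (simp add: Int_absorb2 Int_assoc)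
        finally show "measure ?P (C 0 \<inter> D j) - d * measure ?P (C 0) =
            (\<integral>w. indicator (C 0) w * W j w \<partial>?P)" ..
      qed
      also have "\<dots> = (\<integral>w. indicator (C 0) w * ?S w \<partial>?P)"
        unfolding sum_distrib_left
        by (subst Bochner_Integration.integral_sum)
           (use d01 in \<open>auto simp: W_def indicator_def intro!: P.integrable_const_bound[where B=1] AE_I2\<close>)
      also have "\<bar>\<dots>\<bar> \<le> (\<integral>w. \<bar>indicator (C 0) w * ?S w\<bar> \<partial>?P)"
        by (rule integral_abs_bound)
      also have "\<dots> \<le> (\<integral>w. (?S w)\<^sup>2 / (2 * sqrt n) + sqrt n / 2 \<partial>?P)"
      proof (intro integral_mono_AE')
        show "integrable ?P (\<lambda>w. (?S w)\<^sup>2 / (2 * sqrt n) + sqrt n / 2)"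
          using Sint by simp
        have "\<bar>indicator (C 0) w * ?S w\<bar> \<le> (?S w)\<^sup>2 / (2 * sqrt n) + sqrt n / 2" for w
        proof -
          have "\<bar>indicator (C 0) w * ?S w\<bar> \<le> \<bar>?S w\<bar>" by (auto simp: indicator_def)
          \<comment> \<open>The arithmetic-geometric mean inequality stands in for Cauchy-Schwarz.\<close>
          moreover have "0 \<le> (\<bar>?S w\<bar> - sqrt n)\<^sup>2" by simp
          then have "2 * sqrt n * \<bar>?S w\<bar> \<le> (?S w)\<^sup>2 + (sqrt n)\<^sup>2"
            by (simp add: power2_diff mult.commute mult.left_commute)
          then have "\<bar>?S w\<bar> \<le> (?S w)\<^sup>2 / (2 * sqrt n) + sqrt n / 2"
            using that by (simp add: field_simps power2_eq_square)
          ultimately show ?thesis by simp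
        qed
        then show "AE w in ?P. \<bar>indicator (C 0) w * ?S w\<bar> \<le> (?S w)\<^sup>2 / (2 * sqrt n) + sqrt n / 2"
          by simp
      qed simp
      also have "\<dots> = (\<integral>w. (?S w)\<^sup>2 \<partial>?P) / (2 * sqrt n) + sqrt n / 2"
        using Sint P.prob_space by simp
      also have "\<dots> \<le> n / (2 * sqrt n) + sqrt n / 2"
        using S2 by (intro add_right_mono divide_right_mono) auto
      also have "\<dots> = sqrt n"
        using that by (simp add: real_div_sqrt field_simps)
      finally show ?thesis by (simp add: abs_mult)
    qed
    have "?c = 0"
    proof (rule ccontr)
      assume "?c \<noteq> 0"
      define e where "e = \<bar>?c\<bar>"
      have e: "0 < e" using \<open>?c \<noteq> 0\<close> by (simp add: e_def)
      obtain n :: nat where n: "1 / e\<^sup>2 < n" using reals_Archimedean2 by blast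
      have "0 < 1 / e\<^sup>2" using e by simp
      with n have "0 < real n" by linarith
      then have n0: "n > 0" by simp
      have "sqrt n * (sqrt n * e) \<le> sqrt n * 1"
        using bound[OF n0] unfolding e_def by (simp add: mult.assoc[symmetric])
      then have "sqrt n * e \<le> 1"
        using n0 by (simp add: mult_le_cancel_left_pos)
      then have "(sqrt n * e)\<^sup>2 \<le> 1"
        using e by (simp add: power_le_one)
      then show False
        using n e by (simp add: power_mult_distrib field_simps)
    qed
    then show ?thesis by (simp add: d_def)
  qed
  \<comment> \<open>Agreement on cylinders extends to all measurable sets, in particular to \<open>C 0\<close> itself.\<close>
  let ?Q = "scale_measure (emeasure ?P (C 0)) ?P"
  have "density ?P (indicator (C 0)) = ?Q"
  proof (rule measure_eqI_PiM_infinite[where I=UNIV and M="\<lambda>_. M"])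
    show "finite_measure (density ?P (indicator (C 0)))"
      by (intro finite_measureI) (simp add: emeasure_density)
    fix J :: "nat set" and A assume J: "finite J" and A: "\<And>i. i \<in> J \<Longrightarrow> A i \<in> sets M"
    from J obtain k where k: "J \<subseteq> {..<k}" using finite_nat_iff_bounded by blast
    let ?D = "\<lambda>j. {w \<in> space ?P. \<forall>i\<in>J. w (k * j + i) \<in> A i}"
    have eq: "prod_emb UNIV (\<lambda>_. M) J (Pi\<^sub>E J A) = ?D 0"
      by (auto simp: prod_emb_def space_PiM)
    have [measurable]: "?D 0 \<in> sets ?P" using J A by measurable
    show "emeasure (density ?P (indicator (C 0))) (prod_emb UNIV (\<lambda>_. M) J (Pi\<^sub>E J A)) =
        emeasure ?Q (prod_emb UNIV (\<lambda>_. M) J (Pi\<^sub>E J A))"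
      unfolding eq using cyl[of ?D J k A] k A
      by (simp add: emeasure_density P.emeasure_eq_measure ennreal_mult'[symmetric]
          flip: indicator_inter_arith)
  qed simp_all
  from arg_cong[OF this, of "\<lambda>Q. emeasure Q (C 0)"]
  have "measure ?P (C 0) = measure ?P (C 0) * measure ?P (C 0)"
    by (simp add: emeasure_density P.emeasure_eq_measure ennreal_mult'[symmetric]
          flip: indicator_inter_arith)
  then show ?thesis by auto
qed

section \<open>Partial sums and the Sparre Andersen identity\<close>

definition psum :: "(nat \<Rightarrow> real) \<Rightarrow> nat \<Rightarrow> real"
  where "psum w n = (\<Sum>i<n. w i)"

definition npos :: "(nat \<Rightarrow> real) \<Rightarrow> nat \<Rightarrow> real"
  where "npos w n = (\<Sum>j=1..n. indicator {0<..} (psum w j))"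

definition first_max :: "(nat \<Rightarrow> real) \<Rightarrow> nat \<Rightarrow> nat \<Rightarrow> bool"
  where "first_max w n k \<longleftrightarrow> k \<le> n \<and> (\<forall>j<k. psum w j < psum w k) \<and> (\<forall>j\<in>{k..n}. psum w j \<le> psum w k)"

lemma psum_0[simp]: "psum w 0 = 0" and psum_Suc: "psum w (Suc n) = psum w n + w n"
  by (simp_all add: psum_def)

lemma psum_Suc_shift: "psum w (Suc n) = w 0 + psum (\<lambda>i. w (Suc i)) n"
  unfolding psum_def by (rule sum.lessThan_Suc_shift)

lemma psum_add: "psum w (k + i) = psum w k + psum (\<lambda>l. w (k + l)) i"
  by (induction i) (simp_all add: psum_Suc)

lemma psum_cong: "(\<And>i. i < n \<Longrightarrow> w i = w' i) \<Longrightarrow> psum w n = psum w' n"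
  unfolding psum_def by (intro sum.cong) auto

lemma npos_Suc: "npos w (Suc n) = npos w n + indicator {0<..} (psum w (Suc n))"
  by (simp add: npos_def)

lemma npos_cong:
  assumes "\<And>i. i < n \<Longrightarrow> w i = w' i"
  shows "npos w n = npos w' n"
proof -
  have "psum w j = psum w' j" if "j \<le> n" for j
    using that assms by (intro psum_cong) simp
  then show ?thesis unfolding npos_def by (intro sum.cong) auto
qed

lemma first_max_cong:
  assumes "\<And>i. i < n \<Longrightarrow> w i = w' i"
  shows "first_max w n k = first_max w' n k"
proof -
  have "psum w j = psum w' j" if "j \<le> n" for j
    using that assms by (intro psum_cong) simp
  then show ?thesis unfolding first_max_def by auto
qed

lemma measurable_iid:
  assumes "\<And>i. (\<lambda>x. f x i) \<in> borel_measurable N"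
  shows "f \<in> N \<rightarrow>\<^sub>M iid (borel :: real measure)"
  using assms by (intro measurable_PiM_single') simp_all

lemma measurable_reindex:
  "(\<lambda>w i. w (\<pi> i)) \<in> iid borel \<rightarrow>\<^sub>M iid (borel :: real measure)"
  by (rule measurable_iid) measurable

lemma measurable_psum[measurable]: "(\<lambda>w. psum w n) \<in> borel_measurable (iid borel)"
  unfolding psum_def by measurable

lemma measurable_npos[measurable]: "(\<lambda>w. npos w n) \<in> borel_measurable (iid borel)"
  unfolding npos_def by measurable

lemma measurable_first_max[measurable]: "Measurable.pred (iid borel) (\<lambda>w. first_max w n k)"
proof -
  have less: "Measurable.pred (iid borel) (\<lambda>w. psum w i < psum w j)" for i j by measurable
  have le: "Measurable.pred (iid borel) (\<lambda>w. psum w i \<le> psum w j)" for i j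
    unfolding not_less[symmetric] by measurable
  show ?thesis
    unfolding first_max_def
    by (intro pred_intros_logic pred_intros_countable pred_intros_countable_bounded
        pred_intros_finite less le) auto
qed

text \<open>As measurability rules these must have a rigid shift: a schematic reindexing would match every function
  of the sequence.\<close>
lemmas measurable_shifted[measurable] =
  measurable_compose[OF measurable_reindex[of Suc] measurable_psum]
  measurable_compose[OF measurable_reindex[of Suc] measurable_npos]
  measurable_compose[OF measurable_reindex[of Suc] measurable_first_max]

context real_distribution
begin

lemma prob_space_iid: "prob_space (iid M)"
  by (rule prob_space_PiM) unfold_locales

lemma sets_iid: "sets (iid M) = sets (iid borel)"
  by (rule sets_PiM_cong) simp_all

lemma space_iid[simp]: "space (iid M) = UNIV"
  by (simp add: space_PiM)

text \<open>Conditioning on the first coordinate, respectively on all the others.\<close>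
lemma emeasure_iid_iter:
  assumes A: "A \<in> sets (iid M)"
  shows "emeasure (iid M) A = (\<integral>\<^sup>+x. emeasure (iid M) {w. case_nat x w \<in> A} \<partial>M)"
    and "emeasure (iid M) A = (\<integral>\<^sup>+w. emeasure M {x. case_nat x w \<in> A} \<partial>iid M)"
proof -
  interpret sequence_space M by (rule sequence_space_iid) unfold_locales
  interpret MS: pair_prob_space M S ..
  have cn: "(\<lambda>(s, w). case_nat s w) \<in> M \<Otimes>\<^sub>M S \<rightarrow>\<^sub>M S"
    unfolding measurable_cong_sets[OF refl sets_iid]
  proof (rule measurable_iid)
    show "(\<lambda>z. (case z of (s, w) \<Rightarrow> case_nat s w) i) \<in> borel_measurable (M \<Otimes>\<^sub>M S)" for i
      by (cases i) (simp_all add: split_beta')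
  qed
  then have m: "(\<lambda>(s, w). case_nat s w) -` A \<inter> space (M \<Otimes>\<^sub>M S) \<in> sets (M \<Otimes>\<^sub>M S)"
    by (rule measurable_sets) fact
  have "emeasure S A = emeasure (distr (M \<Otimes>\<^sub>M S) S (\<lambda>(s, w). case_nat s w)) A"
    by (simp add: PiM_iter)
  also have "\<dots> = emeasure (M \<Otimes>\<^sub>M S) ((\<lambda>(s, w). case_nat s w) -` A \<inter> space (M \<Otimes>\<^sub>M S))"
    using cn A by (rule emeasure_distr)
  finally have *: "emeasure S A = \<dots>" .
  show "emeasure (iid M) A = (\<integral>\<^sup>+x. emeasure (iid M) {w. case_nat x w \<in> A} \<partial>M)"
    unfolding * by (subst P.emeasure_pair_measure_alt[OF m])
      (auto intro!: nn_integral_cong arg_cong2[where f=emeasure] simp: space_pair_measure)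
  show "emeasure (iid M) A = (\<integral>\<^sup>+w. emeasure M {x. case_nat x w \<in> A} \<partial>iid M)"
    unfolding * by (subst MS.emeasure_pair_measure_alt2[OF m])
      (auto intro!: nn_integral_cong arg_cong2[where f=emeasure] simp: space_pair_measure)
qed

text \<open>Exchangeability in the one form needed for the Sparre Andersen identity: the step after the first
  \<open>n\<close> may as well be the step before them.\<close>
lemma measure_last_to_front:
  assumes Q: "\<And>w w' x. (\<And>i. i < n \<Longrightarrow> w i = w' i) \<Longrightarrow> Q w x = Q w' x"
    and m[measurable]: "Measurable.pred (iid M) (\<lambda>w. Q w (w n))"
  shows "measure (iid M) {w. Q w (w n)} = measure (iid M) {w. Q (\<lambda>i. w (Suc i)) (w 0)}"
proof -
  define \<pi> where "\<pi> i = (if i < n then Suc i else if i = n then 0 else i)" for i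
  have inj: "inj \<pi>" by (intro injI) (auto simp: \<pi>_def split: if_splits)
  have "Q (\<lambda>i. w (\<pi> i)) = Q (\<lambda>i. w (Suc i))" for w
    by (intro ext Q) (simp add: \<pi>_def)
  moreover have "\<pi> n = 0" by (simp add: \<pi>_def)
  moreover have "{w. Q w (w n)} \<in> sets (iid M)"
    using predE[OF m] by simp
  ultimately show ?thesis
    using measure_iid_reindex[OF _ inj, of M "{w. Q w (w n)}"] prob_space_axioms by simp
qed

text \<open>A last partial sum that is at most 0 cannot exceed the starting value, so it does not move the first maximum.\<close>
lemma first_max_Suc_nonpos:
  assumes "psum w (Suc n) \<le> 0"
  shows "first_max w (Suc n) k \<longleftrightarrow> first_max w n k"
proof -
  have "k \<noteq> Suc n" if "\<forall>j<k. psum w j < psum w k"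
    using that assms by force
  moreover have "psum w (Suc n) \<le> psum w k" if "k \<le> n" "\<forall>j<k. psum w j < psum w k"
    using that assms by (cases "k = 0") force+
  ultimately show ?thesis
    unfolding first_max_def by (auto simp: le_Suc_eq)
qed

text \<open>If the walk ends above 0, its maximum is not attained at time 0, so the first maximum is that of the walk
  after its first step, one step later.\<close>
lemma first_max_Suc_pos:
  assumes "psum w (Suc n) > 0"
  shows "first_max w (Suc n) k \<longleftrightarrow> k > 0 \<and> first_max (\<lambda>i. w (Suc i)) n (k - 1)"
proof (cases k)
  case 0
  then show ?thesis using assms by (force simp: first_max_def)
next
  case (Suc l)
  have "(\<forall>j\<in>{Suc l..Suc n}. P j) \<longleftrightarrow> (\<forall>j\<in>{l..n}. P (Suc j))" for P
    by (metis atLeastAtMost_iff Suc_le_mono Suc_le_D)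
  moreover have "(\<forall>j<Suc l. P j) \<longleftrightarrow> P 0 \<and> (\<forall>j<l. P (Suc j))" for P
    by (metis less_Suc_eq_0_disj)
  moreover have "0 < psum w (Suc l)" if "\<forall>j\<in>{l..n}. psum w (Suc j) \<le> psum w (Suc l)" "l \<le> n"
    using that assms by force
  ultimately show ?thesis
    using Suc by (auto simp: first_max_def psum_Suc_shift)
qed

text \<open>Appending a step increases the number of positive partial sums exactly when the new sum is positive.
  The first maximum obeys the same recursion, provided that in the case of a positive sum the step is put
  in front rather than appended; by exchangeability this does not change probabilities. The final sum
  must be carried along because it decides which case applies.\<close>
theorem sparre_andersen:
  assumes "B \<in> sets borel"
  shows "measure (iid M) {w. npos w n = real k \<and> psum w n \<in> B} =
         measure (iid M) {w. first_max w n k \<and> psum w n \<in> B}"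
  using assms
proof (induction n arbitrary: k B)
  case 0
  then show ?case
    by (intro arg_cong2[where f=measure]) (auto simp: npos_def first_max_def)
next
  case (Suc n)
  let ?P = "iid M"
  interpret P: prob_space ?P by (rule prob_space_iid)
  note Suc.prems[measurable]
  have step: "measure ?P {w. npos w n = real l \<and> psum w (Suc n) \<in> D} =
      measure ?P {w. first_max (\<lambda>i. w (Suc i)) n l \<and> psum w (Suc n) \<in> D}"
    if D[measurable]: "D \<in> sets borel" for l D
  proof -
    have "measure ?P {w. npos w n = real l \<and> psum w (Suc n) \<in> D}
        = measure ?P {w. npos (\<lambda>i. w (Suc i)) n = real l \<and> psum (\<lambda>i. w (Suc i)) n + w 0 \<in> D}"
      unfolding psum_Suc
    proof (rule measure_last_to_front[where Q="\<lambda>w x. npos w n = real l \<and> psum w n + x \<in> D"])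
      fix w w' :: "nat \<Rightarrow> real" and x :: real
      assume eq: "\<And>i. i < n \<Longrightarrow> w i = w' i"
      have "npos w n = npos w' n" "psum w n = psum w' n" by (rule npos_cong[OF eq] psum_cong[OF eq]; assumption)+
      then show "(npos w n = real l \<and> psum w n + x \<in> D) = (npos w' n = real l \<and> psum w' n + x \<in> D)"
        by simp
    qed measurable
    also have "\<dots> = measure ?P {w. first_max (\<lambda>i. w (Suc i)) n l \<and> psum (\<lambda>i. w (Suc i)) n + w 0 \<in> D}"
      (is "measure ?P ?L = measure ?P ?R")
    proof -
      have "Measurable.pred ?P (\<lambda>w. npos (\<lambda>i. w (Suc i)) n = real l \<and> psum (\<lambda>i. w (Suc i)) n + w 0 \<in> D)"
        "Measurable.pred ?P (\<lambda>w. first_max (\<lambda>i. w (Suc i)) n l \<and> psum (\<lambda>i. w (Suc i)) n + w 0 \<in> D)"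
        by measurable
      from this[THEN predE] have m: "?L \<in> sets ?P" "?R \<in> sets ?P" by simp_all
      have "emeasure ?P ?L = emeasure ?P ?R"
        unfolding emeasure_iid_iter(1)[OF m(1)] emeasure_iid_iter(1)[OF m(2)]
      proof (intro nn_integral_cong)
        fix x
        have D': "(\<lambda>s. s + x) -` D \<in> sets borel"
          using measurable_sets[of "\<lambda>s. s + x" borel borel D] D by simp
        show "emeasure ?P {w. case_nat x w \<in> ?L} = emeasure ?P {w. case_nat x w \<in> ?R}"
          using Suc.IH[OF D', of l] by (simp add: P.emeasure_eq_measure)
      qed
      then show ?thesis by (simp add: measure_def)
    qed
    also have "?R = {w. first_max (\<lambda>i. w (Suc i)) n l \<and> psum w (Suc n) \<in> D}"
      by (simp add: psum_Suc_shift add.commute)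
    finally show ?thesis .
  qed
  have step': "measure ?P {w. npos w n = real l \<and> psum w (Suc n) \<in> D} =
      measure ?P {w. first_max w n l \<and> psum w (Suc n) \<in> D}"
    if D[measurable]: "D \<in> sets borel" for l D
  proof -
    have "measure ?P {w. first_max w n l \<and> psum w n + w n \<in> D} =
        measure ?P {w. first_max (\<lambda>i. w (Suc i)) n l \<and> psum (\<lambda>i. w (Suc i)) n + w 0 \<in> D}"
    proof (rule measure_last_to_front[where Q="\<lambda>w x. first_max w n l \<and> psum w n + x \<in> D"])
      fix w w' :: "nat \<Rightarrow> real" and x :: real
      assume eq: "\<And>i. i < n \<Longrightarrow> w i = w' i"
      have "first_max w n l = first_max w' n l" "psum w n = psum w' n"
        by (rule first_max_cong[OF eq] psum_cong[OF eq]; assumption)+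
      then show "(first_max w n l \<and> psum w n + x \<in> D) = (first_max w' n l \<and> psum w' n + x \<in> D)"
        by simp
    qed measurable
    moreover have "w 0 + psum (\<lambda>i. w (Suc i)) n = psum (\<lambda>i. w (Suc i)) n + w 0" for w
      by simp
    ultimately show ?thesis
      using step[OF D, of l] by (simp only: psum_Suc psum_Suc_shift[symmetric] psum_Suc_shift)
  qed
  have split: "measure ?P {w. R w \<and> psum w (Suc n) \<in> B} =
      measure ?P {w. R w \<and> psum w (Suc n) \<in> B \<inter> {..0}} + measure ?P {w. R w \<and> psum w (Suc n) \<in> B \<inter> {0<..}}"
    if [measurable]: "Measurable.pred ?P R" for R
  proof -
    have "{w \<in> space ?P. R w \<and> psum w (Suc n) \<in> B \<inter> {..0}} \<in> sets ?P"
      "{w \<in> space ?P. R w \<and> psum w (Suc n) \<in> B \<inter> {0<..}} \<in> sets ?P" by measurable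
    then show ?thesis
      by (subst P.finite_measure_Union[symmetric]) (auto intro!: arg_cong2[where f=measure])
  qed
  have neg: "measure ?P {w. npos w (Suc n) = real k \<and> psum w (Suc n) \<in> B \<inter> {..0}} =
      measure ?P {w. first_max w (Suc n) k \<and> psum w (Suc n) \<in> B \<inter> {..0}}"
  proof -
    have "{w. npos w (Suc n) = real k \<and> psum w (Suc n) \<in> B \<inter> {..0}} =
        {w. npos w n = real k \<and> psum w (Suc n) \<in> B \<inter> {..0}}"
      by (auto simp: npos_Suc)
    moreover have "{w. first_max w (Suc n) k \<and> psum w (Suc n) \<in> B \<inter> {..0}} =
        {w. first_max w n k \<and> psum w (Suc n) \<in> B \<inter> {..0}}"
      by (auto simp: first_max_Suc_nonpos)
    ultimately show ?thesis using step'[of "B \<inter> {..0}" k] by simp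
  qed
  have pos: "measure ?P {w. npos w (Suc n) = real k \<and> psum w (Suc n) \<in> B \<inter> {0<..}} =
      measure ?P {w. first_max w (Suc n) k \<and> psum w (Suc n) \<in> B \<inter> {0<..}}"
  proof (cases k)
    case 0
    have "npos w n \<ge> 0" for w unfolding npos_def by (intro sum_nonneg) auto
    then have "{w. npos w (Suc n) = real k \<and> psum w (Suc n) \<in> B \<inter> {0<..}} = {}"
      using 0 by (auto simp: npos_Suc add_nonneg_eq_0_iff)
    moreover have "{w. first_max w (Suc n) k \<and> psum w (Suc n) \<in> B \<inter> {0<..}} = {}"
      using 0 by (auto simp: first_max_Suc_pos)
    ultimately show ?thesis by (simp only:)
  next
    case (Suc l)
    have "{w. npos w (Suc n) = real k \<and> psum w (Suc n) \<in> B \<inter> {0<..}} =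
        {w. npos w n = real l \<and> psum w (Suc n) \<in> B \<inter> {0<..}}"
      using Suc by (auto simp: npos_Suc)
    moreover have "{w. first_max w (Suc n) k \<and> psum w (Suc n) \<in> B \<inter> {0<..}} =
        {w. first_max (\<lambda>i. w (Suc i)) n l \<and> psum w (Suc n) \<in> B \<inter> {0<..}}"
      using Suc by (auto simp: first_max_Suc_pos)
    ultimately show ?thesis using step[of "B \<inter> {0<..}" l] by simp
  qed
  have "Measurable.pred ?P (\<lambda>w. npos w (Suc n) = real k)"
    "Measurable.pred ?P (\<lambda>w. first_max w (Suc n) k)" by measurable
  from this[THEN split] neg pos show ?case by linarith
qed

end

section \<open>The arcsine distribution\<close>

definition arcsine_distribution :: "real measure"
  where "arcsine_distribution = density lborel (\<lambda>x. indicator {0<..<1} x / (pi * sqrt (x * (1 - x))))"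

text \<open>The probability \<open>binomial (2 * k) k / 4 ^ k\<close> that a symmetric walk without ties has no positive
  partial sum up to time \<open>k\<close>, written with the Pochhammer symbol for the sake of the Vandermonde identity.\<close>
definition half_binomial :: "nat \<Rightarrow> real"
  where "half_binomial k = pochhammer (1/2) k / fact k"

lemma Gamma_half: "Gamma (real k + 1/2) = half_binomial k * fact k * sqrt pi"
proof -
  have "(1/2 :: real) \<notin> \<int>\<^sub>\<le>\<^sub>0" by (auto elim!: nonpos_Ints_cases)
  from pochhammer_Gamma[OF this, of k] show ?thesis
    by (simp add: half_binomial_def Gamma_one_half_real add.commute field_simps)
qed

lemma half_binomial_nonneg: "0 \<le> half_binomial k"
  unfolding half_binomial_def by (intro divide_nonneg_nonneg pochhammer_nonneg) auto

lemma sum_half_binomial: "(\<Sum>k\<le>n. half_binomial k * half_binomial (n - k)) = 1"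
proof -
  have "fact n = pochhammer (1/2 + 1/2 :: real) n" by (simp add: pochhammer_fact)
  also have "\<dots> = (\<Sum>k\<le>n. real (n choose k) * pochhammer (1/2) k * pochhammer (1/2) (n - k))"
    by (rule pochhammer_binomial_sum)
  also have "\<dots> = (\<Sum>k\<le>n. fact n * (half_binomial k * half_binomial (n - k)))"
    by (intro sum.cong refl) (auto simp: half_binomial_def binomial_fact field_simps)
  also have "\<dots> = fact n * (\<Sum>k\<le>n. half_binomial k * half_binomial (n - k))"
    by (simp add: sum_distrib_left)
  finally show ?thesis by simp
qed

text \<open>The convolution equation determines its nonnegative solution, as \<open>u n\<close> enters with the factor \<open>2 * u 0 = 2\<close>
  and all other terms are earlier values.\<close>
lemma eq_half_binomial:
  fixes u :: "nat \<Rightarrow> real"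
  assumes conv: "\<And>n. (\<Sum>k\<le>n. u k * u (n - k)) = 1" and nonneg: "\<And>n. 0 \<le> u n"
  shows "u n = half_binomial n"
proof (induction n rule: less_induct)
  case (less n)
  have h0: "half_binomial 0 = 1" by (simp add: half_binomial_def)
  have u0: "u 0 = 1"
  proof -
    have "(u 0)\<^sup>2 = 1\<^sup>2" using conv[of 0] by (simp add: power2_eq_square)
    then show ?thesis using nonneg[of 0] by (metis power2_eq_iff_nonneg zero_le_one)
  qed
  show ?case
  proof (cases n)
    case 0
    then show ?thesis using u0 h0 by simp
  next
    case (Suc m)
    have split: "(\<Sum>k\<le>n. w k * w (n - k)) = 2 * (w 0 * w n) + (\<Sum>k\<in>{1..m}. w k * w (n - k))" for w :: "nat \<Rightarrow> real"
    proof -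
      have "{..n} = insert 0 (insert n {1..m})" using Suc by auto
      then show ?thesis using Suc by simp
    qed
    have "(\<Sum>k\<in>{1..m}. u k * u (n - k)) = (\<Sum>k\<in>{1..m}. half_binomial k * half_binomial (n - k))"
      using less Suc by (intro sum.cong refl arg_cong2[where f="(*)"]) auto
    then show ?thesis
      using conv[of n] sum_half_binomial[of n] split[of u] split[of half_binomial] u0 h0 by simp
  qed
qed

lemma nn_integral_arcsine_distribution:
  assumes "f \<in> borel_measurable borel"
    and "((\<lambda>x. f x / (pi * sqrt (x * (1 - x)))) has_integral I) A" and "A \<subseteq> {0..1}"
    and "\<And>x. x \<in> A \<Longrightarrow> 0 \<le> f x" and "A \<in> sets borel"
  shows "(\<integral>\<^sup>+x. f x * indicator A x \<partial>arcsine_distribution) = ennreal I"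
proof -
  note assms(1,5)[measurable]
  have "(\<integral>\<^sup>+x. f x * indicator A x \<partial>arcsine_distribution) =
      (\<integral>\<^sup>+x. ennreal (indicator {0<..<1} x / (pi * sqrt (x * (1 - x)))) * ennreal (f x * indicator A x) \<partial>lborel)"
    unfolding arcsine_distribution_def by (subst nn_integral_density) auto
  also have "\<dots> = (\<integral>\<^sup>+x. ennreal (f x / (pi * sqrt (x * (1 - x)))) * indicator A x \<partial>lborel)"
  proof (rule nn_integral_cong)
    fix x :: real
    consider "x \<notin> A" | "x = 0 \<or> x = 1" | "x \<in> A" "x \<in> {0<..<1}" using assms(3) by force
    then show "ennreal (indicator {0<..<1} x / (pi * sqrt (x * (1 - x)))) * ennreal (f x * indicator A x) =
        ennreal (f x / (pi * sqrt (x * (1 - x)))) * indicator A x"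
      by cases (auto simp: ennreal_mult'[symmetric])
  qed
  also have "\<dots> = ennreal I"
    using assms by (intro nn_integral_has_integral_lebesgue') (auto intro!: divide_nonneg_nonneg mult_nonneg_nonneg)
  finally show ?thesis .
qed

text \<open>The beta-binomial formula: a binomial law whose parameter has the arcsine distribution charges \<open>k\<close> with
  a product of two half-binomial weights.\<close>
lemma arcsine_Beta_integral:
  assumes "k \<le> n"
  shows "((\<lambda>x. Bernstein n k x / (pi * sqrt (x * (1 - x)))) has_integral half_binomial k * half_binomial (n - k)) {0..1}"
proof -
  have "((\<lambda>t. t powr (real k + 1/2 - 1) * (1 - t) powr (real (n - k) + 1/2 - 1)) has_integral
      Beta (real k + 1/2) (real (n - k) + 1/2)) {0..1}"
    by (rule has_integral_Beta_real) auto
  from has_integral_mult_left[OF this, of "real (n choose k) / pi"]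
  have "((\<lambda>t. real (n choose k) / pi * (t powr (real k + 1/2 - 1) * (1 - t) powr (real (n - k) + 1/2 - 1))) has_integral
      real (n choose k) / pi * Beta (real k + 1/2) (real (n - k) + 1/2)) {0..1}"
    by (simp add: mult.commute)
  also have "real (n choose k) / pi * Beta (real k + 1/2) (real (n - k) + 1/2) = half_binomial k * half_binomial (n - k)"
  proof -
    have "real k + 1/2 + (real (n - k) + 1/2) = 1 + real n" using assms by simp
    then have Beta: "Beta (real k + 1/2) (real (n - k) + 1/2) =
        half_binomial k * fact k * sqrt pi * (half_binomial (n - k) * fact (n - k) * sqrt pi) / fact n"
      unfolding Beta_def Gamma_half by (simp add: Gamma_fact)
    have "real (fact k * fact (n - k) * (n choose k)) = real (fact n)"
      using binomial_fact_lemma[OF assms] by (simp only:)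
    then have binom: "fact k * fact (n - k) * real (n choose k) = fact n"
      by (simp only: of_nat_mult of_nat_fact)
    have cancel: "c / pi * (a * f * s * (b * g * s) / m) = a * b"
      if "s * s = pi" "f * g * c = m" "m \<noteq> 0" for a b c f g m s :: real
    proof -
      have "c / pi * (a * f * s * (b * g * s) / m) = a * b * (s * s / pi) * (f * g * c / m)"
        by (simp add: mult_ac)
      then show ?thesis unfolding that using that by simp
    qed
    show ?thesis
      unfolding Beta by (rule cancel[OF _ binom]) auto
  qed
  finally show ?thesis
    unfolding has_integral_Icc_iff_Ioo
  proof (rule has_integral_eq[rotated])
    fix t :: real assume t: "t \<in> {0<..<1}"
    have "s powr (real l + 1/2 - 1) = s ^ l / sqrt s" if "s > 0" for s :: real and l
    proof -
      have "s powr (real l + 1/2 - 1) = s powr (real l) / s powr (1/2)"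
        by (simp flip: powr_diff)
      then show ?thesis using that by (simp add: powr_realpow powr_half_sqrt)
    qed
    then show "real (n choose k) / pi * (t powr (real k + 1/2 - 1) * (1 - t) powr (real (n - k) + 1/2 - 1)) =
        Bernstein n k t / (pi * sqrt (t * (1 - t)))"
      using t by (simp add: Bernstein_def real_sqrt_mult)
  qed
qed

lemma arcsine_density_has_integral:
  assumes "0 \<le> a" "a < 1"
  shows "((\<lambda>x. 1 / (pi * sqrt (x * (1 - x)))) has_integral 2 / pi * arcsin (sqrt a)) {0..a}"
proof -
  have "((\<lambda>x. 1 / (pi * sqrt (x * (1 - x)))) has_integral
      (2 / pi * arcsin (sqrt a) - 2 / pi * arcsin (sqrt 0))) {0..a}"
  proof (rule fundamental_theorem_of_calculus_interior[OF assms(1)])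
    show "continuous_on {0..a} (\<lambda>x. 2 / pi * arcsin (sqrt x))"
      using assms by (intro continuous_intros) (auto intro: order_trans[of _ 0])
    fix x assume x: "x \<in> {0<..<a}"
    then have x01: "0 < x" "x < 1" using assms by auto
    have "((\<lambda>x. 2 / pi * arcsin (sqrt x)) has_real_derivative
        2 / pi * (inverse (sqrt (1 - (sqrt x)\<^sup>2)) * (inverse (sqrt x) / 2))) (at x)"
      using x01 by (intro DERIV_cmult DERIV_chain2[OF DERIV_arcsin DERIV_real_sqrt])
        (auto intro: less_le_trans[of _ 0])
    also have "2 / pi * (inverse (sqrt (1 - (sqrt x)\<^sup>2)) * (inverse (sqrt x) / 2)) = 1 / (pi * sqrt (x * (1 - x)))"
      using x01 by (simp add: real_sqrt_mult divide_simps)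
    finally show "((\<lambda>x. 2 / pi * arcsin (sqrt x)) has_vector_derivative 1 / (pi * sqrt (x * (1 - x)))) (at x)"
      by (simp add: has_real_derivative_iff_has_vector_derivative)
  qed
  then show ?thesis by simp
qed

lemma Bernstein_measurable[measurable]: "Bernstein n k \<in> borel_measurable borel"
  unfolding Bernstein_def by measurable

lemma AE_arcsine_distribution: "AE x in arcsine_distribution. x \<in> {0..1}"
  unfolding arcsine_distribution_def by (subst AE_density) (auto simp: indicator_def)

lemma sets_arcsine_distribution[simp, measurable_cong]: "sets arcsine_distribution = sets borel"
  and space_arcsine_distribution[simp]: "space arcsine_distribution = UNIV"
  by (simp_all add: arcsine_distribution_def)

lemma real_distribution_arcsine: "real_distribution arcsine_distribution"
proof -
  have "emeasure arcsine_distribution (space arcsine_distribution) = emeasure arcsine_distribution {0..1}"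
    using AE_arcsine_distribution by (intro emeasure_eq_AE) auto
  also have "\<dots> = (\<integral>\<^sup>+x. Bernstein 0 0 x * indicator {0..1} x \<partial>arcsine_distribution)"
    by (simp add: Bernstein_def ennreal_indicator)
  also have "\<dots> = ennreal (half_binomial 0 * half_binomial (0 - 0))"
    by (rule nn_integral_arcsine_distribution[OF _ arcsine_Beta_integral]) (auto simp: Bernstein_def)
  also have "\<dots> = 1" by (simp add: half_binomial_def)
  finally show ?thesis
    by (intro real_distribution.intro prob_spaceI real_distribution_axioms.intro) auto
qed

lemma integral_Bernstein_arcsine:
  assumes "k \<le> n"
  shows "(\<integral>x. Bernstein n k x \<partial>arcsine_distribution) = half_binomial k * half_binomial (n - k)"
    and "integrable arcsine_distribution (Bernstein n k)"
proof -
  have "(\<integral>\<^sup>+x. Bernstein n k x \<partial>arcsine_distribution) = (\<integral>\<^sup>+x. Bernstein n k x * indicator {0..1} x \<partial>arcsine_distribution)"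
    using AE_arcsine_distribution by (intro nn_integral_cong_AE) auto
  also have "\<dots> = ennreal (half_binomial k * half_binomial (n - k))"
    by (rule nn_integral_arcsine_distribution[OF _ arcsine_Beta_integral[OF assms]]) (auto simp: Bernstein_nonneg)
  finally have "has_bochner_integral arcsine_distribution (Bernstein n k) (half_binomial k * half_binomial (n - k))"
    using AE_arcsine_distribution half_binomial_nonneg
    by (intro has_bochner_integral_nn_integral) (auto simp: Bernstein_nonneg)
  then show "(\<integral>x. Bernstein n k x \<partial>arcsine_distribution) = half_binomial k * half_binomial (n - k)"
    "integrable arcsine_distribution (Bernstein n k)"
    by (auto simp: has_bochner_integral_iff)
qed

lemma cdf_arcsine_distribution:
  assumes "0 < a" "a < 1"
  shows "cdf arcsine_distribution a = 2 / pi * arcsin (sqrt a)"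
proof -
  interpret real_distribution arcsine_distribution by (rule real_distribution_arcsine)
  have "emeasure arcsine_distribution {..a} = emeasure arcsine_distribution {0..a}"
    using AE_arcsine_distribution by (intro emeasure_eq_AE) auto
  also have "\<dots> = (\<integral>\<^sup>+x. ennreal (1 * indicator {0..a} x) \<partial>arcsine_distribution)"
    by (simp add: ennreal_indicator)
  also have "\<dots> = ennreal (2 / pi * arcsin (sqrt a))"
    using assms arcsine_density_has_integral[of a]
    by (intro nn_integral_arcsine_distribution) auto
  finally show ?thesis
    using assms by (simp add: cdf_def emeasure_eq_measure arcsin_bounded arcsin_nonneg)
qed

lemma isCont_cdf_arcsine: "isCont (cdf arcsine_distribution) a"
proof -
  interpret real_distribution arcsine_distribution by (rule real_distribution_arcsine)
  have "emeasure arcsine_distribution {a} = 0"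
    unfolding arcsine_distribution_def by (subst emeasure_density) auto
  then show ?thesis by (simp add: isCont_cdf measure_def)
qed

text \<open>The sum is the integral of a Bernstein polynomial of \<open>\<phi>\<close> over the arcsine distribution, and these
  polynomials converge uniformly.\<close>
lemma beta_binomial_limit:
  assumes "continuous_on UNIV \<phi>"
  shows "(\<lambda>n. \<Sum>k\<le>n. \<phi> (real k / real n) * (half_binomial k * half_binomial (n - k)))
           \<longlonglongrightarrow> (\<integral>x. \<phi> x \<partial>arcsine_distribution)"
proof (rule LIMSEQ_I)
  interpret real_distribution arcsine_distribution by (rule real_distribution_arcsine)
  fix e :: real assume e: "0 < e"
  have meas[measurable]: "\<phi> \<in> borel_measurable borel" using assms by (rule borel_measurable_continuous_onI)
  have c01: "continuous_on {0..1} \<phi>" using assms continuous_on_subset by blast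
  obtain N where N: "\<And>n x. N \<le> n \<Longrightarrow> x \<in> {0..1} \<Longrightarrow> \<bar>\<phi> x - (\<Sum>k\<le>n. \<phi> (k/n) * Bernstein n k x)\<bar> < e / 2"
    using Bernstein_Weierstrass[OF c01, of "e/2"] e by auto
  have "bounded (\<phi> ` {0..1})"
    using c01 by (intro compact_imp_bounded compact_continuous_image) auto
  then obtain B where "\<forall>x\<in>{0..1}. \<bar>\<phi> x\<bar> \<le> B" by (auto simp: bounded_iff)
  then have B: "x \<in> {0..1} \<Longrightarrow> \<bar>\<phi> x\<bar> \<le> B" for x by blast
  have int: "integrable arcsine_distribution \<phi>"
    using AE_arcsine_distribution by (intro integrable_const_bound[where B=B]) (auto simp: B)
  have "norm ((\<Sum>k\<le>n. \<phi> (real k / real n) * (half_binomial k * half_binomial (n - k))) - integral\<^sup>L arcsine_distribution \<phi>) < e"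
    if n: "N \<le> n" for n
  proof -
    let ?B = "\<lambda>x. \<Sum>k\<le>n. \<phi> (k/n) * Bernstein n k x"
    have intB: "integrable arcsine_distribution ?B"
      by (intro Bochner_Integration.integrable_sum integrable_mult_right integral_Bernstein_arcsine) auto
    have "(\<Sum>k\<le>n. \<phi> (real k / real n) * (half_binomial k * half_binomial (n - k))) = (\<integral>x. ?B x \<partial>arcsine_distribution)"
      by (subst Bochner_Integration.integral_sum)
         (auto simp: integral_Bernstein_arcsine intro!: integrable_mult_right integral_Bernstein_arcsine)
    then have "norm ((\<Sum>k\<le>n. \<phi> (real k / real n) * (half_binomial k * half_binomial (n - k))) - integral\<^sup>L arcsine_distribution \<phi>)
        = \<bar>\<integral>x. ?B x - \<phi> x \<partial>arcsine_distribution\<bar>"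
      using int intB by simp
    also have "\<dots> \<le> (\<integral>x. \<bar>?B x - \<phi> x\<bar> \<partial>arcsine_distribution)" by (rule integral_abs_bound)
    also have "\<dots> \<le> (\<integral>x. e / 2 \<partial>arcsine_distribution)"
    proof (intro integral_mono_AE)
      show "AE x in arcsine_distribution. \<bar>?B x - \<phi> x\<bar> \<le> e / 2"
        using AE_arcsine_distribution
      proof eventually_elim
        case (elim x)
        from N[OF n this] show ?case by (simp add: abs_minus_commute)
      qed
    qed (use int intB in auto)
    also have "\<dots> < e" using e prob_space by simp
    finally show ?thesis .
  qed
  then show "\<exists>N. \<forall>n\<ge>N. norm ((\<Sum>k\<le>n. \<phi> (real k / real n) * (half_binomial k * half_binomial (n - k))) - integral\<^sup>L arcsine_distribution \<phi>) < e"
    by blast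
qed

section \<open>Positive partial sums of the Gaussian walk\<close>

lemma npos_nat: "\<exists>k\<le>n. npos w n = real k"
proof (induction n)
  case 0
  then show ?case by (simp add: npos_def)
next
  case (Suc n)
  then obtain k where k: "k \<le> n" "npos w n = real k" by blast
  show ?case
  proof (cases "0 < psum w (Suc n)")
    case True
    then have "npos w (Suc n) = real (Suc k)" using k by (simp add: npos_Suc)
    then show ?thesis using k by (intro exI[of _ "Suc k"]) simp
  next
    case False
    then have "npos w (Suc n) = real k" using k by (simp add: npos_Suc)
    then show ?thesis using k by (intro exI[of _ k]) simp
  qed
qed

context real_distribution
begin

lemma pred_psum_pos: "Measurable.pred (iid M) (\<lambda>w. \<forall>j\<in>{1..k::nat}. 0 < psum w j)"
  and pred_psum_nonneg: "Measurable.pred (iid M) (\<lambda>w. \<forall>j\<in>{..k::nat}. 0 \<le> psum w j)"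
  and pred_psum_nonpos: "Measurable.pred (iid M) (\<lambda>w. \<forall>j\<in>{..k::nat}. psum w j \<le> 0)"
  by (intro pred_intros_finite; measurable)+

text \<open>Seen backwards from the first maximum at time \<open>k\<close>, the walk is positive for \<open>k\<close> steps; seen
  forwards, it never exceeds its starting value. The two pieces use disjoint sets of steps.\<close>
lemma measure_first_max:
  assumes "k \<le> n"
  shows "measure (iid M) {w. first_max w n k} =
    measure (iid M) {w. \<forall>j\<in>{1..k}. 0 < psum w j} * measure (iid M) {w. \<forall>j\<in>{..n-k}. psum w j \<le> 0}"
proof -
  let ?A = "{w. \<forall>j\<in>{1..k}. 0 < psum w j}" and ?B = "{w. \<forall>j\<in>{..n-k}. psum w j \<le> 0}"
  have A: "?A \<in> sets (iid M)" using pred_psum_pos[THEN predE, of k] by simp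
  have B: "?B \<in> sets (iid M)" using pred_psum_nonpos[THEN predE, of "n-k"] by simp
  \<comment> \<open>\<open>\<pi>\<close> reverses the first \<open>k\<close> steps.\<close>
  define \<pi> where "\<pi> i = (if i < k then k - Suc i else i)" for i
  have inj: "inj \<pi>" by (intro injI) (auto simp: \<pi>_def split: if_splits)
  have rev: "psum (\<lambda>i. w (\<pi> i)) j = psum w k - psum w (k - j)" if "j \<le> k" for w j
    using that
  proof (induction j)
    case (Suc j)
    then have "psum w (k - j) = psum w (k - Suc j) + w (k - Suc j)"
      by (metis Suc_diff_Suc Suc_le_lessD psum_Suc)
    then show ?case using Suc by (simp add: psum_Suc \<pi>_def)
  qed simp
  have same: "psum (\<lambda>i. w (\<pi> i)) (k + i) = psum w (k + i)" for w i
  proof (induction i)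
    case 0
    show ?case using rev[of k w] by simp
  next
    case (Suc i)
    then show ?case by (simp add: psum_Suc \<pi>_def)
  qed
  have "first_max (\<lambda>i. w (\<pi> i)) n k \<longleftrightarrow> w \<in> ?A \<and> (\<lambda>i. w (k + i)) \<in> ?B" for w
  proof -
    have "(\<forall>j<k. psum (\<lambda>i. w (\<pi> i)) j < psum (\<lambda>i. w (\<pi> i)) k) \<longleftrightarrow> (\<forall>j<k. 0 < psum w (k - j))"
      by (simp add: rev)
    also have "\<dots> \<longleftrightarrow> w \<in> ?A"
    proof
      assume *: "\<forall>j<k. 0 < psum w (k - j)"
      have "0 < psum w j" if "j \<in> {1..k}" for j
        using *[rule_format, of "k - j"] that by auto
      then show "w \<in> ?A" by blast
    qed auto
    finally have 1: "(\<forall>j<k. psum (\<lambda>i. w (\<pi> i)) j < psum (\<lambda>i. w (\<pi> i)) k) \<longleftrightarrow> w \<in> ?A" .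
    have "(\<forall>j\<in>{k..n}. P j) \<longleftrightarrow> (\<forall>i\<in>{..n-k}. P (k + i))" for P
    proof
      assume *: "\<forall>i\<in>{..n-k}. P (k + i)"
      have "P j" if "j \<in> {k..n}" for j using bspec[OF *, of "j - k"] that by (simp add: diff_le_mono)
      then show "\<forall>j\<in>{k..n}. P j" by blast
    qed (use assms in auto)
    moreover have "psum (\<lambda>i. w (\<pi> i)) (k + i) \<le> psum (\<lambda>i. w (\<pi> i)) k \<longleftrightarrow> psum (\<lambda>l. w (k + l)) i \<le> 0" for i
      using same[of w i] same[of w 0] psum_add[of w k i] by simp
    ultimately have 2: "(\<forall>j\<in>{k..n}. psum (\<lambda>i. w (\<pi> i)) j \<le> psum (\<lambda>i. w (\<pi> i)) k) \<longleftrightarrow> (\<lambda>i. w (k + i)) \<in> ?B"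
      by (simp only: mem_Collect_eq)
    show ?thesis unfolding first_max_def 1 2 using assms by simp
  qed
  moreover have "{w. first_max w n k} \<in> sets (iid M)"
  proof -
    have "Measurable.pred (iid M) (\<lambda>w. first_max w n k)" by measurable
    from predE[OF this] show ?thesis by simp
  qed
  ultimately have "measure (iid M) {w. first_max w n k} =
      measure (iid M) {w \<in> ?A. (\<lambda>i. w (k + i)) \<in> ?B}"
    using measure_iid_reindex[OF prob_space_axioms inj, of "{w. first_max w n k}"] by simp
  also have "\<dots> = measure (iid M) ?A * measure (iid M) ?B"
  proof (rule measure_iid_append[OF prob_space_axioms A B])
    fix w w' :: "nat \<Rightarrow> real"
    assume w: "w \<in> ?A" and eq: "\<And>i. i < k \<Longrightarrow> w i = w' i"
    have "psum w j = psum w' j" if "j \<le> k" for j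
      using that eq by (intro psum_cong) simp
    then show "w' \<in> ?A" using w by simp
  qed
  finally show ?thesis .
qed

lemma AE_psum_nonzero:
  assumes "\<And>x. emeasure M {x} = 0" and "n > 0"
  shows "AE w in iid M. psum w n \<noteq> 0"
proof -
  obtain m where m: "n = Suc m" using assms(2) by (cases n) auto
  have "Measurable.pred (iid M) (\<lambda>w. psum w n = 0)" by measurable
  from predE[OF this] have meas: "{w. psum w n = 0} \<in> sets (iid M)" by simp
  have "{x. case_nat x w \<in> {w. psum w n = 0}} = {- psum w m}" for w
    by (auto simp: m psum_Suc_shift)
  then have "emeasure (iid M) {w. psum w n = 0} = 0"
    unfolding emeasure_iid_iter(2)[OF meas] using assms(1) by simp
  then show ?thesis using meas by (intro AE_I'[of "{w. psum w n = 0}"]) (auto simp: null_sets_def)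
qed

text \<open>Symmetry and the absence of ties make both factors of \<open>measure_first_max\<close> the same function \<open>u\<close>,
  and the total mass 1 is the convolution equation solved by \<open>half_binomial\<close>.\<close>
theorem npos_law_symmetric:
  assumes sym: "distr M borel uminus = M" and atomless: "\<And>x. emeasure M {x} = 0" and "k \<le> n"
  shows "measure (iid M) {w. npos w n = real k} = half_binomial k * half_binomial (n - k)"
proof -
  let ?P = "iid M"
  interpret P: prob_space ?P by (rule prob_space_iid)
  define u where "u k = measure ?P {w. \<forall>j\<in>{1..k}. 0 < psum w j}" for k
  have neg: "distr ?P (iid borel) (\<lambda>w i. - w i) = ?P"
    using distr_iid_map[OF prob_space_axioms, of uminus borel] sym by simp
  have v: "measure ?P {w. \<forall>j\<in>{..m}. psum w j \<le> 0} = u m" for m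
  proof -
    have pn: "psum (\<lambda>i. - w i) j = - psum w j" for w j
      by (simp add: psum_def sum_negf)
    have ms: "(\<lambda>w i. - w i) \<in> ?P \<rightarrow>\<^sub>M iid borel"
      by (rule measurable_iid) measurable
    have "{w. \<forall>j\<in>{..m}. psum w j \<le> 0} \<in> sets (iid borel)"
      using predE[OF pred_psum_nonpos, of m] by (simp add: sets_iid)
    then have "measure (distr ?P (iid borel) (\<lambda>w i. - w i)) {w. \<forall>j\<in>{..m}. psum w j \<le> 0} =
       measure ?P {w. \<forall>j\<in>{..m}. 0 \<le> psum w j}"
      by (subst measure_distr[OF ms]) (auto simp: pn vimage_def)
    then have "measure ?P {w. \<forall>j\<in>{..m}. psum w j \<le> 0} = measure ?P {w. \<forall>j\<in>{..m}. 0 \<le> psum w j}"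
      by (simp only: neg)
    also have "\<dots> = u m"
      unfolding u_def
    proof (rule measure_eq_AE)
      have "AE w in ?P. \<forall>j\<in>{1..m}. psum w j \<noteq> 0"
        by (intro AE_finite_allI AE_psum_nonzero atomless) auto
      then show "AE w in ?P. w \<in> {w. \<forall>j\<in>{..m}. 0 \<le> psum w j} \<longleftrightarrow> w \<in> {w. \<forall>j\<in>{1..m}. 0 < psum w j}"
      proof eventually_elim
        case (elim w)
        have "0 \<le> psum w j \<longleftrightarrow> j = 0 \<or> 0 < psum w j" if "j \<le> m" for j
          using bspec[OF elim, of j] that by (cases "j = 0") auto
        then have "(\<forall>j\<in>{..m}. 0 \<le> psum w j) \<longleftrightarrow> (\<forall>j\<in>{..m}. j = 0 \<or> 0 < psum w j)"
          by (intro ball_cong refl) simp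
        also have "\<dots> \<longleftrightarrow> (\<forall>j\<in>{1..m}. 0 < psum w j)"
        proof
          assume *: "\<forall>j\<in>{..m}. j = 0 \<or> 0 < psum w j"
          have "0 < psum w j" if "j \<in> {1..m}" for j using bspec[OF *, of j] that by simp
          then show "\<forall>j\<in>{1..m}. 0 < psum w j" by blast
        next
          assume *: "\<forall>j\<in>{1..m}. 0 < psum w j"
          have "j = 0 \<or> 0 < psum w j" if "j \<in> {..m}" for j
            using bspec[OF *, of j] that by (cases j) simp_all
          then show "\<forall>j\<in>{..m}. j = 0 \<or> 0 < psum w j" by blast
        qed
        finally show ?case by (simp only: mem_Collect_eq)
      qed
    qed (use predE[OF pred_psum_nonneg, of m] predE[OF pred_psum_pos, of m] in auto)
    finally show ?thesis .
  qed
  have law: "measure ?P {w. npos w n = real k} = u k * u (n - k)" if "k \<le> n" for n k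
  proof -
    have "measure ?P {w. npos w n = real k} = measure ?P {w. first_max w n k}"
      using sparre_andersen[of UNIV n k] by simp
    then show ?thesis
      unfolding measure_first_max[OF that] v u_def .
  qed
  have "(\<Sum>k\<le>n. u k * u (n - k)) = 1" for n
  proof -
    have "Measurable.pred ?P (\<lambda>w. npos w n = real k)" for k by measurable
    from predE[OF this] have meas: "{w. npos w n = real k} \<in> sets ?P" for k by simp
    have "(\<Sum>k\<le>n. u k * u (n - k)) = (\<Sum>k\<le>n. measure ?P {w. npos w n = real k})"
      by (intro sum.cong refl) (simp add: law)
    also have "\<dots> = measure ?P (\<Union>k\<in>{..n}. {w. npos w n = real k})"
      using meas by (intro P.finite_measure_finite_Union[symmetric]) (auto simp: disjoint_family_on_def)
    also have "(\<Union>k\<in>{..n}. {w. npos w n = real k}) = space ?P"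
    proof -
      have "w \<in> (\<Union>k\<in>{..n}. {w. npos w n = real k})" for w
        using npos_nat[of n w] by auto
      then show ?thesis by (simp add: set_eq_iff)
    qed
    finally show ?thesis using P.prob_space by simp
  qed
  moreover have "0 \<le> u k" for k by (simp add: u_def)
  ultimately have "u k = half_binomial k" for k by (rule eq_half_binomial)
  then show ?thesis using law[OF assms(3)] by simp
qed

lemma expectation_npos_symmetric:
  fixes \<phi> :: "real \<Rightarrow> real"
  assumes "distr M borel uminus = M" and "\<And>x. emeasure M {x} = 0"
  shows "(\<integral>w. \<phi> (npos w n / real n) \<partial>iid M) =
    (\<Sum>k\<le>n. \<phi> (real k / real n) * (half_binomial k * half_binomial (n - k)))"
proof -
  let ?P = "iid M"
  interpret P: prob_space ?P by (rule prob_space_iid)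
  have "Measurable.pred ?P (\<lambda>w. npos w n = real k)" for k by measurable
  from predE[OF this] have meas[measurable]: "{w. npos w n = real k} \<in> sets ?P" for k by simp
  have "(\<integral>w. \<phi> (npos w n / real n) \<partial>?P) =
      (\<integral>w. (\<Sum>k\<le>n. \<phi> (real k / real n) * indicator {w. npos w n = real k} w) \<partial>?P)"
  proof (rule Bochner_Integration.integral_cong[OF refl])
    fix w
    obtain l where l: "l \<le> n" "npos w n = real l" using npos_nat by blast
    have "(\<Sum>k\<le>n. \<phi> (real k / real n) * indicator {w. npos w n = real k} w) =
        (\<Sum>k\<le>n. if k = l then \<phi> (real k / real n) else 0)"
      using l by (intro sum.cong) auto
    then show "\<phi> (npos w n / real n) = (\<Sum>k\<le>n. \<phi> (real k / real n) * indicator {w. npos w n = real k} w)"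
      using l by simp
  qed
  also have "\<dots> = (\<Sum>k\<le>n. \<phi> (real k / real n) * measure ?P {w. npos w n = real k})"
    by (subst Bochner_Integration.integral_sum)
       (auto intro!: integrable_mult_right integrable_real_indicator meas simp: P.emeasure_eq_measure)
  also have "\<dots> = (\<Sum>k\<le>n. \<phi> (real k / real n) * (half_binomial k * half_binomial (n - k)))"
    using npos_law_symmetric[OF assms] by (intro sum.cong refl) simp
  finally show ?thesis .
qed

end

lemma std_normal_symmetric: "distr std_normal_distribution borel uminus = std_normal_distribution"
proof -
  interpret N: real_distribution std_normal_distribution by (rule real_dist_normal_dist)
  have "distributed std_normal_distribution lborel (\<lambda>x. x) std_normal_density"
    unfolding distributed_def by (auto simp: distr_id2)
  from N.normal_density_affine[OF this, of "-1" 0]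
  have "distr std_normal_distribution lborel uminus = std_normal_distribution"
    by (simp add: distributed_def)
  moreover have "distr std_normal_distribution lborel uminus = distr std_normal_distribution borel uminus"
    by (rule distr_cong) auto
  ultimately show ?thesis by simp
qed

lemma std_normal_atomless: "emeasure std_normal_distribution {x} = 0"
  by (subst emeasure_density) auto

lemma normal_walk_arcsine_limit:
  fixes \<phi> :: "real \<Rightarrow> real"
  assumes "continuous_on UNIV \<phi>"
  shows "(\<lambda>n. \<integral>w. \<phi> (npos w n / real n) \<partial>iid std_normal_distribution)
           \<longlonglongrightarrow> (\<integral>x. \<phi> x \<partial>arcsine_distribution)"
proof -
  interpret N: real_distribution std_normal_distribution by (rule real_dist_normal_dist)
  show ?thesis
    using beta_binomial_limit[OF assms]
    by (simp add: N.expectation_npos_symmetric[OF std_normal_symmetric std_normal_atomless])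
qed

section \<open>Centred walks of unit variance on a coarse time grid\<close>

text \<open>Skorohod's theorem is applied to a single step; the product of the resulting space with itself carries
  almost surely convergent copies of all walks at once. The count of positive partial sums is a
  discontinuous function, but it is continuous at walks without zeros, which are almost all
  walks with atomless steps.\<close>
lemma skorohod_iid:
  fixes \<phi> :: "real \<Rightarrow> real"
  assumes \<mu>: "\<And>n. real_distribution (\<mu> n)" and \<nu>: "real_distribution \<nu>"
    and weak: "weak_conv_m \<mu> \<nu>" and atomless: "\<And>x. emeasure \<nu> {x} = 0"
    and \<phi>[measurable]: "\<phi> \<in> borel_measurable borel" and B: "\<And>x. \<bar>\<phi> x\<bar> \<le> B"
  shows "(\<lambda>n. \<integral>w. \<phi> (npos w m) \<partial>iid (\<mu> n)) \<longlonglongrightarrow> (\<integral>w. \<phi> (npos w m) \<partial>iid \<nu>)"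
proof -
  obtain \<Omega> :: "real measure" and Z Y where \<Omega>: "prob_space \<Omega>"
    and Z[measurable]: "\<And>n. Z n \<in> borel_measurable \<Omega>" and Zd: "\<And>n. distr \<Omega> borel (Z n) = \<mu> n"
    and Y': "Y \<in> \<Omega> \<rightarrow>\<^sub>M lborel" and Yd: "distr \<Omega> borel Y = \<nu>"
    and lim: "\<And>x. x \<in> space \<Omega> \<Longrightarrow> (\<lambda>n. Z n x) \<longlonglongrightarrow> Y x"
    using Skorohod[OF \<mu> \<nu> weak] by blast
  have Y[measurable]: "Y \<in> borel_measurable \<Omega>" using Y' by simp
  interpret P: prob_space "iid \<Omega>" by (rule prob_space_iid) fact
  interpret \<nu>: real_distribution \<nu> by fact
  have comp: "(\<lambda>w i. g (w i)) \<in> iid \<Omega> \<rightarrow>\<^sub>M iid borel" if [measurable]: "g \<in> borel_measurable \<Omega>" for g :: "real \<Rightarrow> real"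
    by (rule measurable_iid) measurable
  have int: "(\<integral>w. \<phi> (npos w m) \<partial>iid (distr \<Omega> borel g)) = (\<integral>w. \<phi> (npos (\<lambda>i. g (w i)) m) \<partial>iid \<Omega>)"
    if g: "g \<in> borel_measurable \<Omega>" for g :: "real \<Rightarrow> real"
    unfolding distr_iid_map[OF \<Omega> g, symmetric]
    by (rule integral_distr[OF comp[OF g]]) measurable
  have meas: "(\<lambda>w. \<phi> (npos (\<lambda>i. g (w i)) m)) \<in> borel_measurable (iid \<Omega>)"
    if g: "g \<in> borel_measurable \<Omega>" for g :: "real \<Rightarrow> real"
    by (rule measurable_compose[OF comp[OF g] measurable_compose[OF measurable_npos \<phi>]])
  have "(\<lambda>n. \<integral>w. \<phi> (npos (\<lambda>i. Z n (w i)) m) \<partial>iid \<Omega>) \<longlonglongrightarrow> (\<integral>w. \<phi> (npos (\<lambda>i. Y (w i)) m) \<partial>iid \<Omega>)"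
  proof (rule integral_dominated_convergence[where w="\<lambda>_. B"])
    have "AE w in iid \<nu>. \<forall>j\<in>{1..m}. psum w j \<noteq> 0"
      by (intro AE_finite_allI \<nu>.AE_psum_nonzero atomless) auto
    then have "AE w in distr (iid \<Omega>) (iid borel) (\<lambda>w i. Y (w i)). \<forall>j\<in>{1..m}. psum w j \<noteq> 0"
      unfolding distr_iid_map[OF \<Omega> Y] Yd .
    then have "AE w in iid \<Omega>. \<forall>j\<in>{1..m}. psum (\<lambda>i. Y (w i)) j \<noteq> 0"
      by (rule AE_distrD[OF comp[OF Y]])
    then show "AE w in iid \<Omega>. (\<lambda>n. \<phi> (npos (\<lambda>i. Z n (w i)) m)) \<longlonglongrightarrow> \<phi> (npos (\<lambda>i. Y (w i)) m)"
      using AE_space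
    proof eventually_elim
      case (elim w)
      have conv: "(\<lambda>n. psum (\<lambda>i. Z n (w i)) j) \<longlonglongrightarrow> psum (\<lambda>i. Y (w i)) j" for j
        unfolding psum_def using elim(2) by (intro tendsto_sum lim) (auto simp: space_PiM)
      have "eventually (\<lambda>n. indicator {0<..} (psum (\<lambda>i. Z n (w i)) j) =
          (indicator {0<..} (psum (\<lambda>i. Y (w i)) j) :: real)) sequentially" if "j \<in> {1..m}" for j
      proof (cases "0 < psum (\<lambda>i. Y (w i)) j")
        case True
        from order_tendstoD(1)[OF conv this] show ?thesis
          by eventually_elim (use True in auto)
      next
        case False
        then have "psum (\<lambda>i. Y (w i)) j < 0" using elim(1) that by force
        from order_tendstoD(2)[OF conv this] show ?thesis
          by eventually_elim (use False in auto)
      qed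
      then have "eventually (\<lambda>n. \<forall>j\<in>{1..m}. indicator {0<..} (psum (\<lambda>i. Z n (w i)) j) =
          (indicator {0<..} (psum (\<lambda>i. Y (w i)) j) :: real)) sequentially"
        by (intro eventually_ball_finite) auto
      then have "eventually (\<lambda>n. \<phi> (npos (\<lambda>i. Z n (w i)) m) = \<phi> (npos (\<lambda>i. Y (w i)) m)) sequentially"
        unfolding npos_def by eventually_elim (auto intro!: arg_cong[where f=\<phi>] sum.cong)
      then show ?case by (rule tendsto_eventually)
    qed
  qed (use meas[OF Y] meas[OF Z] B in auto)
  then show ?thesis unfolding int[OF Z, symmetric] int[OF Y, symmetric] Zd Yd .
qed

locale unit_walk = real_distribution M for M :: "real measure" +
  assumes mean: "(\<integral>x. x \<partial>M) = 0" and sq_integrable: "integrable M (\<lambda>x. x\<^sup>2)"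
    and second_moment: "(\<integral>x. x\<^sup>2 \<partial>M) = 1"
begin

sublocale P: prob_space "iid M" by (rule prob_space_iid)

lemma distr_component: "distr (iid M) borel (\<lambda>w. w i) = M"
proof -
  have "distr (iid M) M (\<lambda>w. w i) = M"
    by (rule distr_PiM_component) (auto intro: prob_space_axioms)
  then show ?thesis by (metis distr_cong events_eq_borel)
qed

lemma integral_component:
  fixes g :: "real \<Rightarrow> real" assumes [measurable]: "g \<in> borel_measurable borel"
  shows "(\<integral>w. g (w i) \<partial>iid M) = (\<integral>x. g x \<partial>M)"
    and "integrable (iid M) (\<lambda>w. g (w i)) \<longleftrightarrow> integrable M g"
proof -
  have m: "(\<lambda>w. w i) \<in> borel_measurable (iid M)" by measurable
  show "(\<integral>w. g (w i) \<partial>iid M) = (\<integral>x. g x \<partial>M)"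
    using integral_distr[OF m, of g] by (simp add: distr_component)
  show "integrable (iid M) (\<lambda>w. g (w i)) \<longleftrightarrow> integrable M g"
    using integrable_distr_eq[OF m, of g] by (simp add: distr_component)
qed

lemma component_moments:
  "integrable (iid M) (\<lambda>w. w i)" "(\<integral>w. w i \<partial>iid M) = 0"
  "integrable (iid M) (\<lambda>w. (w i)\<^sup>2)" "(\<integral>w. (w i)\<^sup>2 \<partial>iid M) = 1"
proof -
  have int: "integrable M (\<lambda>x. x)"
    by (rule square_integrable_imp_integrable[OF _ sq_integrable]) simp
  have id: "(\<lambda>x::real. x) \<in> borel_measurable borel" "(\<lambda>x::real. x\<^sup>2) \<in> borel_measurable borel"
    by simp_all
  show "integrable (iid M) (\<lambda>w. w i)"
    by (rule integral_component(2)[OF id(1), THEN iffD2, OF int])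
  show "(\<integral>w. w i \<partial>iid M) = 0"
    by (rule trans[OF integral_component(1)[OF id(1)] mean])
  show "integrable (iid M) (\<lambda>w. (w i)\<^sup>2)"
    by (rule integral_component(2)[OF id(2), THEN iffD2, OF sq_integrable])
  show "(\<integral>w. (w i)\<^sup>2 \<partial>iid M) = 1"
    by (rule trans[OF integral_component(1)[OF id(2)] second_moment])
qed

lemma indep_components: "P.indep_vars (\<lambda>_. borel) (\<lambda>i w. w i) UNIV"
  by (rule P.indep_vars_compose2[OF indep_vars_iid[OF prob_space_axioms], where Y="\<lambda>_ x. x"])
     measurable

lemma psum_moments:
  shows "integrable (iid M) (\<lambda>w. psum w n)" and "(\<integral>w. psum w n \<partial>iid M) = 0"
    and "integrable (iid M) (\<lambda>w. (psum w n)\<^sup>2)" and "(\<integral>w. (psum w n)\<^sup>2 \<partial>iid M) = real n"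
proof -
  show int: "integrable (iid M) (\<lambda>w. psum w n)" for n
    unfolding psum_def by (intro Bochner_Integration.integrable_sum component_moments)
  show "(\<integral>w. psum w n \<partial>iid M) = 0"
    unfolding psum_def by (subst Bochner_Integration.integral_sum) (simp_all add: component_moments)
  have "integrable (iid M) (\<lambda>w. (psum w n)\<^sup>2) \<and> (\<integral>w. (psum w n)\<^sup>2 \<partial>iid M) = real n"
  proof (induction n)
    case (Suc n)
    have "P.indep_var borel (\<lambda>w. w n) borel (\<lambda>w. \<Sum>i<n. w i)"
      by (rule P.indep_vars_sum) (auto intro: P.indep_vars_subset[OF indep_components])
    then have indep: "P.indep_var borel (\<lambda>w. w n) borel (\<lambda>w. psum w n)" by (simp add: psum_def)
    note cross = P.indep_var_lebesgue_integral[OF indep component_moments(1) int]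
      P.indep_var_integrable[OF indep component_moments(1) int]
    have "(psum w (Suc n))\<^sup>2 = (psum w n)\<^sup>2 + 2 * (w n * psum w n) + (w n)\<^sup>2" for w
      by (simp add: psum_Suc power2_sum)
    then show ?case
      using Suc cross component_moments by simp
  qed simp
  then show "integrable (iid M) (\<lambda>w. (psum w n)\<^sup>2)" "(\<integral>w. (psum w n)\<^sup>2 \<partial>iid M) = real n"
    by auto
qed

lemma prob_psum_ge:
  assumes "t > 0"
  shows "measure (iid M) {w. t \<le> \<bar>psum w n\<bar>} \<le> real n / t\<^sup>2"
proof -
  have "measure (iid M) {w \<in> space (iid M). t \<le> \<bar>psum w n - (\<integral>w. psum w n \<partial>iid M)\<bar>} \<le>
      (\<integral>w. (psum w n - (\<integral>w. psum w n \<partial>iid M))\<^sup>2 \<partial>iid M) / t\<^sup>2"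
    by (rule P.Chebyshev_inequality[where f="\<lambda>w. psum w n", OF _ psum_moments(3) assms]) measurable
  then show ?thesis
    by (simp only: psum_moments diff_0_right space_iid UNIV_I simp_thms)
qed

lemma psum_clt:
  "weak_conv_m (\<lambda>n. distr (iid M) borel (\<lambda>w. psum w n / sqrt n)) std_normal_distribution"
proof -
  have "weak_conv_m (\<lambda>n. distr (iid M) borel (\<lambda>w. (\<Sum>i<n. w i) / sqrt (real n * 1\<^sup>2))) std_normal_distribution"
    by (rule P.central_limit_theorem_zero_mean[OF indep_components _ _ _ _ distr_component])
       (simp_all only: component_moments diff_0_right power_one zero_less_one)
  then show ?thesis by (simp only: psum_def power_one mult_1_right)
qed

lemma real_distribution_psum: "real_distribution (distr (iid M) borel (\<lambda>w. psum w n / c))"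
  by (rule P.real_distribution_distr) measurable

text \<open>The rescaled increments over consecutive blocks of length \<open>b\<close> are again independent and identically
  distributed, so the walk at multiples of \<open>b\<close> is a walk whose step law depends on \<open>b\<close>.\<close>
lemma block_law:
  "distr (iid M) (iid borel) (\<lambda>w i. psum (\<lambda>l. w (i * b + l)) b / sqrt b) =
    iid (distr (iid M) borel (\<lambda>w. psum w b / sqrt b))"
proof (rule P.distr_indep_identical_eq_iid)
  let ?K = "\<lambda>i. {i * b..<Suc i * b}"
  let ?Y = "\<lambda>i g. (\<Sum>l<b. g (i * b + l)) / sqrt b"
  have "P.indep_vars (\<lambda>i. PiM (?K i) (\<lambda>_. borel)) (\<lambda>i w. restrict (\<lambda>l. w l) (?K i)) UNIV"
  proof (rule P.indep_vars_restrict[OF indep_components])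
    show "disjoint_family_on ?K UNIV"
      unfolding disjoint_family_on_def
    proof (intro ballI impI)
      fix i j :: nat assume "i \<noteq> j"
      then consider "Suc i \<le> j" | "Suc j \<le> i" by linarith
      then show "?K i \<inter> ?K j = {}"
      proof cases
        case 1
        from mult_le_mono1[OF this, of b] show ?thesis by auto
      next
        case 2
        from mult_le_mono1[OF this, of b] show ?thesis by auto
      qed
    qed
  qed auto
  then have "P.indep_vars (\<lambda>_. borel) (\<lambda>i w. ?Y i (restrict (\<lambda>l. w l) (?K i))) UNIV"
  proof (rule P.indep_vars_compose2)
    fix i :: nat
    show "?Y i \<in> borel_measurable (PiM (?K i) (\<lambda>_. borel))"
      by (intro borel_measurable_divide borel_measurable_sum measurable_component_singleton) auto
  qed
  moreover have "?Y i (restrict (\<lambda>l. w l) (?K i)) = psum (\<lambda>l. w (i * b + l)) b / sqrt b" for i w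
    by (simp add: psum_def)
  ultimately show "P.indep_vars (\<lambda>_. borel) (\<lambda>i w. psum (\<lambda>l. w (i * b + l)) b / sqrt b) UNIV"
    by (simp only:)
next
  fix i
  have "inj (\<lambda>l. i * b + l)" by simp
  note re = distr_iid_reindex[OF prob_space_axioms this]
  have "distr (iid M) borel (\<lambda>w. psum w b / sqrt b) =
      distr (distr (iid M) (iid M) (\<lambda>w l. w (i * b + l))) borel (\<lambda>w. psum w b / sqrt b)"
    by (simp only: re)
  also have "\<dots> = distr (iid M) borel (\<lambda>w. psum (\<lambda>l. w (i * b + l)) b / sqrt b)"
  proof (subst distr_distr)
    show "(\<lambda>w l. w (i * b + l)) \<in> iid M \<rightarrow>\<^sub>M iid M"
      unfolding measurable_cong_sets[OF sets_iid sets_iid] by (rule measurable_reindex)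
    show "(\<lambda>w. psum w b / sqrt b) \<in> borel_measurable (iid M)" by measurable
  qed (simp add: comp_def)
  finally show "distr (iid M) borel (\<lambda>w. psum (\<lambda>l. w (i * b + l)) b / sqrt b) =
      distr (iid M) borel (\<lambda>w. psum w b / sqrt b)" ..
qed

text \<open>Counts the positive partial sums at the first \<open>m\<close> block ends.\<close>
definition grid_npos :: "nat \<Rightarrow> nat \<Rightarrow> (nat \<Rightarrow> real) \<Rightarrow> real"
  where "grid_npos b m w = (\<Sum>i=1..m. indicator {0<..} (psum w (i * b)))"

lemma grid_npos_measurable[measurable]: "grid_npos b m \<in> borel_measurable (iid borel)"
  unfolding grid_npos_def by measurable

lemma grid_npos_limit:
  fixes \<phi> :: "real \<Rightarrow> real"
  assumes [measurable]: "\<phi> \<in> borel_measurable borel" and B: "\<And>x. \<bar>\<phi> x\<bar> \<le> B"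
  shows "(\<lambda>b. \<integral>w. \<phi> (grid_npos b m w) \<partial>iid M) \<longlonglongrightarrow> (\<integral>w. \<phi> (npos w m) \<partial>iid std_normal_distribution)"
proof (rule Lim_transform_eventually)
  show "(\<lambda>b. \<integral>w. \<phi> (npos w m) \<partial>iid (distr (iid M) borel (\<lambda>w. psum w b / sqrt b)))
      \<longlonglongrightarrow> (\<integral>w. \<phi> (npos w m) \<partial>iid std_normal_distribution)"
    by (rule skorohod_iid[OF real_distribution_psum real_dist_normal_dist psum_clt std_normal_atomless _ B]) simp
  have "(\<integral>w. \<phi> (npos w m) \<partial>iid (distr (iid M) borel (\<lambda>w. psum w b / sqrt b))) =
      (\<integral>w. \<phi> (grid_npos b m w) \<partial>iid M)" if b: "b > 0" for b
  proof -
    let ?Z = "\<lambda>w i. psum (\<lambda>l. w (i * b + l)) b / sqrt b"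
    have Z: "?Z \<in> iid M \<rightarrow>\<^sub>M iid borel"
    proof (rule measurable_iid)
      show "(\<lambda>w. ?Z w i) \<in> borel_measurable (iid M)" for i
        unfolding psum_def by measurable
    qed
    have sum: "psum (?Z w) i = psum w (i * b) / sqrt b" for w i
    proof (induction i)
      case (Suc i)
      have "psum w (Suc i * b) = psum w (i * b) + psum (\<lambda>l. w (i * b + l)) b"
        using psum_add[of w "i * b" b] by (simp add: add.commute)
      then show ?case using Suc by (simp add: psum_Suc add_divide_distrib)
    qed simp
    have "npos (?Z w) m = grid_npos b m w" for w
      unfolding npos_def grid_npos_def sum using b
      by (intro sum.cong refl) (simp add: indicator_def zero_less_divide_iff)
    then show ?thesis
      unfolding block_law[symmetric] by (subst integral_distr[OF Z]) simp_all
  qed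
  then show "eventually (\<lambda>b. (\<integral>w. \<phi> (npos w m) \<partial>iid (distr (iid M) borel (\<lambda>w. psum w b / sqrt b))) =
      (\<integral>w. \<phi> (grid_npos b m w) \<partial>iid M)) sequentially"
    by (rule eventually_mono[OF eventually_gt_at_top[of 0]])
qed

end

section \<open>Occupation times of half-lines\<close>

definition occupation :: "real set \<Rightarrow> nat \<Rightarrow> (nat \<Rightarrow> real) \<Rightarrow> real"
  where "occupation A n w = (\<Sum>j<n. indicator A (psum w j)) / real n"

lemma occupation_measurable[measurable]:
  assumes [measurable]: "A \<in> sets borel"
  shows "occupation A n \<in> borel_measurable (iid borel)"
  unfolding occupation_def by measurable

text \<open>Any bound of smaller order than \<open>m\<close> serves, since the sum is divided by \<open>m\<close> afterwards.\<close>
lemma sum_inverse_le_sqrt: "(\<Sum>i<m. 1 / real (Suc i)) \<le> 2 * sqrt m"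
proof (induction m)
  case (Suc m)
  have "1 / real (Suc m) \<le> 1 / sqrt (Suc m)"
    using real_sqrt_le_mono[of "real (Suc m)" "(real (Suc m))\<^sup>2"]
    by (intro divide_left_mono) (auto simp: power2_eq_square simp del: of_nat_Suc)
  also have "\<dots> \<le> 2 * (sqrt (Suc m) - sqrt m)"
  proof -
    have "1 / s \<le> 2 * (s - t)" if "(s - t) * (s + t) = 1" "t \<le> s" "0 < s" for s t :: real
    proof -
      have "(s - t) * (s + t) \<le> (s - t) * (2 * s)" using that by (intro mult_left_mono) auto
      then have "1 \<le> 2 * (s - t) * s" using that(1) by (simp only: mult_ac)
      then show ?thesis using that(3) by (simp only: pos_divide_le_eq)
    qed
    from this[of "sqrt (Suc m)" "sqrt m"] show ?thesis by (simp add: algebra_simps)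
  qed
  finally show ?case using Suc by simp
qed simp

context unit_walk
begin

text \<open>The central limit theorem rules out that the walk is much closer to 0 than the square root of time.\<close>
lemma small_ball:
  assumes "\<epsilon> > 0"
  obtains \<delta> N where "\<delta> > 0"
    and "\<And>n. n \<ge> N \<Longrightarrow> measure (iid M) {w. \<bar>psum w n\<bar> \<le> 2 * \<delta> * sqrt n} \<le> \<epsilon>"
proof -
  interpret N: real_distribution std_normal_distribution by (rule real_dist_normal_dist)
  let ?\<mu> = "\<lambda>n. distr (iid M) borel (\<lambda>w. psum w n / sqrt (real n))"
  let ?\<Phi> = "cdf std_normal_distribution"
  have cont: "isCont ?\<Phi> x" for x
    using std_normal_atomless[of x] by (simp add: N.isCont_cdf measure_def)
  have conv: "(\<lambda>n. cdf (?\<mu> n) x) \<longlonglongrightarrow> ?\<Phi> x" for x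
    using psum_clt cont unfolding weak_conv_m_def weak_conv_def by blast
  obtain d' where d': "d' > 0" "\<And>x. \<bar>x\<bar> < d' \<Longrightarrow> \<bar>?\<Phi> x - ?\<Phi> 0\<bar> < \<epsilon> / 4"
    using cont[of 0] assms unfolding continuous_at_eps_delta
    by (metis diff_zero dist_real_def divide_pos_pos zero_less_numeral)
  define d where "d = d' / 2"
  have d: "d > 0" "\<bar>?\<Phi> d - ?\<Phi> 0\<bar> < \<epsilon> / 4" "\<bar>?\<Phi> (- d) - ?\<Phi> 0\<bar> < \<epsilon> / 4"
    using d' by (auto simp: d_def)
  have "eventually (\<lambda>n. \<bar>cdf (?\<mu> n) x - ?\<Phi> x\<bar> < \<epsilon> / 4) sequentially" for x
    using tendstoD[OF conv, of "\<epsilon>/4" x] assms by (simp add: dist_real_def)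
  then have "eventually (\<lambda>n. \<bar>cdf (?\<mu> n) d - ?\<Phi> d\<bar> < \<epsilon> / 4 \<and> \<bar>cdf (?\<mu> n) (-d) - ?\<Phi> (-d)\<bar> < \<epsilon> / 4 \<and> n > 0) sequentially"
    by (intro eventually_conj eventually_gt_at_top)
  then obtain N where N: "\<And>n. n \<ge> N \<Longrightarrow> \<bar>cdf (?\<mu> n) d - ?\<Phi> d\<bar> < \<epsilon> / 4"
      "\<And>n. n \<ge> N \<Longrightarrow> \<bar>cdf (?\<mu> n) (-d) - ?\<Phi> (-d)\<bar> < \<epsilon> / 4" "\<And>n. n \<ge> N \<Longrightarrow> n > 0"
    unfolding eventually_sequentially by blast
  show thesis
  proof (rule that[of "d / 4" N])
    show "d / 4 > 0" using d by simp
    fix n assume n: "N \<le> n"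
    interpret D: real_distribution "?\<mu> n" by (rule real_distribution_psum)
    have "measure (iid M) {w. \<bar>psum w n\<bar> \<le> 2 * (d / 4) * sqrt n} \<le> measure (?\<mu> n) {-d<..d}"
    proof -
      have "measure (?\<mu> n) {-d<..d} = measure (iid M) ((\<lambda>w. psum w n / sqrt n) -` {-d<..d} \<inter> space (iid M))"
        by (rule measure_distr) auto
      moreover have "measure (iid M) {w. \<bar>psum w n\<bar> \<le> 2 * (d / 4) * sqrt n} \<le>
          measure (iid M) ((\<lambda>w. psum w n / sqrt n) -` {-d<..d} \<inter> space (iid M))"
      proof (rule P.finite_measure_mono)
        have "(\<lambda>w. psum w n / sqrt n) \<in> borel_measurable (iid M)" by measurable
        then show "(\<lambda>w. psum w n / sqrt n) -` {-d<..d} \<inter> space (iid M) \<in> P.events"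
          by (rule measurable_sets) simp
        show "{w. \<bar>psum w n\<bar> \<le> 2 * (d / 4) * sqrt n} \<subseteq> (\<lambda>w. psum w n / sqrt n) -` {-d<..d} \<inter> space (iid M)"
        proof
          fix w assume "w \<in> {w. \<bar>psum w n\<bar> \<le> 2 * (d / 4) * sqrt n}"
          then have "\<bar>psum w n / sqrt n\<bar> \<le> d / 2"
            using N(3)[OF n] by (simp add: pos_divide_le_eq)
          then have "- d < psum w n / sqrt n" "psum w n / sqrt n \<le> d" using d(1) by linarith+
          then show "w \<in> (\<lambda>w. psum w n / sqrt n) -` {-d<..d} \<inter> space (iid M)"
            by (simp only: vimage_eq Int_iff space_iid UNIV_I greaterThanAtMost_iff simp_thms)
        qed
      qed
      ultimately show ?thesis by simp
    qed
    also have "measure (?\<mu> n) {-d<..d} = cdf (?\<mu> n) d - cdf (?\<mu> n) (-d)"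
      using d(1) by (intro D.cdf_diff_eq[symmetric]) simp
    also have "\<dots> \<le> \<epsilon>"
      using N(1)[OF n] N(2)[OF n] d by linarith
    finally show "measure (iid M) {w. \<bar>psum w n\<bar> \<le> 2 * (d / 4) * sqrt n} \<le> \<epsilon>" .
  qed
qed

lemma measure_psum_shift:
  "measure (iid M) {w. t \<le> \<bar>psum (\<lambda>i. w (j + i)) k\<bar>} = measure (iid M) {w. t \<le> \<bar>psum w k\<bar>}"
proof -
  have "Measurable.pred (iid M) (\<lambda>w. t \<le> \<bar>psum w k\<bar>)" by measurable
  from predE[OF this] have meas: "{w. t \<le> \<bar>psum w k\<bar>} \<in> sets (iid M)" by simp
  have "inj (\<lambda>i. j + i)" by simp
  from measure_iid_reindex[OF prob_space_axioms this meas] show ?thesis by simp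
qed

lemma integrable_sign_mismatch:
  assumes [measurable]: "A \<in> sets borel"
  shows "integrable (iid M) (\<lambda>w. \<bar>indicator A (psum w j) - indicator {0<..} (psum w n) :: real\<bar>)"
proof (rule P.integrable_const_bound[where B=1])
  show "AE w in iid M. norm \<bar>indicator A (psum w j) - indicator {0<..} (psum w n) :: real\<bar> \<le> 1"
    by (intro AE_I2) (simp add: indicator_def)
qed measurable

text \<open>If the walk is far from 0 at time \<open>n\<close> and moves little between \<open>j\<close> and \<open>n\<close>, then it is on the same side,
  outside the window of radius \<open>K\<close>, at both times. The first condition fails with small
  probability by assumption, the second by Chebyshev's inequality.\<close>
lemma sign_mismatch:
  assumes A[measurable]: "A \<in> sets borel" and AK: "{K<..} \<subseteq> A" "A \<subseteq> {-K..}"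
    and "j \<le> n" "n - j \<le> b" "n > 0" and \<delta>: "\<delta> > 0" "K < \<delta> * sqrt n"
    and small: "measure (iid M) {w. \<bar>psum w n\<bar> \<le> 2 * \<delta> * sqrt n} \<le> \<epsilon>"
  shows "(\<integral>w. \<bar>indicator A (psum w j) - indicator {0<..} (psum w n)\<bar> \<partial>iid M) \<le> \<epsilon> + b / (\<delta>\<^sup>2 * n)"
proof -
  let ?E = "{w. \<bar>psum w n\<bar> \<le> 2 * \<delta> * sqrt n}"
  let ?F = "{w. \<delta> * sqrt n \<le> \<bar>psum (\<lambda>i. w (j + i)) (n - j)\<bar>}"
  have t: "\<delta> * sqrt n > 0" using assms by simp
  have "Measurable.pred (iid M) (\<lambda>w. \<bar>psum w n\<bar> \<le> 2 * \<delta> * sqrt n)" by measurable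
  from predE[OF this] have E: "?E \<in> sets (iid M)" by simp
  have "Measurable.pred (iid M) (\<lambda>w. \<delta> * sqrt n \<le> \<bar>psum (\<lambda>i. w (j + i)) (n - j)\<bar>)"
    unfolding psum_def by measurable
  from predE[OF this] have F: "?F \<in> sets (iid M)" by simp
  have "(\<integral>w. \<bar>indicator A (psum w j) - indicator {0<..} (psum w n)\<bar> \<partial>iid M) \<le>
      (\<integral>w. (indicator ?E w + indicator ?F w :: real) \<partial>iid M)"
  proof (rule integral_mono)
    show "integrable (iid M) (\<lambda>w. \<bar>indicator A (psum w j) - indicator {0<..} (psum w n) :: real\<bar>)"
      by (rule integrable_sign_mismatch[OF A])
    show "integrable (iid M) (\<lambda>w. indicator ?E w + indicator ?F w :: real)"
      using E F by (intro Bochner_Integration.integrable_add integrable_real_indicator) (simp_all add: P.emeasure_eq_measure)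
    fix w
    have split: "psum w n = psum w j + psum (\<lambda>i. w (j + i)) (n - j)"
      using psum_add[of w j "n - j"] assms(4) by simp
    show "\<bar>indicator A (psum w j) - indicator {0<..} (psum w n) :: real\<bar> \<le> indicator ?E w + indicator ?F w"
    proof (cases "w \<in> ?E \<or> w \<in> ?F")
      case True
      then show ?thesis by (auto simp: indicator_def)
    next
      case False
      then have *: "2 * (\<delta> * sqrt n) < \<bar>psum w n\<bar>" "\<bar>psum (\<lambda>i. w (j + i)) (n - j)\<bar> < \<delta> * sqrt n"
        by (auto simp: not_le)
      show ?thesis
      proof (cases "psum w n > 0")
        case True
        then have "psum w j > K" using * split \<delta>(2) by linarith
        then show ?thesis using True AK(1) by auto
      next
        case neg: False
        then have "psum w j < - K" using * split \<delta>(2) by linarith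
        then have "psum w j \<notin> A" using AK(2) by auto
        then show ?thesis using neg by simp
      qed
    qed
  qed
  also have "\<dots> = measure (iid M) ?E + measure (iid M) ?F"
    using E F by (subst Bochner_Integration.integral_add)
      (simp_all add: integrable_real_indicator P.emeasure_eq_measure)
  also have "measure (iid M) ?F = measure (iid M) {w. \<delta> * sqrt n \<le> \<bar>psum w (n - j)\<bar>}"
    by (rule measure_psum_shift)
  also have "\<dots> \<le> real (n - j) / (\<delta> * sqrt n)\<^sup>2" using t by (rule prob_psum_ge)
  also have "\<dots> \<le> real b / (\<delta> * sqrt n)\<^sup>2"
    using assms(5) by (intro divide_right_mono) auto
  also have "\<dots> = real b / (\<delta>\<^sup>2 * n)" by (simp add: power_mult_distrib)
  finally show ?thesis using small by simp
qed

text \<open>The first term accounts for the fewer than \<open>m\<close> times after the last complete block.\<close>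
lemma occupation_grid_pointwise:
  assumes m: "m > 0" and b: "b = n div m" "b > 0"
  shows "\<bar>occupation A n w - grid_npos b m w / m\<bar> \<le> m / n +
    (\<Sum>i<m. \<Sum>j\<in>{b*i..<b*i+b}. \<bar>indicator A (psum w j) - indicator {0<..} (psum w (Suc i * b))\<bar>) / (real m * real b)"
proof -
  let ?q = "\<lambda>j. indicator A (psum w j) :: real"
  let ?r = "\<lambda>i. indicator {0<..} (psum w (Suc i * b)) :: real"
  define k where "k = m * b"
  have kn: "k \<le> n" "n < k + m" using m b dividend_less_times_div[of m n] div_times_less_eq_dividend[of n m]
    unfolding k_def by (simp_all add: mult.commute add.commute)
  have k0: "0 < k" using m b by (simp add: k_def)
  define T where "T = (\<Sum>j<k. ?q j)"
  define U where "U = (\<Sum>j\<in>{k..<n}. ?q j)"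
  have T: "0 \<le> T" "T \<le> k"
    using sum_mono[of "{..<k}" ?q "\<lambda>_. 1"] by (auto simp: T_def indicator_def intro!: sum_nonneg)
  have U: "0 \<le> U" "U \<le> real n - real k"
    using sum_mono[of "{k..<n}" ?q "\<lambda>_. 1"] kn by (auto simp: U_def indicator_def of_nat_diff intro!: sum_nonneg)
  have occ: "occupation A n w = (T + U) / n"
    unfolding occupation_def T_def U_def
    using kn by (subst sum.union_disjoint[symmetric]) (auto intro!: arg_cong2[where f="(/)"] sum.cong)
  have n0: "0 < n" using k0 kn by simp
  have first: "\<bar>(T + U) / n - T / k\<bar> \<le> m / n"
  proof -
    define V where "V = T / k * (real n - real k)"
    have eq: "(T + U) / n - T / k = (U - V) / n"
      unfolding V_def using k0 n0 by (simp add: field_simps)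
    have "T / k \<le> 1" "0 \<le> T / k" using T k0 by simp_all
    then have "0 \<le> V"
      unfolding V_def using kn by (intro mult_nonneg_nonneg) auto
    moreover have "V \<le> real n - real k"
      unfolding V_def using kn mult_right_mono[OF \<open>T / k \<le> 1\<close>, of "real n - real k"] by simp
    moreover have "real n < real k + real m" using kn(2) by (simp flip: of_nat_add)
    ultimately have "\<bar>U - V\<bar> \<le> m"
      using U by (intro abs_leI) linarith+
    then show ?thesis unfolding eq using n0 by (simp add: divide_right_mono)
  qed
  have group: "T = (\<Sum>i<m. \<Sum>j\<in>{b*i..<b*i+b}. ?q j)"
  proof -
    have "{b * i..<b * i + b} = {i * b..<i * b + b}" for i by (simp only: mult.commute)
    then show ?thesis unfolding T_def k_def by (simp only: sum.nat_group)
  qed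
  have "grid_npos b m w = (\<Sum>i<m. ?r i)"
    unfolding grid_npos_def by (rule sum.reindex_bij_witness[of _ Suc "\<lambda>i. i - 1"]) auto
  also have "\<dots> = (\<Sum>i<m. \<Sum>j\<in>{b*i..<b*i+b}. ?r i) / b"
    using b by (simp add: sum_distrib_left[symmetric])
  finally have grid: "grid_npos b m w / m = (\<Sum>i<m. \<Sum>j\<in>{b*i..<b*i+b}. ?r i) / k"
    by (simp add: k_def mult.commute)
  have diff: "T / k - grid_npos b m w / m = (\<Sum>i<m. \<Sum>j\<in>{b*i..<b*i+b}. ?q j - ?r i) / k"
    unfolding grid group by (simp only: sum_subtractf diff_divide_distrib)
  have second: "\<bar>T / k - grid_npos b m w / m\<bar> \<le> (\<Sum>i<m. \<Sum>j\<in>{b*i..<b*i+b}. \<bar>?q j - ?r i\<bar>) / k"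
    unfolding diff abs_divide abs_of_nat
    by (intro divide_right_mono order_trans[OF sum_abs] sum_mono sum_abs) auto
  have triangle: "\<bar>x - z\<bar> \<le> p + r" if "\<bar>x - y\<bar> \<le> p" "\<bar>y - z\<bar> \<le> r" for x y z p r :: real
    using that abs_triangle_ineq[of "x - y" "y - z"] by simp
  have k: "real m * real b = real k" by (simp add: k_def)
  show ?thesis
    unfolding occ k by (rule triangle[OF first second])
qed

text \<open>Chebyshev's error for the \<open>i\<close>-th block is of order \<open>1 / Suc i\<close>, because the scale of the walk grows with
  time while the block length is fixed; averaging over \<open>m\<close> blocks makes it small.\<close>
lemma occupation_grid_L1:
  assumes A[measurable]: "A \<in> sets borel" and AK: "{K<..} \<subseteq> A" "A \<subseteq> {-K..}"
    and m: "m > 0" and b: "b = n div m" "b > 0" and \<delta>: "\<delta> > 0" "K < \<delta> * sqrt b"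
    and small: "\<And>n. n \<ge> b \<Longrightarrow> measure (iid M) {w. \<bar>psum w n\<bar> \<le> 2 * \<delta> * sqrt n} \<le> \<epsilon>"
  shows "(\<integral>w. \<bar>occupation A n w - grid_npos b m w / m\<bar> \<partial>iid M) \<le> m / n + \<epsilon> + 2 / (\<delta>\<^sup>2 * sqrt m)"
proof -
  let ?d = "\<lambda>i j w. \<bar>indicator A (psum w j) - indicator {0<..} (psum w (Suc i * b))\<bar> :: real"
  have int: "integrable (iid M) (?d i j)" for i j
    by (rule integrable_sign_mismatch[OF A])
  define D where "D w = (\<Sum>i<m. \<Sum>j\<in>{b*i..<b*i+b}. ?d i j w)" for w
  have intD: "integrable (iid M) D"
    unfolding D_def by (intro Bochner_Integration.integrable_sum int)
  have integralD: "(\<integral>w. D w \<partial>iid M) = (\<Sum>i<m. \<Sum>j\<in>{b*i..<b*i+b}. \<integral>w. ?d i j w \<partial>iid M)"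
  proof -
    have "(\<integral>w. D w \<partial>iid M) = (\<Sum>i<m. \<integral>w. (\<Sum>j\<in>{b*i..<b*i+b}. ?d i j w) \<partial>iid M)"
      unfolding D_def by (rule Bochner_Integration.integral_sum) (intro Bochner_Integration.integrable_sum int)
    also have "\<dots> = (\<Sum>i<m. \<Sum>j\<in>{b*i..<b*i+b}. \<integral>w. ?d i j w \<partial>iid M)"
      by (intro sum.cong refl Bochner_Integration.integral_sum int)
    finally show ?thesis .
  qed
  have prob_UNIV: "measure (iid M) UNIV = 1" using P.prob_space by simp
  have "(\<integral>w. \<bar>occupation A n w - grid_npos b m w / m\<bar> \<partial>iid M) \<le>
      (\<integral>w. m / n + D w / (real m * real b) \<partial>iid M)"
  proof (rule integral_mono')
    show "integrable (iid M) (\<lambda>w. m / n + D w / (real m * real b))"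
      by (intro Bochner_Integration.integrable_add integrable_divide intD P.integrable_const)
    show "\<bar>occupation A n w - grid_npos b m w / m\<bar> \<le> m / n + D w / (real m * real b)" for w
      unfolding D_def by (rule occupation_grid_pointwise[OF m b])
    then show "0 \<le> m / n + D w / (real m * real b)" for w
      by (rule order_trans[OF abs_ge_zero])
  qed
  also have "\<dots> = m / n + (\<integral>w. D w \<partial>iid M) / (real m * real b)"
    using Bochner_Integration.integral_add[OF P.integrable_const integrable_divide[OF intD]]
    by (simp only: lebesgue_integral_const integral_divide_zero space_iid prob_UNIV scaleR_one)
  also have "\<dots> = m / n + (\<Sum>i<m. \<Sum>j\<in>{b*i..<b*i+b}. \<integral>w. ?d i j w \<partial>iid M) / (real m * real b)"
    by (simp only: integralD)
  also have "\<dots> \<le> m / n + (\<Sum>i<m. \<Sum>j\<in>{b*i..<b*i+b}. \<epsilon> + 1 / \<delta>\<^sup>2 * (1 / real (Suc i))) / (real m * real b)"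
  proof (intro add_left_mono divide_right_mono sum_mono)
    fix i j assume j: "j \<in> {b*i..<b*i+b}"
    have bs: "b \<le> Suc i * b" by simp
    have "(\<integral>w. ?d i j w \<partial>iid M) \<le> \<epsilon> + b / (\<delta>\<^sup>2 * real (Suc i * b))"
    proof (rule sign_mismatch[OF A AK _ _ _ \<delta>(1) _ small[OF bs]])
      show "j \<le> Suc i * b" "Suc i * b - j \<le> b" "0 < Suc i * b"
        using j b by (auto simp: mult.commute)
      have "sqrt b \<le> sqrt (Suc i * b)" using bs by (simp only: real_sqrt_le_iff of_nat_le_iff)
      then have "\<delta> * sqrt b \<le> \<delta> * sqrt (Suc i * b)" using \<delta>(1) by (intro mult_left_mono) auto
      then show "K < \<delta> * sqrt (Suc i * b)" using \<delta>(2) by simp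
    qed
    also have "b / (\<delta>\<^sup>2 * real (Suc i * b)) = 1 / \<delta>\<^sup>2 * (1 / real (Suc i))"
      using b by (simp del: mult_Suc of_nat_Suc)
    finally show "(\<integral>w. ?d i j w \<partial>iid M) \<le> \<epsilon> + 1 / \<delta>\<^sup>2 * (1 / real (Suc i))" .
  qed simp
  also have "(\<Sum>i<m. \<Sum>j\<in>{b*i..<b*i+b}. \<epsilon> + 1 / \<delta>\<^sup>2 * (1 / real (Suc i))) / (real m * real b) =
      \<epsilon> + 1 / \<delta>\<^sup>2 * (\<Sum>i<m. 1 / real (Suc i)) / m"
  proof -
    have const: "(\<Sum>i<m. \<Sum>j\<in>{b*i..<b*i+b}. c i) = b * (\<Sum>i<m. c i)" for c :: "nat \<Rightarrow> real"
      by (simp add: sum_distrib_left)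
    have "(\<Sum>i<m. \<Sum>j\<in>{b*i..<b*i+b}. \<epsilon> + 1 / \<delta>\<^sup>2 * (1 / real (Suc i))) =
        b * (m * \<epsilon> + 1 / \<delta>\<^sup>2 * (\<Sum>i<m. 1 / real (Suc i)))"
      unfolding const by (simp only: sum.distrib sum_distrib_left[symmetric] sum_constant card_lessThan)
    moreover have "real b * (real m * e + d) / (real m * real b) = e + d / real m" for e d
      using m b by (simp add: add_divide_distrib)
    ultimately show ?thesis by (simp only:)
  qed
  also have "m / n + (\<epsilon> + 1 / \<delta>\<^sup>2 * (\<Sum>i<m. 1 / real (Suc i)) / m) \<le> m / n + (\<epsilon> + 1 / \<delta>\<^sup>2 * (2 * sqrt m) / m)"
    by (intro add_left_mono divide_right_mono mult_left_mono sum_inverse_le_sqrt) auto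
  also have "1 / \<delta>\<^sup>2 * (2 * sqrt m) / m = 2 / (\<delta>\<^sup>2 * sqrt m)"
  proof -
    have "1 / d * (2 * s) / (s * s) = 2 / (d * s)" if "s \<noteq> 0" for s d :: real
      using that by simp
    from this[of "sqrt m" "\<delta>\<^sup>2"] show ?thesis using m by simp
  qed
  finally show ?thesis by (simp only: add.assoc)
qed

lemma occupation_in_unit: "occupation A n w \<in> {0..1}"
proof -
  have "(\<Sum>j<n. indicator A (psum w j)) \<le> (\<Sum>j<n. 1::real)"
    by (intro sum_mono) (simp add: indicator_def)
  then show ?thesis
    by (cases "n = 0") (simp_all add: occupation_def sum_nonneg)
qed

lemma grid_npos_in_unit: "grid_npos b m w / m \<in> {0..1}"
proof -
  have "(\<Sum>i=1..m. indicator {0<..} (psum w (i * b))) \<le> (\<Sum>i=1..m. 1::real)"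
    by (intro sum_mono) (simp add: indicator_def)
  then show ?thesis
    by (cases "m = 0") (simp_all add: grid_npos_def sum_nonneg)
qed

lemma grid_transfer:
  fixes \<phi> :: "real \<Rightarrow> real"
  assumes A[measurable]: "A \<in> sets borel" and AK: "{K<..} \<subseteq> A" "A \<subseteq> {-K..}"
    and \<phi>[measurable]: "\<phi> \<in> borel_measurable borel" and B: "\<And>x. \<bar>\<phi> x\<bar> \<le> B"
    and L: "L > 0" "\<And>x y. \<bar>\<phi> x - \<phi> y\<bar> \<le> L * \<bar>x - y\<bar>"
    and m: "m > 0" and b: "b = n div m" "b > 0" and \<delta>: "\<delta> > 0" "K < \<delta> * sqrt b"
    and small: "\<And>n. n \<ge> b \<Longrightarrow> measure (iid M) {w. \<bar>psum w n\<bar> \<le> 2 * \<delta> * sqrt n} \<le> \<epsilon>"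
  shows "\<bar>(\<integral>w. \<phi> (occupation A n w) \<partial>iid M) - (\<integral>w. \<phi> (grid_npos b m w / m) \<partial>iid M)\<bar>
    \<le> L * (m / n + \<epsilon> + 2 / (\<delta>\<^sup>2 * sqrt m))"
proof -
  have m1: "occupation A n \<in> borel_measurable (iid M)" "(\<lambda>w. grid_npos b m w / m) \<in> borel_measurable (iid M)"
    by measurable
  have int: "integrable (iid M) (\<lambda>w. \<phi> (f w))" if f: "f \<in> borel_measurable (iid M)" for f
  proof (rule P.integrable_const_bound[where B=B])
    show "(\<lambda>w. \<phi> (f w)) \<in> borel_measurable (iid M)" by (rule measurable_compose[OF f \<phi>])
    show "AE w in iid M. norm (\<phi> (f w)) \<le> B" unfolding real_norm_def by (intro AE_I2 B)
  qed
  have int_diff: "integrable (iid M) (\<lambda>w. \<bar>occupation A n w - grid_npos b m w / m\<bar>)"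
  proof (rule P.integrable_const_bound[where B=1])
    have "norm \<bar>occupation A n w - grid_npos b m w / m\<bar> \<le> 1" for w
      using occupation_in_unit[of A n w] grid_npos_in_unit[of b m w]
      unfolding real_norm_def abs_abs atLeastAtMost_iff by (intro abs_leI) linarith+
    then show "AE w in iid M. norm \<bar>occupation A n w - grid_npos b m w / m\<bar> \<le> 1" by (intro AE_I2)
    show "(\<lambda>w. \<bar>occupation A n w - grid_npos b m w / m\<bar>) \<in> borel_measurable (iid M)"
      by (intro borel_measurable_abs borel_measurable_diff m1)
  qed
  have "\<bar>(\<integral>w. \<phi> (occupation A n w) \<partial>iid M) - (\<integral>w. \<phi> (grid_npos b m w / m) \<partial>iid M)\<bar> =
      \<bar>\<integral>w. \<phi> (occupation A n w) - \<phi> (grid_npos b m w / m) \<partial>iid M\<bar>"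
    by (simp only: Bochner_Integration.integral_diff[OF int[OF m1(1)] int[OF m1(2)]])
  also have "\<dots> \<le> (\<integral>w. \<bar>\<phi> (occupation A n w) - \<phi> (grid_npos b m w / m)\<bar> \<partial>iid M)"
    by (rule integral_abs_bound)
  also have "\<dots> \<le> (\<integral>w. L * \<bar>occupation A n w - grid_npos b m w / m\<bar> \<partial>iid M)"
    by (rule integral_mono[OF integrable_abs[OF Bochner_Integration.integrable_diff[OF int[OF m1(1)] int[OF m1(2)]]]
        integrable_mult_right[OF int_diff] L(2)])
  also have "\<dots> = L * (\<integral>w. \<bar>occupation A n w - grid_npos b m w / m\<bar> \<partial>iid M)"
    by (rule integral_mult_right_zero)
  also have "\<dots> \<le> L * (m / n + \<epsilon> + 2 / (\<delta>\<^sup>2 * sqrt m))"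
    by (rule mult_left_mono[OF occupation_grid_L1[OF A AK m b \<delta> small] less_imp_le[OF L(1)]])
  finally show ?thesis .
qed

text \<open>For a given accuracy, \<open>\<delta>\<close> is chosen first, then the number \<open>m\<close> of blocks, and only then \<open>n\<close> tends to
  infinity: the error terms do not vanish for fixed \<open>m\<close>.\<close>
lemma occupation_lipschitz_limit:
  fixes \<phi> :: "real \<Rightarrow> real"
  assumes A[measurable]: "A \<in> sets borel" and AK: "{K<..} \<subseteq> A" "A \<subseteq> {-K..}"
    and cont: "continuous_on UNIV \<phi>" and B: "\<And>x. \<bar>\<phi> x\<bar> \<le> B"
    and L: "L > 0" "\<And>x y. \<bar>\<phi> x - \<phi> y\<bar> \<le> L * \<bar>x - y\<bar>"
  shows "(\<lambda>n. \<integral>w. \<phi> (occupation A n w) \<partial>iid M) \<longlonglongrightarrow> (\<integral>x. \<phi> x \<partial>arcsine_distribution)"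
proof (rule LIMSEQ_I)
  fix e :: real assume e: "0 < e"
  have \<phi>[measurable]: "\<phi> \<in> borel_measurable borel" using cont by (rule borel_measurable_continuous_onI)
  define \<epsilon> where "\<epsilon> = e / (8 * L)"
  have \<epsilon>: "\<epsilon> > 0" using e L by (simp add: \<epsilon>_def)
  obtain \<delta> N where \<delta>: "\<delta> > 0"
    and small: "\<And>n. n \<ge> N \<Longrightarrow> measure (iid M) {w. \<bar>psum w n\<bar> \<le> 2 * \<delta> * sqrt n} \<le> \<epsilon>"
    using small_ball[OF \<epsilon>] by blast
  let ?g = "\<lambda>m. \<integral>w. \<phi> (npos w m / real m) \<partial>iid std_normal_distribution"
  let ?I = "\<integral>x. \<phi> x \<partial>arcsine_distribution"
  have sqrt_lim: "filterlim (\<lambda>b. sqrt (real b)) at_top sequentially"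
    by (rule filterlim_compose[OF sqrt_at_top filterlim_real_sequentially])
  have "(\<lambda>m. 2 / \<delta>\<^sup>2 * inverse (sqrt (real m))) \<longlonglongrightarrow> 0"
    by (rule tendsto_mult_right_zero[OF tendsto_inverse_0_at_top[OF sqrt_lim]])
  moreover have "2 / \<delta>\<^sup>2 * inverse (sqrt (real m)) = 2 / (\<delta>\<^sup>2 * sqrt (real m))" for m
    by (simp add: divide_simps)
  ultimately have "(\<lambda>m. 2 / (\<delta>\<^sup>2 * sqrt (real m))) \<longlonglongrightarrow> 0" by (simp only:)
  from order_tendstoD(2)[OF this \<epsilon>]
  have "eventually (\<lambda>m. 2 / (\<delta>\<^sup>2 * sqrt (real m)) < \<epsilon>) sequentially" .
  moreover have "eventually (\<lambda>m. \<bar>?g m - ?I\<bar> < e / 4) sequentially"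
    using tendstoD[OF normal_walk_arcsine_limit[OF cont], of "e/4"] e unfolding dist_real_def by simp
  ultimately have "eventually (\<lambda>m. 2 / (\<delta>\<^sup>2 * sqrt (real m)) < \<epsilon> \<and> \<bar>?g m - ?I\<bar> < e / 4 \<and> m > 0) sequentially"
    by (intro eventually_conj eventually_gt_at_top)
  then obtain m where m: "2 / (\<delta>\<^sup>2 * sqrt (real m)) < \<epsilon>" "\<bar>?g m - ?I\<bar> < e / 4" "m > 0"
    using eventually_happens'[OF sequentially_bot] by blast
  let ?G = "\<lambda>b. \<integral>w. \<phi> (grid_npos b m w / m) \<partial>iid M"
  have e4: "0 < e / 4" using e by simp
  have "?G \<longlonglongrightarrow> ?g m"
    by (rule grid_npos_limit[of "\<lambda>x. \<phi> (x / real m)" B]) (measurable, rule B)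
  from tendstoD[OF this e4] have G: "eventually (\<lambda>b. \<bar>?G b - ?g m\<bar> < e / 4) sequentially"
    unfolding dist_real_def .
  have "filterlim (\<lambda>b. \<delta> * sqrt (real b)) at_top sequentially"
    by (rule filterlim_tendsto_pos_mult_at_top[OF tendsto_const \<delta> sqrt_lim])
  then have "eventually (\<lambda>b. K < \<delta> * sqrt (real b)) sequentially" by (simp add: filterlim_at_top_dense)
  with G have "eventually (\<lambda>b. \<bar>?G b - ?g m\<bar> < e / 4 \<and> K < \<delta> * sqrt (real b) \<and> N \<le> b \<and> 0 < b) sequentially"
    by (intro eventually_conj eventually_gt_at_top eventually_ge_at_top)
  moreover have "filterlim (\<lambda>n. n div m) at_top sequentially"
    unfolding filterlim_at_top eventually_sequentially
  proof (intro allI exI impI)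
    fix Z n :: nat assume "Z * m \<le> n"
    from div_le_mono[OF this, of m] show "Z \<le> n div m" using m(3) by simp
  qed
  ultimately have "eventually (\<lambda>n. \<bar>?G (n div m) - ?g m\<bar> < e / 4 \<and> K < \<delta> * sqrt (real (n div m)) \<and>
      N \<le> n div m \<and> 0 < n div m) sequentially"
    by (rule eventually_compose_filterlim)
  moreover have "eventually (\<lambda>n. real m / real n < \<epsilon>) sequentially"
    using \<epsilon> by (intro order_tendstoD(2)[OF lim_const_over_n])
  ultimately have "eventually (\<lambda>n. norm ((\<integral>w. \<phi> (occupation A n w) \<partial>iid M) - ?I) < e) sequentially"
  proof eventually_elim
    case (elim n)
    define b where "b = n div m"
    have b: "0 < b" "K < \<delta> * sqrt b" "N \<le> b" using elim(1) unfolding b_def by blast+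
    have "\<bar>(\<integral>w. \<phi> (occupation A n w) \<partial>iid M) - ?G b\<bar> \<le> L * (m / n + \<epsilon> + 2 / (\<delta>\<^sup>2 * sqrt m))"
      by (rule grid_transfer[OF A AK \<phi> B L m(3) b_def b(1) \<delta> b(2) small[OF order_trans[OF b(3)]]])
    also have "\<dots> \<le> L * (3 * \<epsilon>)"
    proof (rule mult_left_mono)
      show "m / n + \<epsilon> + 2 / (\<delta>\<^sup>2 * sqrt m) \<le> 3 * \<epsilon>" using elim(2) m(1) by linarith
    qed (use L(1) in simp)
    also have "\<dots> = 3 / 8 * e" using L(1) by (simp add: \<epsilon>_def)
    finally have "\<bar>(\<integral>w. \<phi> (occupation A n w) \<partial>iid M) - ?G b\<bar> \<le> 3 / 8 * e" .
    moreover have "\<bar>?G b - ?g m\<bar> < e / 4" using elim unfolding b_def by blast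
    ultimately show ?case using m(2) e unfolding real_norm_def by linarith
  qed
  then show "\<exists>N. \<forall>n\<ge>N. norm ((\<integral>w. \<phi> (occupation A n w) \<partial>iid M) - ?I) < e"
    unfolding eventually_sequentially .
qed

text \<open>The set \<open>A\<close> is a half-line up to a bounded window, in which it is arbitrary. This covers the images of end
  intervals under a conjugacy, whose boundary point need not be the image of anything.\<close>
theorem occupation_arcsine_law:
  assumes A[measurable]: "A \<in> sets borel" and AK: "{K<..} \<subseteq> A" "A \<subseteq> {-K..}"
    and \<alpha>: "0 < \<alpha>" "\<alpha> < 1"
  shows "(\<lambda>n. measure (iid M) {w. occupation A n w \<le> \<alpha>}) \<longlonglongrightarrow> 2 / pi * arcsin (sqrt \<alpha>)"
proof -
  let ?\<mu> = "\<lambda>n. distr (iid M) borel (occupation A n)"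
  have occ: "occupation A n \<in> borel_measurable (iid M)" for n by measurable
  have "weak_conv_m ?\<mu> arcsine_distribution"
  proof (rule integral_cts_step_conv_imp_weak_conv)
    show "real_distribution (?\<mu> n)" for n using occ by (rule P.real_distribution_distr)
    show "real_distribution arcsine_distribution" by (rule real_distribution_arcsine)
    fix x y :: real assume xy: "x < y"
    have cont: "continuous_on UNIV (cts_step x y)"
      using cts_step_uniformly_continuous[OF xy] by (rule uniformly_continuous_imp_continuous)
    have "(\<lambda>n. \<integral>w. cts_step x y (occupation A n w) \<partial>iid M) \<longlonglongrightarrow> (\<integral>z. cts_step x y z \<partial>arcsine_distribution)"
    proof (rule occupation_lipschitz_limit[OF A AK cont])
      show "\<bar>cts_step x y z\<bar> \<le> 1" for z using xy by (auto simp: cts_step_def divide_simps)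
      show "1 / (y - x) > 0" using xy by simp
      show "\<bar>cts_step x y s - cts_step x y t\<bar> \<le> 1 / (y - x) * \<bar>s - t\<bar>" for s t
        using xy by (auto simp: cts_step_def divide_simps abs_if split: if_splits)
    qed
    moreover have "integral\<^sup>L (?\<mu> n) (cts_step x y) = (\<integral>w. cts_step x y (occupation A n w) \<partial>iid M)" for n
      using cont by (intro integral_distr[OF occ] borel_measurable_continuous_onI)
    ultimately show "(\<lambda>n. integral\<^sup>L (?\<mu> n) (cts_step x y)) \<longlonglongrightarrow> integral\<^sup>L arcsine_distribution (cts_step x y)"
      by simp
  qed
  then have "(\<lambda>n. cdf (?\<mu> n) \<alpha>) \<longlonglongrightarrow> cdf arcsine_distribution \<alpha>"
    using isCont_cdf_arcsine unfolding weak_conv_m_def weak_conv_def by blast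
  moreover have "cdf (?\<mu> n) \<alpha> = measure (iid M) {w. occupation A n w \<le> \<alpha>}" for n
    unfolding cdf_def by (subst measure_distr[OF occ]) (simp_all add: vimage_def)
  ultimately show ?thesis using cdf_arcsine_distribution[OF \<alpha>] by simp
qed

end

section \<open>Fibre orbits over the Bernoulli shift\<close>

lemma prob_space_bernoulli: "prob_space (bernoulli p)"
  unfolding bernoulli_def by (rule prob_space_PiM) (rule measure_pmf.prob_space_axioms)

lemma space_bernoulli[simp]: "space (bernoulli p) = UNIV"
  by (simp add: bernoulli_def space_PiM)

lemma fiber_cong: "(\<And>i. i < n \<Longrightarrow> \<omega> i = \<omega>' i) \<Longrightarrow> fiber f n \<omega> x = fiber f n \<omega>' x"
  by (induction n) simp_all

lemma measurable_letter:
  fixes p :: "'a::countable pmf"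
  shows "(\<lambda>\<omega>. \<omega> i) \<in> bernoulli p \<rightarrow>\<^sub>M count_space UNIV"
proof -
  have "(\<lambda>\<omega>. \<omega> i) \<in> bernoulli p \<rightarrow>\<^sub>M measure_pmf p"
    unfolding bernoulli_def by (rule measurable_component_singleton) simp
  then show ?thesis by (simp only: measurable_cong_sets[OF refl sets_measure_pmf_count_space])
qed

text \<open>Words of fixed length form a countable set, so that everything determined by a finite prefix is measurable,
  whatever the fibre maps are.\<close>
lemma measurable_prefix:
  fixes p :: "'a::countable pmf"
  shows "(\<lambda>\<omega>. map \<omega> [0..<n]) \<in> bernoulli p \<rightarrow>\<^sub>M count_space UNIV"
  unfolding measurable_count_space_eq2_countable
proof (intro conjI ballI)
  fix xs :: "'a list"
  have "{\<omega> \<in> space (bernoulli p). \<omega> i = a} \<in> sets (bernoulli p)" for i a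
    using measurable_sets[OF measurable_letter, of "{a}" i p] by (simp add: vimage_def)
  then have "{\<omega> \<in> space (bernoulli p). \<forall>i\<in>{..<n}. \<omega> i = xs ! i} \<in> sets (bernoulli p)"
    by (intro sets.sets_Collect_finite_All) auto
  moreover have "(\<lambda>\<omega>. map \<omega> [0..<n]) -` {xs} \<inter> space (bernoulli p) =
      (if length xs = n then {\<omega> \<in> space (bernoulli p). \<forall>i\<in>{..<n}. \<omega> i = xs ! i} else {})"
  proof -
    have "map \<omega> [0..<n] = xs \<longleftrightarrow> length xs = n \<and> (\<forall>i\<in>{..<n}. \<omega> i = xs ! i)" for \<omega>
      unfolding list_eq_iff_nth_eq by (simp add: Ball_def) blast
    then show ?thesis by (simp add: vimage_def)
  qed
  ultimately show "(\<lambda>\<omega>. map \<omega> [0..<n]) -` {xs} \<inter> space (bernoulli p) \<in> sets (bernoulli p)"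
    by simp
qed simp

lemma measurable_fiber:
  fixes p :: "'a::countable pmf"
  shows "(\<lambda>\<omega>. fiber f n \<omega> x) \<in> bernoulli p \<rightarrow>\<^sub>M count_space UNIV"
proof -
  have "(\<lambda>\<omega>. fiber f n (\<lambda>i. map \<omega> [0..<n] ! i) x) \<in> bernoulli p \<rightarrow>\<^sub>M count_space UNIV"
    by (rule measurable_compose[OF measurable_prefix]) simp
  moreover have "fiber f n (\<lambda>i. map \<omega> [0..<n] ! i) x = fiber f n \<omega> x" for \<omega>
    by (rule fiber_cong) simp
  ultimately show ?thesis by simp
qed

lemma measurable_fiber_borel:
  fixes p :: "'a::countable pmf" and g :: "real \<Rightarrow> real"
  shows "(\<lambda>\<omega>. g (fiber f n \<omega> x)) \<in> borel_measurable (bernoulli p)"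
  by (rule measurable_compose[OF measurable_fiber, where g=g]) simp

lemma countable_orbit:
  fixes f :: "'a::countable \<Rightarrow> real \<Rightarrow> real"
  shows "countable (orbit f x)"
proof (rule countable_subset)
  show "orbit f x \<subseteq> range (\<lambda>xs. fiber f (length xs) (\<lambda>i. xs ! i) x)"
  proof
    fix y assume "y \<in> orbit f x"
    then obtain n \<omega> where y: "y = fiber f n \<omega> x" unfolding orbit_def by blast
    have "y = fiber f (length (map \<omega> [0..<n])) (\<lambda>i. map \<omega> [0..<n] ! i) x"
      unfolding y by (simp, rule fiber_cong) simp
    then show "y \<in> range (\<lambda>xs. fiber f (length xs) (\<lambda>i. xs ! i) x)" by blast
  qed
qed simp

lemma fiber_in_orbit: "fiber f n \<omega> x \<in> orbit f x"
  unfolding orbit_def by blast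

lemma self_in_orbit: "x \<in> orbit f x"
  using fiber_in_orbit[of f 0 _ x] by simp

lemma step_in_orbit:
  assumes "y \<in> orbit f x" shows "f a y \<in> orbit f x"
proof -
  obtain n \<omega> where y: "y = fiber f n \<omega> x" using assms unfolding orbit_def by blast
  have "fiber f n (fun_upd \<omega> n a) x = fiber f n \<omega> x" by (rule fiber_cong) simp
  then have "f a y = fiber f (Suc n) (fun_upd \<omega> n a) x" by (simp add: y)
  then show ?thesis by (simp only: fiber_in_orbit)
qed

section \<open>Fibre orbits coded by a random walk\<close>

text \<open>The conjugacy enters only through an injective code \<open>H\<close> with centred steps of variance one; its
  monotonicity is added where order matters.\<close>
locale coded_walk =
  fixes p :: "'a::countable pmf" and f :: "'a \<Rightarrow> real \<Rightarrow> real" and x :: real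
    and H :: "real \<Rightarrow> real" and \<nu> :: "real measure"
  assumes full: "\<And>a. pmf p a > 0"
    and unit: "unit_walk \<nu>"
    and law: "distr (bernoulli p) (iid borel) (\<lambda>\<omega> i. rw_step f H x i \<omega>) = iid \<nu>"
    and inj: "inj_on H (orbit f x)"
begin

sublocale U: unit_walk \<nu> by (rule unit)
sublocale B: prob_space "bernoulli p" by (rule prob_space_bernoulli)

abbreviation steps :: "(nat \<Rightarrow> 'a) \<Rightarrow> nat \<Rightarrow> real"
  where "steps \<omega> \<equiv> (\<lambda>i. rw_step f H x i \<omega>)"

lemma measurable_steps: "steps \<in> bernoulli p \<rightarrow>\<^sub>M iid borel"
  by (rule measurable_iid) (simp only: rw_step_def borel_measurable_diff measurable_fiber_borel)

lemma psum_steps: "psum (steps \<omega>) n = H (fiber f n \<omega> x) - H x"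
  by (induction n) (simp_all add: psum_Suc rw_step_def)

lemma measure_steps:
  assumes "C \<in> sets (iid borel)"
  shows "B.prob {\<omega>. steps \<omega> \<in> C} = measure (iid \<nu>) C"
proof -
  have "measure (iid \<nu>) C = B.prob (steps -` C \<inter> space (bernoulli p))"
    unfolding law[symmetric] by (rule measure_distr[OF measurable_steps assms])
  then show ?thesis by (simp add: vimage_def)
qed

lemma code_in_image:
  assumes y: "y \<in> orbit f x"
  shows "H y - H x \<in> (\<lambda>y. H y - H x) ` (orbit f x \<inter> B) \<longleftrightarrow> y \<in> B"
proof
  assume "H y - H x \<in> (\<lambda>y. H y - H x) ` (orbit f x \<inter> B)"
  then obtain z where z: "z \<in> orbit f x" "z \<in> B" "H y - H x = H z - H x" by blast
  then have "H y = H z" by simp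
  then have "y = z" by (rule inj_onD[OF inj _ y z(1)])
  then show "y \<in> B" using z(2) by simp
qed (use y in blast)

text \<open>The invariance demanded of the \<open>n\<close>-th set in the Hewitt-Savage law.\<close>
definition prefix_symmetric :: "nat \<Rightarrow> (nat \<Rightarrow> real) set \<Rightarrow> bool"
  where "prefix_symmetric n C \<longleftrightarrow> (\<forall>\<pi> \<omega>. inj \<pi> \<longrightarrow> (\<forall>i<n. \<pi> i < n) \<longrightarrow> (\<forall>i\<ge>n. \<pi> i = i) \<longrightarrow>
    ((\<lambda>i. \<omega> (\<pi> i)) \<in> C \<longleftrightarrow> \<omega> \<in> C))"

lemma psum_perm:
  assumes "inj \<pi>" "\<forall>i<n. \<pi> i < n" "\<forall>i\<ge>n. \<pi> i = i" "n \<le> k"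
  shows "psum (\<lambda>i. \<omega> (\<pi> i)) k = psum \<omega> k"
proof -
  have into: "\<pi> ` {..<k} \<subseteq> {..<k}"
  proof
    fix j assume "j \<in> \<pi> ` {..<k}"
    then obtain i where "i < k" "j = \<pi> i" by blast
    then show "j \<in> {..<k}" using assms by (cases "i < n") auto
  qed
  have inj': "inj_on \<pi> {..<k}" using assms(1) by (rule inj_on_subset) simp
  then have "\<pi> ` {..<k} = {..<k}" using into by (intro endo_inj_surj) auto
  then have "bij_betw \<pi> {..<k} {..<k}" using inj' by (simp add: bij_betw_def)
  then show ?thesis unfolding psum_def by (rule sum.reindex_bij_betw)
qed

text \<open>From time \<open>n\<close> on, partial sums are symmetric functions of the first \<open>n\<close> steps, and the code recovers the
  position from the partial sum.\<close>
lemma tail_event_prefix_symmetric: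
  assumes "A \<in> tail_sigma (bernoulli p) (\<lambda>n \<omega>. fiber f n \<omega> x)"
  shows "\<exists>C\<in>sets (iid borel). prefix_symmetric n C \<and> A = {\<omega>. steps \<omega> \<in> C}"
proof -
  let ?G = "\<lambda>k. {(\<lambda>\<omega>. fiber f (Suc k) \<omega> x) -` B \<inter> space (bernoulli p) | B. B \<in> sets borel}"
  have "A \<in> sigma_sets (space (bernoulli p)) (\<Union> (?G ` {n..}))"
    using assms unfolding tail_sigma_def B.tail_events_def by blast
  then show ?thesis
  proof induction
    case (Basic A)
    then obtain k B where k: "n \<le> k" and B: "A = (\<lambda>\<omega>. fiber f (Suc k) \<omega> x) -` B \<inter> space (bernoulli p)"
      by auto
    define D where "D = (\<lambda>y. H y - H x) ` (orbit f x \<inter> B)"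
    have "countable D" unfolding D_def using countable_orbit by (intro countable_image countable_Int1)
    then have D: "D \<in> sets borel" by (rule sets.countable[rotated]) simp
    let ?C = "(\<lambda>\<omega>. psum \<omega> (Suc k)) -` D \<inter> space (iid borel)"
    have "?C \<in> sets (iid borel)" by (rule measurable_sets[OF measurable_psum D])
    moreover have "prefix_symmetric n ?C"
      unfolding prefix_symmetric_def using psum_perm[of _ n "Suc k"] k by (auto simp: space_PiM)
    moreover have "A = {\<omega>. steps \<omega> \<in> ?C}"
    proof -
      have "psum (steps \<omega>) (Suc k) \<in> D \<longleftrightarrow> fiber f (Suc k) \<omega> x \<in> B" for \<omega>
        unfolding psum_steps D_def by (rule code_in_image[OF fiber_in_orbit])
      then show ?thesis unfolding B by (auto simp: space_PiM)
    qed
    ultimately show ?case by blast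
  next
    case Empty
    show ?case by (rule bexI[of _ "{}"]) (auto simp: prefix_symmetric_def)
  next
    case (Compl A)
    then obtain C where C: "C \<in> sets (iid borel)" "prefix_symmetric n C" "A = {\<omega>. steps \<omega> \<in> C}" by blast
    have "space (iid borel) - C \<in> sets (iid borel)" using C(1) by blast
    moreover have "prefix_symmetric n (space (iid borel) - C)"
      using C(2) unfolding prefix_symmetric_def by (simp add: space_PiM)
    moreover have "space (bernoulli p) - A = {\<omega>. steps \<omega> \<in> space (iid borel) - C}"
      using C(3) by (auto simp: space_PiM)
    ultimately show ?case by blast
  next
    case (Union a)
    then have "\<forall>i. \<exists>C. C \<in> sets (iid borel) \<and> prefix_symmetric n C \<and> a i = {\<omega>. steps \<omega> \<in> C}" by blast
    then obtain C where C: "\<And>i. C i \<in> sets (iid borel)" "\<And>i. prefix_symmetric n (C i)" "\<And>i. a i = {\<omega>. steps \<omega> \<in> C i}"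
      by metis
    have "(\<Union>i. C i) \<in> sets (iid borel)" using C(1) by blast
    moreover have "prefix_symmetric n (\<Union>i. C i)"
      using C(2) unfolding prefix_symmetric_def by (simp only: UN_iff) metis
    moreover have "(\<Union>i. a i) = {\<omega>. steps \<omega> \<in> (\<Union>i. C i)}" using C(3) by auto
    ultimately show ?case by blast
  qed
qed

theorem tail_trivial:
  assumes A: "A \<in> tail_sigma (bernoulli p) (\<lambda>n \<omega>. fiber f n \<omega> x)"
  shows "B.prob A = 0 \<or> B.prob A = 1"
proof -
  have "\<forall>n. \<exists>C. C \<in> sets (iid borel) \<and> prefix_symmetric n C \<and> A = {\<omega>. steps \<omega> \<in> C}"
    using tail_event_prefix_symmetric[OF A] by blast
  then obtain C where C: "\<And>n. C n \<in> sets (iid borel)" "\<And>n. prefix_symmetric n (C n)" "\<And>n. A = {\<omega>. steps \<omega> \<in> C n}"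
    by metis
  have "measure (iid \<nu>) (C 0) = 0 \<or> measure (iid \<nu>) (C 0) = 1"
  proof (rule hewitt_savage[OF U.prob_space_axioms])
    show "C n \<in> sets (iid \<nu>)" for n using C(1) U.sets_iid by simp
    show "(\<lambda>i. \<omega> (\<pi> i)) \<in> C n \<longleftrightarrow> \<omega> \<in> C n"
      if "inj \<pi>" "\<And>i. i < n \<Longrightarrow> \<pi> i < n" "\<And>i. i \<ge> n \<Longrightarrow> \<pi> i = i" for n \<pi> \<omega>
      using C(2)[of n] that unfolding prefix_symmetric_def by blast
    fix n
    have "AE \<omega> in bernoulli p. steps \<omega> \<in> C n \<longleftrightarrow> steps \<omega> \<in> C 0"
      using C(3)[of n] C(3)[of 0] by (intro AE_I2) blast
    moreover have "{\<omega> \<in> space (iid borel). \<omega> \<in> C n \<longleftrightarrow> \<omega> \<in> C 0} \<in> sets (iid borel)"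
    proof -
      have "{\<omega> \<in> space (iid borel). \<omega> \<in> C n \<longleftrightarrow> \<omega> \<in> C 0} =
          (C n \<inter> C 0) \<union> (space (iid borel) - (C n \<union> C 0))"
        by (auto simp: space_PiM)
      also have "\<dots> \<in> sets (iid borel)"
        by (intro sets.Un sets.Int sets.compl_sets C(1))
      finally show ?thesis .
    qed
    ultimately show "AE \<omega> in iid \<nu>. \<omega> \<in> C n \<longleftrightarrow> \<omega> \<in> C 0"
      unfolding law[symmetric] by (simp only: AE_distr_iff[OF measurable_steps])
  qed
  then show ?thesis using measure_steps[OF C(1)[of 0]] C(3)[of 0] by simp
qed

text \<open>The assumptions say that the code maps \<open>S\<close> to an upper half-line, except for codes within \<open>K\<close> of that of \<open>x\<close>.\<close>
theorem fiber_occupation_limit: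
  assumes K: "\<And>y. y \<in> orbit f x \<Longrightarrow> H y - H x > K \<Longrightarrow> y \<in> S"
    "\<And>y. y \<in> orbit f x \<Longrightarrow> y \<in> S \<Longrightarrow> - K \<le> H y - H x" and K0: "0 \<le> K"
    and \<alpha>: "0 < \<alpha>" "\<alpha> < 1"
  shows "(\<lambda>n. B.prob {\<omega>. fiber_average f (indicator S) x n \<omega> \<le> \<alpha>}) \<longlonglongrightarrow> 2 / pi * arcsin (sqrt \<alpha>)"
proof -
  \<comment> \<open>The second part matters only inside the window; it is countable, hence Borel.\<close>
  define A where "A = {K<..} \<union> (\<lambda>y. H y - H x) ` (orbit f x \<inter> S)"
  have "countable ((\<lambda>y. H y - H x) ` (orbit f x \<inter> S))"
    using countable_orbit by (intro countable_image countable_Int1)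
  then have "(\<lambda>y. H y - H x) ` (orbit f x \<inter> S) \<in> sets borel" by (rule sets.countable[rotated]) simp
  then have A: "A \<in> sets borel" unfolding A_def by (intro sets.Un) simp_all
  have AK: "{K<..} \<subseteq> A" "A \<subseteq> {-K..}"
    using K(2) K0 unfolding A_def by auto
  have ind: "indicator S y = (indicator A (H y - H x) :: real)" if y: "y \<in> orbit f x" for y
  proof -
    have "y \<in> S \<longleftrightarrow> H y - H x \<in> A"
      using K(1)[OF y] code_in_image[OF y, of S] unfolding A_def by blast
    then show ?thesis by (simp add: indicator_def)
  qed
  have avg: "fiber_average f (indicator S) x n \<omega> = occupation A n (steps \<omega>)" for n \<omega>
    unfolding fiber_average_def occupation_def psum_steps
    by (intro arg_cong2[where f="(/)"] sum.cong refl ind fiber_in_orbit)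
  have "B.prob {\<omega>. fiber_average f (indicator S) x n \<omega> \<le> \<alpha>} =
      measure (iid \<nu>) {\<omega>. occupation A n \<omega> \<le> \<alpha>}" for n
  proof -
    have "(\<lambda>\<omega>. occupation A n \<omega>) \<in> borel_measurable (iid borel)" by (rule occupation_measurable[OF A])
    from borel_measurable_le[OF this borel_measurable_const, of \<alpha>]
    have "{\<omega>. occupation A n \<omega> \<le> \<alpha>} \<in> sets (iid borel)" by (simp add: space_PiM)
    from measure_steps[OF this] show ?thesis by (simp add: avg)
  qed
  then show ?thesis using U.occupation_arcsine_law[OF A AK \<alpha>] by simp
qed

text \<open>If the code were bounded above by \<open>K\<close>, the half-line above \<open>K\<close> would never be visited, so its
  occupation frequency would be at most 1/4 with probability 1; the arcsine law gives 1/3.\<close>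
lemma H_unbounded: "\<exists>y\<in>orbit f x. H y > K"
proof (rule ccontr)
  assume "\<not> ?thesis"
  then have le: "\<And>y. y \<in> orbit f x \<Longrightarrow> H y - H x \<le> \<bar>K\<bar> + \<bar>H x\<bar>"
    by (smt (verit))
  have "(\<lambda>n. B.prob {\<omega>. fiber_average f (indicator {}) x n \<omega> \<le> 1 / 4}) \<longlonglongrightarrow> 2 / pi * arcsin (sqrt (1 / 4))"
    by (rule fiber_occupation_limit[where K="\<bar>K\<bar> + \<bar>H x\<bar>"]) (use le in \<open>auto simp: not_less[symmetric]\<close>)
  moreover have "fiber_average f (indicator {}) x n \<omega> \<le> 1 / 4" for n \<omega>
    by (simp add: fiber_average_def)
  then have "B.prob {\<omega>. fiber_average f (indicator {}) x n \<omega> \<le> 1 / 4} = 1" for n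
    using B.prob_space by simp
  ultimately have "(\<lambda>n::nat. 1) \<longlonglongrightarrow> 2 / pi * arcsin (1 / 2)" by (simp add: real_sqrt_divide)
  then have "2 / pi * arcsin (1 / 2) = 1" by (simp add: LIMSEQ_const_iff)
  moreover have "arcsin (1/2) = pi / 6" 
    by (intro arcsin_unique) (auto simp: sin_30)
  ultimately show False by simp
qed

lemma measure_prefix: "B.prob {\<omega>. \<forall>i<n. \<omega> i = \<omega>\<^sub>0 i} = (\<Prod>i<n. pmf p (\<omega>\<^sub>0 i))"
proof -
  interpret S: sequence_space "measure_pmf p" by (rule sequence_space_iid) (rule measure_pmf.prob_space_axioms)
  have "\<omega> \<in> prod_emb UNIV (\<lambda>_. measure_pmf p) {..<n} (\<Pi>\<^sub>E i\<in>{..<n}. {\<omega>\<^sub>0 i}) \<longleftrightarrow> (\<forall>i<n. \<omega> i = \<omega>\<^sub>0 i)" for \<omega>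
    unfolding prod_emb_def by (simp add: PiE_iff Ball_def)
  then have "B.prob {\<omega>. \<forall>i<n. \<omega> i = \<omega>\<^sub>0 i} =
      measure (iid (measure_pmf p)) (prod_emb UNIV (\<lambda>_. measure_pmf p) {..<n} (\<Pi>\<^sub>E i\<in>{..<n}. {\<omega>\<^sub>0 i}))"
    unfolding bernoulli_def by (intro arg_cong2[where f=measure] refl set_eqI) (simp only: mem_Collect_eq)
  also have "\<dots> = (\<Prod>i<n. measure (measure_pmf p) {\<omega>\<^sub>0 i})"
    by (rule S.measure_PiM_emb) simp_all
  also have "\<dots> = (\<Prod>i<n. pmf p (\<omega>\<^sub>0 i))" by (simp only: pmf.rep_eq)
  finally show ?thesis .
qed

lemma measure_prefix_pos: "B.prob {\<omega>. \<forall>i<n. \<omega> i = \<omega>\<^sub>0 i} > 0"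
  unfolding measure_prefix by (intro prod_pos ballI full)

text \<open>Independence makes the law of a step the same at each orbit point, and from each orbit point the letter \<open>b\<close>
  is used with probability \<open>pmf p b > 0\<close>. So the displacement by \<open>b\<close> cannot be so large that
  Chebyshev's inequality gives it a smaller probability.\<close>
lemma step_bounded:
  "\<exists>D. \<forall>y\<in>orbit f x. \<bar>H (f b y) - H y\<bar> < D"
proof -
  \<comment> \<open>With this choice Chebyshev's bound is half the probability of \<open>b\<close>.\<close>
  define D where "D = sqrt (2 / pmf p b)"
  have D: "D > 0" "1 / D\<^sup>2 < pmf p b"
    using full[of b] by (simp_all add: D_def)
  have "\<bar>H (f b y) - H y\<bar> < D" if y_orb: "y \<in> orbit f x" for y
  proof (rule ccontr)
    assume big: "\<not> \<bar>H (f b y) - H y\<bar> < D"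
    obtain n \<omega>\<^sub>0 where y: "y = fiber f n \<omega>\<^sub>0 x" using y_orb unfolding orbit_def by blast
    let ?A = "{\<omega>. fiber f n \<omega> x = y}"
    have A: "?A \<in> sets (bernoulli p)"
      using measurable_sets[OF measurable_fiber, of "{y}" f n x p] by (simp add: vimage_def)
    have "{\<omega>. \<forall>i<n. \<omega> i = \<omega>\<^sub>0 i} \<subseteq> ?A" using fiber_cong unfolding y by blast
    then have A0: "B.prob ?A > 0"
      using measure_prefix_pos[of n \<omega>\<^sub>0] B.finite_measure_mono[OF _ A] by (meson less_le_trans)
    have comp: "{\<omega>. \<omega> 0 = b} \<in> sets (iid (measure_pmf p))"
      using measurable_sets[OF measurable_letter, of "{b}" 0 p] by (simp add: vimage_def bernoulli_def space_PiM)
    have b: "B.prob {\<omega> \<in> ?A. \<omega> n = b} = B.prob ?A * pmf p b"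
    proof -
      have "measure (iid (measure_pmf p)) {\<omega> \<in> ?A. (\<lambda>i. \<omega> (n + i)) \<in> {\<omega>. \<omega> 0 = b}} =
          measure (iid (measure_pmf p)) ?A * measure (iid (measure_pmf p)) {\<omega>. \<omega> 0 = b}"
      proof (rule measure_iid_append[OF measure_pmf.prob_space_axioms _ comp])
        show "?A \<in> sets (iid (measure_pmf p))" using A by (simp add: bernoulli_def)
        show "\<omega>' \<in> ?A" if "\<omega> \<in> ?A" "\<And>i. i < n \<Longrightarrow> \<omega> i = \<omega>' i" for \<omega> \<omega>'
          using that fiber_cong[of n \<omega> \<omega>'] by auto
      qed
      moreover have "measure (iid (measure_pmf p)) {\<omega>. \<omega> 0 = b} = pmf p b"
        using measure_prefix[of 1 "\<lambda>_. b"] by (simp add: bernoulli_def)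
      ultimately show ?thesis by (simp add: bernoulli_def)
    qed
    let ?C = "{\<omega>. psum \<omega> n = H y - H x}" and ?E = "{\<omega>. D \<le> \<bar>psum \<omega> 1\<bar>}"
    have C: "?C \<in> sets (iid borel)"
      using measurable_sets[OF measurable_psum, of "{H y - H x}" n] by (simp add: vimage_def space_PiM)
    have E: "?E \<in> sets (iid borel)"
      using borel_measurable_le[OF borel_measurable_const borel_measurable_abs[OF measurable_psum], of D 1]
      by (simp add: space_PiM)
    have AC: "\<omega> \<in> ?A \<longleftrightarrow> steps \<omega> \<in> ?C" for \<omega>
      using inj_onD[OF inj _ fiber_in_orbit y_orb] by (auto simp: psum_steps)
    have sh: "psum (\<lambda>i. \<omega> (n + i)) 1 = \<omega> n" for \<omega> by (simp add: psum_def)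
    have CE: "{\<omega> \<in> ?C. (\<lambda>i. \<omega> (n + i)) \<in> ?E} = {\<omega>. psum \<omega> n = H y - H x \<and> D \<le> \<bar>\<omega> n\<bar>}"
      by (simp only: mem_Collect_eq sh)
    have CEm: "{\<omega>. psum \<omega> n = H y - H x \<and> D \<le> \<bar>\<omega> n\<bar>} \<in> sets (iid borel)"
    proof -
      have "{\<omega> \<in> space (iid borel). D \<le> \<bar>\<omega> n\<bar>} \<in> sets (iid borel)" by measurable
      then have "?C \<inter> {\<omega> \<in> space (iid borel). D \<le> \<bar>\<omega> n\<bar>} \<in> sets (iid borel)" using C by blast
      then show ?thesis by (simp add: Int_def space_PiM)
    qed
    have "B.prob {\<omega> \<in> ?A. \<omega> n = b} \<le> B.prob {\<omega>. steps \<omega> \<in> {\<omega>. psum \<omega> n = H y - H x \<and> D \<le> \<bar>\<omega> n\<bar>}}"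
    proof (rule B.finite_measure_mono)
      show "{\<omega> \<in> ?A. \<omega> n = b} \<subseteq> {\<omega>. steps \<omega> \<in> {\<omega>. psum \<omega> n = H y - H x \<and> D \<le> \<bar>\<omega> n\<bar>}}"
      proof
        fix \<omega> assume "\<omega> \<in> {\<omega> \<in> ?A. \<omega> n = b}"
        then have \<omega>: "fiber f n \<omega> x = y" "\<omega> n = b" by simp_all
        have "psum (steps \<omega>) n = H y - H x" unfolding psum_steps \<omega> ..
        moreover have "D \<le> \<bar>steps \<omega> n\<bar>"
          using big by (simp add: rw_step_def \<omega> not_less)
        ultimately show "\<omega> \<in> {\<omega>. steps \<omega> \<in> {\<omega>. psum \<omega> n = H y - H x \<and> D \<le> \<bar>\<omega> n\<bar>}}"
          by blast
      qed
      show "{\<omega>. steps \<omega> \<in> {\<omega>. psum \<omega> n = H y - H x \<and> D \<le> \<bar>\<omega> n\<bar>}} \<in> sets (bernoulli p)"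
        using measurable_sets[OF measurable_steps CEm] by (simp add: vimage_def)
    qed
    also have "\<dots> = measure (iid \<nu>) {\<omega>. psum \<omega> n = H y - H x \<and> D \<le> \<bar>\<omega> n\<bar>}"
      by (rule measure_steps[OF CEm])
    also have "\<dots> = measure (iid \<nu>) ?C * measure (iid \<nu>) ?E"
      unfolding CE[symmetric]
    proof (rule measure_iid_append[OF U.prob_space_axioms])
      show "?C \<in> sets (iid \<nu>)" "?E \<in> sets (iid \<nu>)" using C E by (simp_all only: U.sets_iid)
      show "\<omega>' \<in> ?C" if "\<omega> \<in> ?C" "\<And>i. i < n \<Longrightarrow> \<omega> i = \<omega>' i" for \<omega> \<omega>'
        using that psum_cong[of n \<omega> \<omega>'] by simp
    qed
    also have "measure (iid \<nu>) ?C = B.prob ?A"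
      using measure_steps[OF C] AC by simp
    also have "measure (iid \<nu>) ?E \<le> 1 / D\<^sup>2"
      using U.prob_psum_ge[OF D(1), of 1] by simp
    finally have "B.prob ?A * pmf p b \<le> B.prob ?A * (1 / D\<^sup>2)"
      unfolding b by (simp add: mult_left_mono)
    then have "pmf p b \<le> 1 / D\<^sup>2"
      by (simp only: mult_le_cancel_left_pos[OF A0])
    then show False using D(2) by linarith
  qed
  then show ?thesis by blast
qed

text \<open>Used to exclude that a single fibre map sends the whole orbit to one side of an orbit point.\<close>
lemma no_bounded_step: "\<exists>y\<in>orbit f x. H (f b y) > K"
proof -
  obtain D where D: "\<forall>y\<in>orbit f x. \<bar>H (f b y) - H y\<bar> < D" using step_bounded by blast
  obtain y where y: "y \<in> orbit f x" "H y > K + D" using H_unbounded by blast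
  have "\<bar>H (f b y) - H y\<bar> < D" using D y(1) by blast
  then have "H (f b y) > K" using y(2) by (simp add: abs_less_iff)
  then show ?thesis using y(1) by blast
qed

end

lemma coded_walk_scale:
  fixes p :: "'a::countable pmf" and f :: "'a \<Rightarrow> real \<Rightarrow> real" and h :: "real \<Rightarrow> real"
  assumes full: "\<And>a. pmf p a > 0" and inj: "inj_on h (orbit f x)"
    and indep: "prob_space.indep_vars (bernoulli p) (\<lambda>_. borel) (rw_step f h x) UNIV"
    and ident: "\<And>n. distr (bernoulli p) borel (rw_step f h x n) = distr (bernoulli p) borel (rw_step f h x 0)"
    and sq: "integrable (bernoulli p) (\<lambda>\<omega>. (rw_step f h x 0 \<omega>)\<^sup>2)"
    and mean: "(\<integral>\<omega>. rw_step f h x 0 \<omega> \<partial>bernoulli p) = 0"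
    and c: "c\<^sup>2 * (\<integral>\<omega>. (rw_step f h x 0 \<omega>)\<^sup>2 \<partial>bernoulli p) = 1"
  shows "coded_walk p f x (\<lambda>y. c * h y) (distr (bernoulli p) borel (rw_step f (\<lambda>y. c * h y) x 0))"
proof -
  interpret B: prob_space "bernoulli p" by (rule prob_space_bernoulli)
  have scale: "rw_step f (\<lambda>y. c * h y) x n = (\<lambda>\<omega>. c * rw_step f h x n \<omega>)" for n
    by (intro ext) (simp add: rw_step_def right_diff_distrib)
  have rv: "rw_step f h x n \<in> borel_measurable (bernoulli p)" for n
    unfolding rw_step_def by (intro borel_measurable_diff measurable_fiber_borel)
  have rvc: "rw_step f (\<lambda>y. c * h y) x n \<in> borel_measurable (bernoulli p)" for n
    unfolding rw_step_def by (intro borel_measurable_diff measurable_fiber_borel)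
  have c0: "c \<noteq> 0" using c by auto
  let ?Y = "rw_step f (\<lambda>y. c * h y) x 0"
  let ?\<nu> = "distr (bernoulli p) borel ?Y"
  show ?thesis
  proof (rule coded_walk.intro)
    show "pmf p a > 0" for a by (rule full)
    have "B.indep_vars (\<lambda>_. borel) (\<lambda>n \<omega>. c * rw_step f h x n \<omega>) UNIV"
      by (rule B.indep_vars_compose2[OF indep, where Y="\<lambda>_ y. c * y"]) simp
    moreover have "distr (bernoulli p) borel (\<lambda>\<omega>. c * rw_step f h x n \<omega>) =
        distr (distr (bernoulli p) borel (rw_step f h x n)) borel (\<lambda>y. c * y)" for n
      by (subst distr_distr[OF _ rv]) (simp_all add: comp_def)
    then have "distr (bernoulli p) borel (\<lambda>\<omega>. c * rw_step f h x n \<omega>) =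
        distr (bernoulli p) borel (\<lambda>\<omega>. c * rw_step f h x 0 \<omega>)" for n
      by (simp only: ident[of n])
    ultimately show "distr (bernoulli p) (iid borel) (\<lambda>\<omega> i. rw_step f (\<lambda>y. c * h y) x i \<omega>) =
        iid ?\<nu>"
      unfolding scale by (rule B.distr_indep_identical_eq_iid)
    show "inj_on (\<lambda>y. c * h y) (orbit f x)"
      using inj c0 by (simp add: inj_on_def)
    show "unit_walk ?\<nu>"
    proof (intro unit_walk.intro unit_walk_axioms.intro)
      show "real_distribution ?\<nu>"
        by (rule B.real_distribution_distr[OF rvc])
      have "(\<integral>y. y \<partial>?\<nu>) =
          (\<integral>\<omega>. ?Y \<omega> \<partial>bernoulli p)"
        by (rule integral_distr[OF rvc]) simp
      also have "\<dots> = 0" unfolding scale by (simp add: mean)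
      finally show "(\<integral>y. y \<partial>?\<nu>) = 0" .
      have "integrable (bernoulli p) (\<lambda>\<omega>. (?Y \<omega>)\<^sup>2)"
        unfolding scale power_mult_distrib by (rule integrable_mult_right[OF sq])
      then show "integrable ?\<nu> (\<lambda>y. y\<^sup>2)"
        by (subst integrable_distr_eq[OF rvc]) simp_all
      have "(\<integral>y. y\<^sup>2 \<partial>?\<nu>) =
          (\<integral>\<omega>. (?Y \<omega>)\<^sup>2 \<partial>bernoulli p)"
        by (rule integral_distr[OF rvc]) simp
      also have "\<dots> = 1" unfolding scale power_mult_distrib integral_mult_right_zero by (rule c)
      finally show "(\<integral>y. y\<^sup>2 \<partial>?\<nu>) = 1" .
    qed
  qed
qed

lemma strictly_monotone_imp_inj_on:
  fixes h :: "real \<Rightarrow> real"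
  assumes "strict_mono_on A h \<or> strict_antimono_on A h"
  shows "inj_on h A"
proof (rule inj_onI)
  fix u v assume uv: "u \<in> A" "v \<in> A" "h u = h v"
  show "u = v"
  proof (rule ccontr)
    assume "u \<noteq> v"
    then have "u < v \<or> v < u" by linarith
    then show False using assms uv by (auto dest: monotone_onD)
  qed
qed

text \<open>Both orientations are available because the steps may be multiplied by either square root of the inverse
  variance. An end interval at 0 needs the decreasing code, one at 1 the increasing code.\<close>
lemma conjugacy_coded_walk:
  fixes p :: "'a::countable pmf"
  assumes full: "\<And>a. pmf p a > 0" and conj: "conjugate_to_centered_random_walk p f x"
  shows "\<exists>H \<nu>. coded_walk p f x H \<nu> \<and> strict_mono_on (orbit f x) H"
    and "\<exists>H \<nu>. coded_walk p f x H \<nu> \<and> strict_antimono_on (orbit f x) H"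
proof -
  interpret B: prob_space "bernoulli p" by (rule prob_space_bernoulli)
  obtain h where mono: "strict_mono_on (orbit f x) h \<or> strict_antimono_on (orbit f x) h"
    and indep: "B.indep_vars (\<lambda>_. borel) (rw_step f h x) UNIV"
    and ident: "\<And>n. distr (bernoulli p) borel (rw_step f h x n) = distr (bernoulli p) borel (rw_step f h x 0)"
    and sq: "integrable (bernoulli p) (\<lambda>\<omega>. (rw_step f h x 0 \<omega>)\<^sup>2)"
    and mean: "B.expectation (rw_step f h x 0) = 0"
    and var: "B.variance (rw_step f h x 0) > 0"
    using conj unfolding conjugate_to_centered_random_walk_def random_walk_conjugacy_def by blast
  define V where "V = (\<integral>\<omega>. (rw_step f h x 0 \<omega>)\<^sup>2 \<partial>bernoulli p)"
  have V: "V > 0" using var by (simp add: V_def mean)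
  define s where "s = 1 / sqrt V"
  have s: "s > 0" "s\<^sup>2 * V = 1" "(- s)\<^sup>2 * V = 1" using V by (simp_all add: s_def power_divide)
  note walk = coded_walk_scale[OF full strictly_monotone_imp_inj_on[OF mono] indep ident sq mean, folded V_def]
  note plus = walk[OF s(2)] and minus = walk[OF s(3)]
  have up: "strict_mono_on A (\<lambda>y. s * h y)" "strict_antimono_on A (\<lambda>y. - s * h y)" if "strict_mono_on A h" for A
    using that s(1) by (auto simp: monotone_on_def)
  have down: "strict_mono_on A (\<lambda>y. - s * h y)" "strict_antimono_on A (\<lambda>y. s * h y)" if "strict_antimono_on A h" for A
    using that s(1) by (auto simp: monotone_on_def)
  show "\<exists>H \<nu>. coded_walk p f x H \<nu> \<and> strict_mono_on (orbit f x) H"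
    using mono plus minus up(1) down(1) by blast
  show "\<exists>H \<nu>. coded_walk p f x H \<nu> \<and> strict_antimono_on (orbit f x) H"
    using mono plus minus up(2) down(2) by blast
qed

text \<open>The codes of \<open>y0\<close> and \<open>y1\<close> bound the window in which the threshold \<open>\<gamma>\<close> is hidden.\<close>
lemma arcsine_law_between:
  fixes p :: "'a::countable pmf"
  assumes full: "\<And>a. pmf p a > 0" and conj: "conjugate_to_centered_random_walk p f x"
    and fib: "\<And>n \<omega>. fiber f n \<omega> x \<in> {0..1}"
    and y0: "y0 \<in> orbit f x" "y0 < \<gamma>" and y1: "y1 \<in> orbit f x" "\<gamma> < y1"
  shows "arcsine_law p f \<gamma> x"
proof -
  have orb: "y \<in> {0..1}" if "y \<in> orbit f x" for y using that fib unfolding orbit_def by blast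
  have lim: "occupation_prob p f i \<gamma> x \<alpha> \<longlonglongrightarrow> 2 / pi * arcsin (sqrt \<alpha>)"
    if walk: "coded_walk p f x H \<nu>" and \<alpha>: "\<alpha> \<in> {0<..<1}" and z: "H z0 < H z1"
      and up: "\<And>y. y \<in> orbit f x \<Longrightarrow> H z1 < H y \<Longrightarrow> y \<in> end_interval i \<gamma>"
      and down: "\<And>y. y \<in> orbit f x \<Longrightarrow> y \<in> end_interval i \<gamma> \<Longrightarrow> H z0 \<le> H y" for H \<nu> \<alpha> i z0 z1
  proof -
    interpret coded_walk p f x H \<nu> by (rule walk)
    let ?K = "\<bar>H z0 - H x\<bar> + \<bar>H z1 - H x\<bar>"
    have "(\<lambda>n. measure (bernoulli p) {\<omega>. fiber_average f (indicator (end_interval i \<gamma>)) x n \<omega> \<le> \<alpha>})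
        \<longlonglongrightarrow> 2 / pi * arcsin (sqrt \<alpha>)"
    proof (rule fiber_occupation_limit[where K="?K"])
      show "y \<in> end_interval i \<gamma>" if "y \<in> orbit f x" "?K < H y - H x" for y
      proof (rule up[OF that(1)])
        have "H z1 - H x \<le> ?K" using abs_ge_self[of "H z1 - H x"] abs_ge_zero[of "H z0 - H x"] by linarith
        then show "H z1 < H y" using that(2) by linarith
      qed
      show "- ?K \<le> H y - H x" if "y \<in> orbit f x" "y \<in> end_interval i \<gamma>" for y
      proof -
        have "- ?K \<le> H z0 - H x" using abs_ge_minus_self[of "H z0 - H x"] abs_ge_zero[of "H z1 - H x"] by linarith
        then show ?thesis using down[OF that] by linarith
      qed
    qed (use \<alpha> in auto)
    then show ?thesis unfolding occupation_prob_def by simp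
  qed
  show ?thesis
    unfolding arcsine_law_def
  proof (intro ballI)
    fix \<alpha> :: real and i :: nat assume \<alpha>: "\<alpha> \<in> {0<..<1}" and i: "i \<in> {0, 1}"
    have z: "y0 < y1" using y0(2) y1(2) by simp
    show "occupation_prob p f i \<gamma> x \<alpha> \<longlonglongrightarrow> 2 / pi * arcsin (sqrt \<alpha>)"
    proof (cases "i = 0")
      case True
      obtain H \<nu> where walk: "coded_walk p f x H \<nu>" and mono: "strict_antimono_on (orbit f x) H"
        using conjugacy_coded_walk(2)[OF full conj] by blast
      have less: "H u < H v" if "u \<in> orbit f x" "v \<in> orbit f x" "v < u" for u v
        using monotone_onD[OF mono that(2,1,3)] .
      show ?thesis
      proof (rule lim[OF walk \<alpha>])
        show "H y1 < H y0" by (rule less[OF y1(1) y0(1) z])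
        show "y \<in> end_interval i \<gamma>" if y: "y \<in> orbit f x" "H y0 < H y" for y
        proof -
          have "y \<le> y0" using less[OF y0(1) y(1)] less[OF y(1) y0(1)] y(2) by (cases y0 y rule: linorder_cases) auto
          then show ?thesis using orb[OF y(1)] y0(2) True by (simp add: end_interval_def)
        qed
        show "H y1 \<le> H y" if y: "y \<in> orbit f x" "y \<in> end_interval i \<gamma>" for y
          using less[OF y1(1) y(1)] y(2) y1(2) True by (simp add: end_interval_def)
      qed
    next
      case False
      obtain H \<nu> where walk: "coded_walk p f x H \<nu>" and mono: "strict_mono_on (orbit f x) H"
        using conjugacy_coded_walk(1)[OF full conj] by blast
      have less: "H u < H v" if "u \<in> orbit f x" "v \<in> orbit f x" "u < v" for u v
        using monotone_onD[OF mono that] .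
      show ?thesis
      proof (rule lim[OF walk \<alpha>])
        show "H y0 < H y1" by (rule less[OF y0(1) y1(1) z])
        show "y \<in> end_interval i \<gamma>" if y: "y \<in> orbit f x" "H y1 < H y" for y
        proof -
          have "y1 \<le> y" using less[OF y1(1) y(1)] less[OF y(1) y1(1)] y(2) by (cases y1 y rule: linorder_cases) auto
          then show ?thesis using orb[OF y(1)] y1(2) False by (simp add: end_interval_def)
        qed
        show "H y0 \<le> H y" if y: "y \<in> orbit f x" "y \<in> end_interval i \<gamma>" for y
          using less[OF y0(1) y(1)] y(2) y0(2) False by (simp add: end_interval_def)
      qed
    qed
  qed
qed

section \<open>Occupation frequencies and fibre averages along almost every orbit\<close>

abbreviation lower_average :: "('a \<Rightarrow> real \<Rightarrow> real) \<Rightarrow> real \<Rightarrow> (nat \<Rightarrow> 'a) \<Rightarrow> ereal"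
  where "lower_average f x \<omega> \<equiv> liminf (\<lambda>n. ereal (fiber_average f (\<lambda>y. y) x n \<omega>))"

abbreviation upper_average :: "('a \<Rightarrow> real \<Rightarrow> real) \<Rightarrow> real \<Rightarrow> (nat \<Rightarrow> 'a) \<Rightarrow> ereal"
  where "upper_average f x \<omega> \<equiv> limsup (\<lambda>n. ereal (fiber_average f (\<lambda>y. y) x n \<omega>))"

abbreviation upper_frequency :: "('a \<Rightarrow> real \<Rightarrow> real) \<Rightarrow> nat \<Rightarrow> real \<Rightarrow> real \<Rightarrow> (nat \<Rightarrow> 'a) \<Rightarrow> ereal"
  where "upper_frequency f i \<gamma> x \<omega> \<equiv>
    limsup (\<lambda>n. ereal (fiber_average f (indicator (end_interval i \<gamma>)) x n \<omega>))"

lemma arcsine_value_less_1: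
  assumes "\<alpha> \<in> {0<..<1}" shows "2 / pi * arcsin (sqrt \<alpha>) < 1"
proof -
  have "0 < sqrt \<alpha>" "sqrt \<alpha> < 1" using assms by simp_all
  then have "arcsin (sqrt \<alpha>) < pi / 2" using arcsin_lt_bounded[of "sqrt \<alpha>"] by linarith
  then show ?thesis by (simp add: field_simps)
qed

text \<open>Omitting the first terms of the sums changes the averages by a quantity that tends to 0.\<close>
lemma limsup_average_ge_tail_event:
  fixes p :: "'a::countable pmf" and \<phi> :: "real \<Rightarrow> real"
  assumes \<phi>[measurable]: "\<phi> \<in> borel_measurable borel"
  shows "{\<omega>. ereal \<alpha> \<le> limsup (\<lambda>n. ereal (fiber_average f \<phi> x n \<omega>))}
    \<in> tail_sigma (bernoulli p) (\<lambda>n \<omega>. fiber f n \<omega> x)"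
proof -
  interpret B: prob_space "bernoulli p" by (rule prob_space_bernoulli)
  let ?G = "\<lambda>k. {(\<lambda>\<omega>. fiber f (Suc k) \<omega> x) -` B \<inter> space (bernoulli p) | B. B \<in> sets borel}"
  let ?E = "{\<omega>. ereal \<alpha> \<le> limsup (\<lambda>n. ereal (fiber_average f \<phi> x n \<omega>))}"
  have "?E \<in> sigma_sets (space (bernoulli p)) (\<Union> (?G ` {m..}))" for m
  proof -
    define N where "N = sigma UNIV (\<Union> (?G ` {m..}))"
    have N: "sets N = sigma_sets UNIV (\<Union> (?G ` {m..}))" "space N = UNIV"
      unfolding N_def by (rule sets_measure_of space_measure_of, simp)+
    have X: "(\<lambda>\<omega>. fiber f j \<omega> x) \<in> borel_measurable N" if "j > m" for j
    proof (rule measurableI)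
      fix B :: "real set" assume "B \<in> sets borel"
      moreover have "j = Suc (j - 1)" "m \<le> j - 1" using that by auto
      ultimately have "(\<lambda>\<omega>. fiber f j \<omega> x) -` B \<inter> space (bernoulli p) \<in> \<Union> (?G ` {m..})"
        by (intro UN_I[of "j - 1"]) auto
      then show "(\<lambda>\<omega>. fiber f j \<omega> x) -` B \<inter> space N \<in> sets N"
        unfolding N by (auto intro: sigma_sets.Basic)
    qed simp
    define u where "u n \<omega> = (\<Sum>j\<in>{..<n} \<inter> {..m}. \<phi> (fiber f j \<omega> x)) / real n" for n \<omega>
    define v where "v n \<omega> = (\<Sum>j\<in>{..<n} - {..m}. \<phi> (fiber f j \<omega> x)) / real n" for n \<omega>
    have avg: "ereal (fiber_average f \<phi> x n \<omega>) = ereal (u n \<omega>) + ereal (v n \<omega>)" for n \<omega>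
    proof -
      have "(\<Sum>j<n. \<phi> (fiber f j \<omega> x)) =
          (\<Sum>j\<in>{..<n} \<inter> {..m}. \<phi> (fiber f j \<omega> x)) + (\<Sum>j\<in>{..<n} - {..m}. \<phi> (fiber f j \<omega> x))"
        by (rule sum.Int_Diff) simp
      then show ?thesis by (simp add: fiber_average_def u_def v_def add_divide_distrib)
    qed
    have u0: "(\<lambda>n. ereal (u n \<omega>)) \<longlonglongrightarrow> 0" for \<omega>
    proof -
      have "(\<lambda>n. (\<Sum>j\<in>{..m}. \<phi> (fiber f j \<omega> x)) / real n) \<longlonglongrightarrow> 0" by (rule lim_const_over_n)
      moreover have "eventually (\<lambda>n. (\<Sum>j\<in>{..m}. \<phi> (fiber f j \<omega> x)) / real n = u n \<omega>) sequentially"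
        using eventually_gt_at_top[of m]
      proof eventually_elim
        case (elim n)
        then have "{..<n} \<inter> {..m} = {..m}" by auto
        then show ?case by (simp add: u_def)
      qed
      ultimately have "(\<lambda>n. u n \<omega>) \<longlonglongrightarrow> 0" by (rule Lim_transform_eventually)
      then show ?thesis by (simp add: zero_ereal_def)
    qed
    have "limsup (\<lambda>n. ereal (fiber_average f \<phi> x n \<omega>)) = limsup (\<lambda>n. ereal (v n \<omega>))" for \<omega>
      unfolding avg using ereal_limsup_lim_add[OF u0[of \<omega>], where v="\<lambda>n. ereal (v n \<omega>)"] by simp
    moreover have "v n \<in> borel_measurable N" for n
      unfolding v_def by (intro borel_measurable_divide borel_measurable_sum measurable_compose[OF X \<phi>]
          borel_measurable_const) auto
    then have "(\<lambda>\<omega>. limsup (\<lambda>n. ereal (v n \<omega>))) \<in> borel_measurable N"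
      by (intro borel_measurable_limsup borel_measurable_ereal) 
    then have "{\<omega> \<in> space N. ereal \<alpha> \<le> limsup (\<lambda>n. ereal (v n \<omega>))} \<in> sets N"
      by (intro borel_measurable_le borel_measurable_const)
    ultimately show ?thesis using N by simp
  qed
  then show ?thesis unfolding tail_sigma_def B.tail_events_def by blast
qed

lemma fiber_average_measurable:
  fixes p :: "'a::countable pmf"
  shows "fiber_average f \<phi> x n \<in> borel_measurable (bernoulli p)"
  unfolding fiber_average_def
  by (intro borel_measurable_divide borel_measurable_sum measurable_fiber_borel borel_measurable_const)

text \<open>The event that the frequency exceeds \<open>\<alpha>\<close> infinitely often has at least the limiting probability of a single
  excess, which the arcsine law bounds away from 0; tail triviality raises it to 1.\<close>
lemma limsup_occupation_ge:
  fixes p :: "'a::countable pmf"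
  assumes walk: "coded_walk p f x H \<nu>" and arc: "arcsine_law p f \<gamma> x"
    and i: "i \<in> {0, 1}" and \<alpha>: "\<alpha> \<in> {0<..<1}"
  shows "AE \<omega> in bernoulli p. ereal \<alpha> \<le> upper_frequency f i \<gamma> x \<omega>"
proof -
  interpret coded_walk p f x H \<nu> by (rule walk)
  let ?o = "\<lambda>n \<omega>. fiber_average f (indicator (end_interval i \<gamma>)) x n \<omega>"
  let ?E = "{\<omega>. ereal \<alpha> \<le> upper_frequency f i \<gamma> x \<omega>}"
  have "end_interval i \<gamma> \<in> sets borel" by (simp add: end_interval_def)
  then have "indicator (end_interval i \<gamma>) \<in> borel_measurable (borel :: real measure)" by simp
  from tail_trivial[OF limsup_average_ge_tail_event[OF this]]
  have dich: "measure (bernoulli p) ?E = 0 \<or> measure (bernoulli p) ?E = 1" .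
  have E: "?E \<in> sets (bernoulli p)"
  proof -
    have "(\<lambda>\<omega>. upper_frequency f i \<gamma> x \<omega>) \<in> borel_measurable (bernoulli p)"
      by (intro borel_measurable_limsup borel_measurable_ereal fiber_average_measurable)
    from borel_measurable_le[OF borel_measurable_const this, of "ereal \<alpha>"] show ?thesis by simp
  qed
  define A where "A n = {\<omega>. \<alpha> < ?o n \<omega>}" for n
  have A: "A n \<in> sets (bernoulli p)" for n
  proof -
    have "{\<omega> \<in> space (bernoulli p). \<alpha> < ?o n \<omega>} \<in> sets (bernoulli p)"
      by (rule borel_measurable_less[OF borel_measurable_const fiber_average_measurable])
    then show ?thesis by (simp add: A_def)
  qed
  have PA: "measure (bernoulli p) (A n) = 1 - occupation_prob p f i \<gamma> x \<alpha> n" for n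
  proof -
    have "occupation_prob p f i \<gamma> x \<alpha> n = measure (bernoulli p) (space (bernoulli p) - A n)"
      unfolding occupation_prob_def A_def by (intro arg_cong2[where f=measure]) auto
    then show ?thesis using B.prob_compl[OF A, of n] by simp
  qed
  define U where "U m = (\<Union>n\<in>{m..}. A n)" for m
  have U: "U m \<in> sets (bernoulli p)" for m unfolding U_def using A by (intro sets.countable_UN'') auto
  have "decseq U" unfolding decseq_def U_def by force
  then have "(\<lambda>m. measure (bernoulli p) (U m)) \<longlonglongrightarrow> measure (bernoulli p) (\<Inter>m. U m)"
    using U by (intro B.finite_Lim_measure_decseq) auto
  moreover have "(\<lambda>m. 1 - occupation_prob p f i \<gamma> x \<alpha> m) \<longlonglongrightarrow> 1 - 2 / pi * arcsin (sqrt \<alpha>)"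
    using arc i \<alpha> unfolding arcsine_law_def by (intro tendsto_diff tendsto_const) auto
  moreover have "1 - occupation_prob p f i \<gamma> x \<alpha> m \<le> measure (bernoulli p) (U m)" for m
    unfolding PA[symmetric] using U by (intro B.finite_measure_mono) (auto simp: U_def)
  ultimately have "1 - 2 / pi * arcsin (sqrt \<alpha>) \<le> measure (bernoulli p) (\<Inter>m. U m)"
    by (intro LIMSEQ_le) auto
  also have "\<dots> \<le> measure (bernoulli p) ?E"
  proof (rule B.finite_measure_mono[OF _ E])
    show "(\<Inter>m. U m) \<subseteq> ?E"
    proof
      fix \<omega> assume \<omega>: "\<omega> \<in> (\<Inter>m. U m)"
      show "\<omega> \<in> ?E"
      proof (rule ccontr)
        assume "\<omega> \<notin> ?E"
        then have "upper_frequency f i \<gamma> x \<omega> < ereal \<alpha>" by (simp add: not_le)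
        then have "eventually (\<lambda>n. ereal (?o n \<omega>) < ereal \<alpha>) sequentially" by (rule Limsup_lessD)
        then obtain m where m: "\<And>n. n \<ge> m \<Longrightarrow> ?o n \<omega> < \<alpha>" unfolding eventually_sequentially by auto
        from \<omega> have "\<omega> \<in> U m" by blast
        then obtain n where "n \<ge> m" "\<alpha> < ?o n \<omega>" unfolding U_def A_def by auto
        with m[of n] show False by simp
      qed
    qed
  qed
  finally have "1 - 2 / pi * arcsin (sqrt \<alpha>) \<le> measure (bernoulli p) ?E" .
  then have "measure (bernoulli p) ?E = 1" using dich arcsine_value_less_1[OF \<alpha>] by linarith
  then show ?thesis using B.prob_Collect_eq_1[of "\<lambda>\<omega>. \<omega> \<in> ?E"] E by simp
qed

lemma limsup_occupation_eq_1:
  fixes p :: "'a::countable pmf"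
  assumes walk: "coded_walk p f x H \<nu>" and arc: "arcsine_law p f \<gamma> x" and i: "i \<in> {0, 1}"
  shows "AE \<omega> in bernoulli p. 1 \<le> upper_frequency f i \<gamma> x \<omega>"
proof -
  let ?\<alpha> = "\<lambda>k::nat. 1 - 1 / real (k + 2)"
  have "AE \<omega> in bernoulli p. \<forall>k. ereal (?\<alpha> k) \<le> upper_frequency f i \<gamma> x \<omega>"
    unfolding AE_all_countable by (intro allI limsup_occupation_ge[OF walk arc i]) simp
  then show ?thesis
  proof eventually_elim
    case (elim \<omega>)
    have "(\<lambda>k. 1 - 1 / real (k + 2)) \<longlonglongrightarrow> 1 - 0"
      by (intro tendsto_diff tendsto_const LIMSEQ_ignore_initial_segment[OF lim_const_over_n])
    then have "(\<lambda>k. ereal (?\<alpha> k)) \<longlonglongrightarrow> 1" by (simp add: one_ereal_def)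
    then show ?case by (rule LIMSEQ_le_const2) (use elim in blast)
  qed
qed

lemma frequently_occupation:
  assumes "1 \<le> limsup (\<lambda>n. ereal (o' n))" and "\<alpha> < 1" and "eventually P sequentially"
  shows "\<exists>n>0. P n \<and> \<alpha> < o' n"
proof (rule ccontr)
  assume *: "\<not> ?thesis"
  have "eventually (\<lambda>n. ereal (o' n) \<le> ereal \<alpha>) sequentially"
    using assms(3) eventually_gt_at_top[of 0]
  proof eventually_elim
    case (elim n)
    then show ?case using * by force
  qed
  then have "limsup (\<lambda>n. ereal (o' n)) \<le> ereal \<alpha>" by (rule Limsup_bounded)
  then have "1 \<le> ereal \<alpha>" using assms(1) by (rule order_trans[rotated])
  then show False using assms(2) by simp
qed

text \<open>While the orbit spends almost all its time in \<open>{0..\<gamma>}\<close>, its average is hardly larger than \<open>\<gamma>\<close>.\<close>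
lemma liminf_average_le:
  assumes fib: "\<And>n. fiber f n \<omega> x \<in> {0..1}" and \<gamma>: "\<gamma> \<in> {0<..<1}"
    and occ: "1 \<le> upper_frequency f 0 \<gamma> x \<omega>"
  shows "lower_average f x \<omega> \<le> ereal \<gamma>"
proof (rule ccontr)
  let ?o = "fiber_average f (indicator (end_interval 0 \<gamma>)) x"
  let ?a = "fiber_average f (\<lambda>y. y) x"
  assume "\<not> ?thesis"
  then have "ereal \<gamma> < lower_average f x \<omega>" by (simp add: not_le)
  then obtain z where z: "ereal \<gamma> < ereal z" "ereal z < lower_average f x \<omega>"
    using ereal_dense2 by blast
  from less_LiminfD[OF z(2)] have ev: "eventually (\<lambda>n. z < ?a n \<omega>) sequentially" by simp
  \<comment> \<open>A frequency above \<open>1 - (z - \<gamma>)\<close> already forces the average below \<open>z\<close>.\<close>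
  have "1 - (z - \<gamma>) < 1" using z(1) by simp
  from frequently_occupation[OF occ this ev] obtain n where n: "n > 0" "z < ?a n \<omega>" "1 - (z - \<gamma>) < ?o n \<omega>"
    by blast
  have "(\<Sum>j<n. fiber f j \<omega> x) \<le> (\<Sum>j<n. 1 - (1 - \<gamma>) * indicator (end_interval 0 \<gamma>) (fiber f j \<omega> x))"
    using fib by (intro sum_mono) (auto simp: end_interval_def indicator_def)
  also have "\<dots> = n - (1 - \<gamma>) * (\<Sum>j<n. indicator (end_interval 0 \<gamma>) (fiber f j \<omega> x))"
    by (simp add: sum_subtractf sum_distrib_left)
  finally have "?a n \<omega> \<le> (n - (1 - \<gamma>) * (\<Sum>j<n. indicator (end_interval 0 \<gamma>) (fiber f j \<omega> x))) / n"
    unfolding fiber_average_def by (rule divide_right_mono) simp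
  also have "\<dots> = 1 - (1 - \<gamma>) * ?o n \<omega>"
    using n(1) by (simp add: fiber_average_def diff_divide_distrib)
  also have "\<dots> \<le> 1 - (1 - \<gamma>) * (1 - (z - \<gamma>))"
    using n(3) \<gamma> by (intro diff_left_mono mult_left_mono) auto
  also have "\<dots> = z - \<gamma> * (z - \<gamma>)" by (simp add: algebra_simps)
  also have "\<dots> \<le> z" using \<gamma> z(1) by simp
  finally show False using n(2) by simp
qed

lemma limsup_average_ge:
  assumes fib: "\<And>n. fiber f n \<omega> x \<in> {0..1}" and \<gamma>: "\<gamma> \<in> {0<..<1}"
    and occ: "1 \<le> upper_frequency f 1 \<gamma> x \<omega>"
  shows "ereal \<gamma> \<le> upper_average f x \<omega>"
proof (rule ccontr)
  let ?o = "fiber_average f (indicator (end_interval 1 \<gamma>)) x"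
  let ?a = "fiber_average f (\<lambda>y. y) x"
  assume "\<not> ?thesis"
  then have "upper_average f x \<omega> < ereal \<gamma>" by (simp add: not_le)
  then obtain z where z: "upper_average f x \<omega> < ereal z" "ereal z < ereal \<gamma>"
    using ereal_dense2 by blast
  from Limsup_lessD[OF z(1)] have ev: "eventually (\<lambda>n. ?a n \<omega> < z) sequentially" by simp
  have "z / \<gamma> < 1" using z(2) \<gamma> by simp
  from frequently_occupation[OF occ this ev] obtain n where n: "n > 0" "?a n \<omega> < z" "z / \<gamma> < ?o n \<omega>"
    by blast
  have "\<gamma> * (\<Sum>j<n. indicator (end_interval 1 \<gamma>) (fiber f j \<omega> x)) \<le> (\<Sum>j<n. fiber f j \<omega> x)"
    unfolding sum_distrib_left using fib by (intro sum_mono) (auto simp: end_interval_def indicator_def)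
  then have "\<gamma> * (\<Sum>j<n. indicator (end_interval 1 \<gamma>) (fiber f j \<omega> x)) / n \<le> ?a n \<omega>"
    unfolding fiber_average_def by (rule divide_right_mono) simp
  then have "\<gamma> * ?o n \<omega> \<le> ?a n \<omega>" by (simp add: fiber_average_def)
  moreover have "z < \<gamma> * ?o n \<omega>" using n(3) \<gamma> by (simp add: pos_divide_less_eq mult.commute)
  ultimately show False using n(2) by simp
qed

section \<open>Orbits of monotone fibre maps\<close>

text \<open>The fibre maps need not be continuous, so the supremum \<open>s\<close> of the orbit is not an invariant of the dynamics.
  Monotonicity alone gives that a letter moving \<open>s\<close> down moves the entire orbit below \<open>f b s\<close>, and
  this contradicts \<open>no_bounded_step\<close>.\<close>
lemma orbit_spreads:
  fixes p :: "'a::countable pmf"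
  assumes full: "\<And>a. pmf p a > 0" and conj: "conjugate_to_centered_random_walk p f x"
    and x: "x \<in> {0<..<1}"
    and maps: "\<And>a y. y \<in> {0<..<1} \<Longrightarrow> f a y \<in> {0<..<1}"
    and mono: "\<And>a y z. y \<in> {0<..<1} \<Longrightarrow> z \<in> {0<..<1} \<Longrightarrow> y \<le> z \<Longrightarrow> f a y \<le> f a z"
    and down: "\<And>y. y \<in> {0<..<1} \<Longrightarrow> \<exists>a. f a y < y" and up: "\<And>y. y \<in> {0<..<1} \<Longrightarrow> \<exists>a. y < f a y"
    and \<gamma>: "\<gamma> \<in> {0<..<1}"
  shows "\<exists>y\<in>orbit f x. y < \<gamma>" and "\<exists>y\<in>orbit f x. \<gamma> < y"
proof -
  have fib: "fiber f n \<omega> x \<in> {0<..<1}" for n \<omega>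
    by (induction n) (use x maps in auto)
  then have orb: "y \<in> {0<..<1}" if "y \<in> orbit f x" for y using that unfolding orbit_def by blast
  have ne: "orbit f x \<noteq> {}" using self_in_orbit[of x f] by blast
  have bdd: "bdd_above (orbit f x)" "bdd_below (orbit f x)"
    using orb by (auto intro!: bdd_aboveI[of _ 1] bdd_belowI[of _ 0] less_imp_le)
  show "\<exists>y\<in>orbit f x. \<gamma> < y"
  proof (rule ccontr)
    assume "\<not> ?thesis"
    then have le: "\<And>y. y \<in> orbit f x \<Longrightarrow> y \<le> \<gamma>" by (meson not_le)
    define s where "s = Sup (orbit f x)"
    have "s \<le> \<gamma>" unfolding s_def by (rule cSup_least[OF ne le])
    moreover have xs: "y \<le> s" if "y \<in> orbit f x" for y unfolding s_def by (rule cSup_upper[OF that bdd(1)])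
    ultimately have s: "s \<in> {0<..<1}" using x \<gamma> xs[OF self_in_orbit] by auto
    obtain b where b: "f b s < s" using down[OF s] by blast
    then obtain z where z: "z \<in> orbit f x" "f b s < z"
      unfolding s_def using less_cSup_iff[OF ne bdd(1)] by blast
    obtain H \<nu> where walk: "coded_walk p f x H \<nu>" and H: "strict_mono_on (orbit f x) H"
      using conjugacy_coded_walk(1)[OF full conj] by blast
    obtain y where y: "y \<in> orbit f x" "H (f b y) > H z"
      using coded_walk.no_bounded_step[OF walk] by blast
    have "f b y \<le> f b s" by (rule mono[OF orb[OF y(1)] s xs[OF y(1)]])
    then have "f b y < z" using z(2) by linarith
    from monotone_onD[OF H step_in_orbit[OF y(1)] z(1) this] show False using y(2) by simp
  qed
  show "\<exists>y\<in>orbit f x. y < \<gamma>"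
  proof (rule ccontr)
    assume "\<not> ?thesis"
    then have ge: "\<And>y. y \<in> orbit f x \<Longrightarrow> \<gamma> \<le> y" by (meson not_le)
    define s where "s = Inf (orbit f x)"
    have "\<gamma> \<le> s" unfolding s_def by (rule cInf_greatest[OF ne ge])
    moreover have xs: "s \<le> y" if "y \<in> orbit f x" for y unfolding s_def by (rule cInf_lower[OF that bdd(2)])
    ultimately have s: "s \<in> {0<..<1}" using x \<gamma> xs[OF self_in_orbit] by auto
    obtain b where b: "s < f b s" using up[OF s] by blast
    then obtain z where z: "z \<in> orbit f x" "z < f b s"
      unfolding s_def using cInf_less_iff[OF ne bdd(2)] by blast
    obtain H \<nu> where walk: "coded_walk p f x H \<nu>" and H: "strict_antimono_on (orbit f x) H"
      using conjugacy_coded_walk(2)[OF full conj] by blast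
    obtain y where y: "y \<in> orbit f x" "H (f b y) > H z"
      using coded_walk.no_bounded_step[OF walk] by blast
    have "f b s \<le> f b y" by (rule mono[OF s orb[OF y(1)] xs[OF y(1)]])
    then have "z < f b y" using z(2) by linarith
    from monotone_onD[OF H z(1) step_in_orbit[OF y(1)] this] show False using y(2) by simp
  qed
qed

section \<open>Historical behavior\<close>

text \<open>Joint measurability is needed to exchange the null sets in the product; it rests on the countability of the alphabet.\<close>
lemma measurable_fiber_joint:
  fixes p :: "'a::countable pmf"
  assumes f: "\<And>a. f a \<in> restrict_space borel {0..1} \<rightarrow>\<^sub>M restrict_space borel {0..1::real}"
  shows "(\<lambda>z. fiber f n (fst z) (snd z)) \<in>
    bernoulli p \<Otimes>\<^sub>M restrict_space lborel {0..1} \<rightarrow>\<^sub>M restrict_space borel {0..1}"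
proof (induction n)
  case 0
  have "snd \<in> bernoulli p \<Otimes>\<^sub>M restrict_space lborel {0..1::real} \<rightarrow>\<^sub>M restrict_space lborel {0..1}"
    by (rule measurable_snd)
  also have "bernoulli p \<Otimes>\<^sub>M restrict_space lborel {0..1::real} \<rightarrow>\<^sub>M restrict_space lborel {0..1} =
      bernoulli p \<Otimes>\<^sub>M restrict_space lborel {0..1} \<rightarrow>\<^sub>M restrict_space borel {0..1}"
    by (rule measurable_cong_sets[OF refl sets_restrict_space_cong]) (rule sets_lborel)
  finally show ?case by (simp only: fiber.simps id_apply)
next
  case (Suc n)
  have coord: "(\<lambda>z. fst z n) \<in> bernoulli p \<Otimes>\<^sub>M restrict_space lborel {0..1::real} \<rightarrow>\<^sub>M count_space UNIV"
    by (rule measurable_compose[OF measurable_fst measurable_letter])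
  have "(\<lambda>z. f a (fiber f n (fst z) (snd z))) \<in>
      bernoulli p \<Otimes>\<^sub>M restrict_space lborel {0..1} \<rightarrow>\<^sub>M restrict_space borel {0..1}" for a
    by (rule measurable_compose[OF Suc.IH f])
  from measurable_compose_countable[OF this coord] show ?case by simp
qed

lemma not_convergent_if_liminf_less_limsup:
  fixes u :: "nat \<Rightarrow> real"
  assumes "liminf (\<lambda>n. ereal (u n)) < limsup (\<lambda>n. ereal (u n))"
  shows "\<not> convergent u"
proof
  assume "convergent u"
  then obtain L where "u \<longlonglongrightarrow> L" unfolding convergent_def by blast
  then have "(\<lambda>n. ereal (u n)) \<longlonglongrightarrow> ereal L" by simp
  from lim_imp_Liminf[OF _ this] lim_imp_Limsup[OF _ this] show False using assms by simp
qed

text \<open>The identity serves as the continuous function for every pair, so the exceptional set lies in a measurable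
  set whose sections are null.\<close>
lemma historical_behavior_if_liminf_less_limsup:
  fixes p :: "'a::countable pmf"
  assumes f: "\<And>a. f a \<in> restrict_space borel {0..1} \<rightarrow>\<^sub>M restrict_space borel {0..1::real}"
    and less: "\<And>x. x \<in> {0<..<1} \<Longrightarrow> AE \<omega> in bernoulli p.
      lower_average f x \<omega> < upper_average f x \<omega>"
  shows "historical_behavior_ae p f"
proof -
  let ?L = "restrict_space lborel {0..1::real}"
  let ?P = "\<lambda>\<omega> x. lower_average f x \<omega> < upper_average f x \<omega>"
  interpret B: prob_space "bernoulli p" by (rule prob_space_bernoulli)
  have "finite_measure ?L"
    by (rule finite_measureI) (simp add: emeasure_restrict_space space_restrict_space)
  then interpret L: finite_measure ?L .
  interpret BL: pair_sigma_finite "bernoulli p" ?L ..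
  have fib: "(\<lambda>z. fiber f n (fst z) (snd z)) \<in> borel_measurable (bernoulli p \<Otimes>\<^sub>M ?L)" for n
    using measurable_fiber_joint[where p=p and n=n, OF f] by (simp add: measurable_restrict_space2_iff)
  then have avg: "(\<lambda>z. ereal (fiber_average f (\<lambda>y. y) (snd z) n (fst z))) \<in> borel_measurable (bernoulli p \<Otimes>\<^sub>M ?L)" for n
    unfolding fiber_average_def
    by (intro borel_measurable_ereal borel_measurable_divide borel_measurable_sum borel_measurable_const)
  have meas: "{z \<in> space (bernoulli p \<Otimes>\<^sub>M ?L). ?P (fst z) (snd z)} \<in> sets (bernoulli p \<Otimes>\<^sub>M ?L)"
    by (intro borel_measurable_less borel_measurable_liminf borel_measurable_limsup avg)
  have "AE x in lborel. x \<noteq> 0 \<and> x \<noteq> (1::real)"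
    by (intro AE_conjI AE_lborel_singleton)
  then have "AE x in lborel. x \<in> {0..1} \<longrightarrow> (AE \<omega> in bernoulli p. ?P \<omega> x)"
  proof eventually_elim
    case (elim x)
    show ?case
    proof
      assume "x \<in> {0..1}"
      then have "x \<in> {0<..<1}" using elim by auto
      then show "AE \<omega> in bernoulli p. ?P \<omega> x" by (rule less)
    qed
  qed
  then have "AE x in ?L. AE \<omega> in bernoulli p. ?P \<omega> x"
    by (subst AE_restrict_space_iff) simp_all
  then have "AE \<omega> in bernoulli p. AE x in ?L. ?P \<omega> x"
    by (rule BL.AE_commute[OF meas, THEN iffD2])
  then have "AE z in bernoulli p \<Otimes>\<^sub>M ?L. ?P (fst z) (snd z)"
    by (intro BL.AE_pair_measure[where P="\<lambda>z. ?P (fst z) (snd z)", OF meas]) (simp only: fst_conv snd_conv)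
  then show ?thesis
    unfolding historical_behavior_ae_def
  proof eventually_elim
    case (elim z)
    have "continuous_on {0..1} (\<lambda>y::real. y)" by (rule continuous_on_id)
    moreover have "\<not> convergent (\<lambda>n. fiber_average f (\<lambda>y. y) (snd z) n (fst z))"
      by (rule not_convergent_if_liminf_less_limsup[OF elim])
    ultimately show ?case unfolding case_prod_beta by blast
  qed
qed

lemma pointwise_fluctuation_law_if_arcsine:
  assumes arc: "\<And>\<gamma>. \<gamma> \<in> {0<..<1} \<Longrightarrow> arcsine_law p f \<gamma> x" and x: "x \<in> {0<..<1}"
    and \<gamma>: "\<gamma>0 \<in> {0<..<1}" "\<gamma>1 \<in> {0<..<1}"
  shows "pointwise_fluctuation_law p f \<gamma>0 \<gamma>1"
proof -
  have "liminf (\<lambda>n. ereal (occupation_prob p f i \<gamma> x \<alpha> n)) < 1"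
    if "\<gamma> \<in> {0<..<1}" "\<alpha> \<in> {0<..<1}" "i \<in> {0, 1}" for \<gamma> \<alpha> i
  proof -
    have "(\<lambda>n. occupation_prob p f i \<gamma> x \<alpha> n) \<longlonglongrightarrow> 2 / pi * arcsin (sqrt \<alpha>)"
      using arc[OF that(1)] that(2,3) unfolding arcsine_law_def by blast
    then have "(\<lambda>n. ereal (occupation_prob p f i \<gamma> x \<alpha> n)) \<longlonglongrightarrow> ereal (2 / pi * arcsin (sqrt \<alpha>))" by simp
    then have "liminf (\<lambda>n. ereal (occupation_prob p f i \<gamma> x \<alpha> n)) = ereal (2 / pi * arcsin (sqrt \<alpha>))"
      by (intro lim_imp_Liminf) simp_all
    then show ?thesis using arcsine_value_less_1[OF that(2)] by simp
  qed
  then show ?thesis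
    unfolding pointwise_fluctuation_law_def using x \<gamma> by blast
qed

theorem proposition1:
  fixes p :: "'a::countable pmf" and f :: "'a \<Rightarrow> real \<Rightarrow> real"
  assumes "\<And>a. pmf p a > 0"
    and "\<And>a. f a \<in> restrict_space borel {0..1} \<rightarrow>\<^sub>M restrict_space borel {0..1}"
    and "\<And>x. x \<in> {0<..<1} \<Longrightarrow> conjugate_to_centered_random_walk p f x"
  shows
    "(\<forall>x\<in>{0<..<1}. \<forall>A \<in> tail_sigma (bernoulli p) (\<lambda>n \<omega>. fiber f n \<omega> x).
        measure (bernoulli p) A = 0 \<or> measure (bernoulli p) A = 1) \<and>
     (\<forall>\<gamma>\<in>{0<..<1}. \<forall>x\<in>{0<..<1}.
        Inf (orbit f x) < \<gamma> \<and> \<gamma> < Sup (orbit f x) \<longrightarrow> arcsine_law p f \<gamma> x) \<and>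
     ((\<forall>\<omega>::nat \<Rightarrow> 'a.
         f (\<omega> 0) \<in> restrict_space borel {0<..<1} \<rightarrow>\<^sub>M restrict_space borel {0<..<1} \<and>
         mono_on {0<..<1} (f (\<omega> 0))) \<longrightarrow>
      (\<forall>x\<in>{0<..<1}. \<exists>(\<alpha> :: nat \<Rightarrow> 'a) (\<beta> :: nat \<Rightarrow> 'a). f (\<alpha> 0) x < x \<and> x < f (\<beta> 0) x) \<longrightarrow>
      (\<forall>\<gamma>\<in>{0<..<1}. \<forall>x\<in>{0<..<1}. arcsine_law p f \<gamma> x) \<and>
      (\<exists>\<gamma>0 \<gamma>1. \<gamma>0 < \<gamma>1 \<and> pointwise_fluctuation_law p f \<gamma>0 \<gamma>1) \<and>
      (\<forall>\<gamma>0 \<gamma>1. \<gamma>0 < \<gamma>1 \<and> pointwise_fluctuation_law p f \<gamma>0 \<gamma>1 \<longrightarrow>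
        (\<forall>x\<in>{0<..<1}. AE \<omega> in bernoulli p.
           liminf (\<lambda>n. ereal (fiber_average f (\<lambda>y. y) x n \<omega>)) \<le> ereal \<gamma>0 \<and>
           ereal \<gamma>1 \<le> limsup (\<lambda>n. ereal (fiber_average f (\<lambda>y. y) x n \<omega>)))) \<and>
      historical_behavior_ae p f)"
    (is "?tail \<and> ?arcsine \<and> (?b \<longrightarrow> ?c \<longrightarrow> ?arcsine_all \<and> ?exists \<and> ?averages \<and> ?historical)")
proof -
  note full = assms(1) and conj = assms(3)
  have unit: "f a y \<in> {0..1}" if "y \<in> {0..1}" for a y
    using measurable_space[OF assms(2)[of a], of y] that by (simp add: space_restrict_space)
  have fib: "fiber f n \<omega> x \<in> {0..1}" if "x \<in> {0<..<1}" for n \<omega> x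
    by (induction n) (use that unit in auto)
  have walk: "\<exists>H \<nu>. coded_walk p f x H \<nu>" if "x \<in> {0<..<1}" for x
    using conjugacy_coded_walk(1)[OF full conj[OF that]] by blast
  have ?tail
  proof (intro ballI)
    fix x A assume x: "x \<in> {0<..<1::real}" and A: "A \<in> tail_sigma (bernoulli p) (\<lambda>n \<omega>. fiber f n \<omega> x)"
    obtain H \<nu> where "coded_walk p f x H \<nu>" using walk[OF x] by blast
    from coded_walk.tail_trivial[OF this A]
    show "measure (bernoulli p) A = 0 \<or> measure (bernoulli p) A = 1" .
  qed
  moreover have ?arcsine
  proof (intro ballI impI, elim conjE)
    fix \<gamma> x :: real assume x: "x \<in> {0<..<1}" and *: "Inf (orbit f x) < \<gamma>" "\<gamma> < Sup (orbit f x)"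
    have orb: "y \<in> {0..1}" if "y \<in> orbit f x" for y using that fib[OF x] unfolding orbit_def by blast
    have ne: "orbit f x \<noteq> {}" using self_in_orbit[of x f] by blast
    have bdd: "bdd_above (orbit f x)" "bdd_below (orbit f x)"
      using orb by (auto intro!: bdd_aboveI[of _ 1] bdd_belowI[of _ 0])
    obtain y0 y1 where "y0 \<in> orbit f x" "y0 < \<gamma>" "y1 \<in> orbit f x" "\<gamma> < y1"
      using * cInf_less_iff[OF ne bdd(2)] less_cSup_iff[OF ne bdd(1)] by blast
    then show "arcsine_law p f \<gamma> x"
      by (rule arcsine_law_between[OF full conj[OF x] fib[OF x]])
  qed
  moreover have "?arcsine_all \<and> ?exists \<and> ?averages \<and> ?historical" if b: ?b and c: ?c
  proof -
    have fb: "f a \<in> restrict_space borel {0<..<1} \<rightarrow>\<^sub>M restrict_space borel {0<..<1}" "mono_on {0<..<1} (f a)" for a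
      using b[rule_format, of "\<lambda>_. a"] by auto
    have maps: "f a y \<in> {0<..<1}" if "y \<in> {0<..<1}" for a y
      using measurable_space[OF fb(1)[of a], of y] that by (simp add: space_restrict_space)
    have mono: "f a y \<le> f a z" if "y \<in> {0<..<1}" "z \<in> {0<..<1}" "y \<le> z" for a y z
      using monotone_onD[OF fb(2) that] .
    have down: "\<exists>a. f a y < y" and up: "\<exists>a. y < f a y" if "y \<in> {0<..<1}" for y
      using c that by blast+
    have arc: "arcsine_law p f \<gamma> x" if \<gamma>: "\<gamma> \<in> {0<..<1}" and x: "x \<in> {0<..<1}" for \<gamma> x
    proof -
      obtain y0 y1 where "y0 \<in> orbit f x" "y0 < \<gamma>" "y1 \<in> orbit f x" "\<gamma> < y1"
        using orbit_spreads[OF full conj[OF x] x maps mono down up \<gamma>] by blast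
      then show ?thesis by (rule arcsine_law_between[OF full conj[OF x] fib[OF x]])
    qed
    have avg: "AE \<omega> in bernoulli p.
        lower_average f x \<omega> \<le> ereal \<gamma>0 \<and>
        ereal \<gamma>1 \<le> upper_average f x \<omega>"
      if \<gamma>: "\<gamma>0 \<in> {0<..<1}" "\<gamma>1 \<in> {0<..<1}" and x: "x \<in> {0<..<1}" for \<gamma>0 \<gamma>1 x
    proof -
      obtain H \<nu> where w: "coded_walk p f x H \<nu>" using walk[OF x] by blast
      have "AE \<omega> in bernoulli p. 1 \<le> upper_frequency f 0 \<gamma>0 x \<omega>"
        "AE \<omega> in bernoulli p. 1 \<le> upper_frequency f 1 \<gamma>1 x \<omega>"
        by (rule limsup_occupation_eq_1[OF w arc[OF _ x]], use \<gamma> in simp_all)+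
      then show ?thesis
      proof eventually_elim
        case (elim \<omega>)
        show ?case
          using liminf_average_le[OF fib[OF x] \<gamma>(1) elim(1)] limsup_average_ge[OF fib[OF x] \<gamma>(2) elim(2)] by blast
      qed
    qed
    have ?arcsine_all using arc by blast
    moreover have ?exists
    proof (intro exI conjI)
      show "(1/3 :: real) < 2/3" by simp
      show "pointwise_fluctuation_law p f (1/3) (2/3)"
        by (rule pointwise_fluctuation_law_if_arcsine[where x="1/2"]) (auto intro: arc)
    qed
    moreover have ?averages
      using avg unfolding pointwise_fluctuation_law_def by blast
    moreover have ?historical
    proof (rule historical_behavior_if_liminf_less_limsup[OF assms(2)])
      fix x :: real assume x: "x \<in> {0<..<1}"
      have "AE \<omega> in bernoulli p.
        lower_average f x \<omega> \<le> ereal (1/3) \<and>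
        ereal (2/3) \<le> upper_average f x \<omega>"
        by (rule avg[OF _ _ x]) simp_all
      then show "AE \<omega> in bernoulli p. lower_average f x \<omega> <
          upper_average f x \<omega>"
      proof eventually_elim
        case (elim \<omega>)
        have "ereal (1/3) < ereal (2/3)" by simp
        then show ?case using elim by (meson le_less_trans less_le_trans)
      qed
    qed
    ultimately show ?thesis by blast
  qed
  ultimately show ?thesis by blast
qed

end
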